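(* Let $A$ be a bounded linear operator on a complex Hilbert space. Let $c_0,c_1\in\mathbb R$ and $r_0,r_1>0$ satisfy $$c_0-r_0<c_1-r_1<c_0+r_0<c_1+r_1\qquad\text{and}\qquad 0<c_0+r_0 .$$ Suppose that the numerical range $W(A)$ is contained in the closed disk of radius $r_1$ centered at $c_1$, and that $A-c_0$ is invertible with $W((A-c_0)^{-1})$ contained in the closed disk of radius $1/r_0$ centered at $0$. Let $$E=\{z\in\mathbb C : |z-c_1|\le r_1 \text{ and } |z-c_0|\ge r_0\}$$ (a lens-shaped simply connected set not containing $0$). Let $a$ be the intersection point with positive imaginary part of the circles $|z-c_0|=r_0$ and $|z-c_1|=r_1$ (an endpoint of the two circular arcs composing $\partial E$), and let $\theta_0=\arg(a-c_0)$, $\theta_1=\arg(a-c_1)$ and $\arg a$ be the arguments taken in $(0,\pi)$. Let $F_n$ be the $n$th Faber polynomial of $E$, let $\Phi$ be the normalized exterior Riemann map of $E$, and let $\gamma=1/|\Phi(0)|$. Then $$\|F_n(A)\|\le 2+\frac{4\theta_0}{\pi}\quad\text{for every integer } n\ge1,$$ and $$\gamma=\frac{\sin\!\Big(\dfrac{\pi\arg a}{2\pi-\theta_1+\theta_0}\Big)}{\sin\!\Big(\dfrac{\pi(\pi+\theta_0-\arg a)}{2\pi-\theta_1+\theta_0}\Big)} .$$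
   Context: $\|\cdot\|$ is the operator norm. The numerical range of a bounded operator $T$ on a Hilbert space $\mathcal H$ is $W(T)=\{\langle Tu,u\rangle : u\in\mathcal H,\ \|u\|=1\}$. For a compact $E\subset\mathbb C$ whose boundary is a rectifiable Jordan curve, the normalized exterior Riemann map $\Phi$ sends the exterior of $E$ conformally onto the exterior of the closed unit disk, with $\Phi(\infty)=\infty$ and $\Phi'(\infty)>0$. The $n$th Faber polynomial $F_n=F_n^E$ is the polynomial part of the Laurent expansion of $\Phi^n$ at infinity, i.e. the polynomial satisfying $F_n(z)=\Phi(z)^n+O(1/z)$ as $z\to\infty$. *)

theory Defs
  imports "HOL-Complex_Analysis.Complex_Analysis" "HOL-Library.Landau_Symbols"
begin

text \<open>
  A complex inner product is put on top of the class of real normed vector spaces, so that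
  the existing notions \<^const>\<open>bounded_linear\<close> and \<^const>\<open>onorm\<close> apply.
  The inner product is linear in its first argument.
  The last axiom says that the norm is the one induced by the inner product; it also contains
  positive definiteness.
\<close>

class complex_inner = real_normed_vector +
  fixes scaleC :: "complex \<Rightarrow> 'a \<Rightarrow> 'a" (infixr "*\<^sub>C" 75)
    and cinner :: "'a \<Rightarrow> 'a \<Rightarrow> complex"
  assumes scaleC_add_right: "c *\<^sub>C (x + y) = c *\<^sub>C x + c *\<^sub>C y"
    and scaleC_add_left: "(c + d) *\<^sub>C x = c *\<^sub>C x + d *\<^sub>C x"
    and scaleC_scaleC: "c *\<^sub>C d *\<^sub>C x = (c * d) *\<^sub>C x"
    and scaleC_of_real: "complex_of_real r *\<^sub>C x = r *\<^sub>R x"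
    and cinner_commute: "cinner x y = cnj (cinner y x)"
    and cinner_add_left: "cinner (x + y) z = cinner x z + cinner y z"
    and cinner_scaleC_left: "cinner (c *\<^sub>C x) y = c * cinner x y"
    and cinner_self: "cinner x x = complex_of_real ((norm x)\<^sup>2)"

class complex_hilbert = complex_inner + complete_space
begin

subclass banach ..

end

instantiation complex :: complex_hilbert
begin

definition scaleC_complex :: "complex \<Rightarrow> complex \<Rightarrow> complex"
  where "scaleC_complex c x = c * x"

definition cinner_complex :: "complex \<Rightarrow> complex \<Rightarrow> complex"
  where "cinner_complex x y = x * cnj y"

instance
proof
  fix x :: complex
  show "cinner x x = complex_of_real ((norm x)\<^sup>2)"
    unfolding cinner_complex_def by (rule complex_norm_square [symmetric])
qed (auto simp: scaleC_complex_def cinner_complex_def scaleR_conv_of_real algebra_simps)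

end

definition bounded_clinear :: "('a::complex_inner \<Rightarrow> 'a) \<Rightarrow> bool"
  where "bounded_clinear T \<longleftrightarrow> bounded_linear T \<and> (\<forall>c x. T (c *\<^sub>C x) = c *\<^sub>C T x)"

definition op_invertible :: "('a::complex_inner \<Rightarrow> 'a) \<Rightarrow> bool"
  where "op_invertible T \<longleftrightarrow> (\<exists>S. bounded_clinear S \<and> T \<circ> S = id \<and> S \<circ> T = id)"

text \<open>If \<^prop>\<open>op_invertible T\<close>, the inverse operator is the inverse function \<^term>\<open>inv T\<close>.\<close>

lemma op_invertible_inv:
  assumes "op_invertible T"
  shows "bounded_clinear (inv T)" "T \<circ> inv T = id" "inv T \<circ> T = id"
proof -
  obtain S where S: "bounded_clinear S" "T \<circ> S = id" "S \<circ> T = id"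
    using assms by (auto simp: op_invertible_def)
  then have "inv T = S"
    by (metis inv_unique_comp)
  with S show "bounded_clinear (inv T)" "T \<circ> inv T = id" "inv T \<circ> T = id"
    by auto
qed

definition numerical_range :: "('a::complex_inner \<Rightarrow> 'a) \<Rightarrow> complex set"
  where "numerical_range T = {cinner (T u) u | u. norm u = 1}"

definition op_poly :: "complex poly \<Rightarrow> ('a::complex_inner \<Rightarrow> 'a) \<Rightarrow> 'a \<Rightarrow> 'a"
  where "op_poly p T x = (\<Sum>i\<le>degree p. coeff p i *\<^sub>C (T ^^ i) x)"

text \<open>
  For a compact set \<open>E\<close> bounded by a Jordan curve, the exterior is the complement of \<open>E\<close>.
  The derivative at infinity of \<open>\<Phi>\<close> is the limit of \<open>\<Phi> z / z\<close>.
  Values of \<open>\<Phi>\<close> on \<open>E\<close> itself are irrelevant.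
\<close>

definition exterior_riemann_map :: "complex set \<Rightarrow> (complex \<Rightarrow> complex) \<Rightarrow> bool"
  where "exterior_riemann_map E \<Phi> \<longleftrightarrow>
    \<Phi> holomorphic_on (- E) \<and>
    bij_betw \<Phi> (- E) {w. norm w > 1} \<and>
    filterlim \<Phi> at_infinity at_infinity \<and>
    (\<exists>d::real. d > 0 \<and> ((\<lambda>z. \<Phi> z / z) \<longlongrightarrow> complex_of_real d) at_infinity)"

text \<open>
  \<open>p\<close> is the \<open>n\<close>-th Faber polynomial of the set whose normalized exterior Riemann map is \<open>\<Phi>\<close>:
  the polynomial part at infinity of the Laurent expansion of \<open>\<Phi>\<^sup>n\<close>.
\<close>

definition faber_polynomial :: "(complex \<Rightarrow> complex) \<Rightarrow> nat \<Rightarrow> complex poly \<Rightarrow> bool"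
  where "faber_polynomial \<Phi> n p \<longleftrightarrow>
    (\<lambda>z. poly p z - \<Phi> z ^ n) \<in> O[at_infinity](\<lambda>z. 1 / z)"

definition lens :: "real \<Rightarrow> real \<Rightarrow> real \<Rightarrow> real \<Rightarrow> complex set"
  where "lens c\<^sub>0 r\<^sub>0 c\<^sub>1 r\<^sub>1 =
    {z. norm (z - complex_of_real c\<^sub>1) \<le> r\<^sub>1 \<and> norm (z - complex_of_real c\<^sub>0) \<ge> r\<^sub>0}"

text \<open>The origin lies in the exterior of the lens, so its image under \<open>\<Phi>\<close> is meaningful.\<close>

lemma zero_notin_lens:
  assumes "c\<^sub>0 - r\<^sub>0 < c\<^sub>1 - r\<^sub>1" "0 < c\<^sub>0 + r\<^sub>0"
  shows "0 \<notin> lens c\<^sub>0 r\<^sub>0 c\<^sub>1 r\<^sub>1"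
  using assms by (auto simp: lens_def)

end

theory Submission
  imports Defs
begin

text \<open>
  Write \<open>\<Psi>\<close> for the inverse of the exterior map and \<open>w = 1 / z\<close>. The function
  \<open>w \<Psi>'(w) \<langle>(\<Psi>(w) - A)\<inverse> u, v\<rangle>\<close> is holomorphic in \<open>|z| < 1\<close> and its Taylor
  coefficients in \<open>z\<close> are \<open>\<langle>F\<^sub>n(A) u, v\<rangle>\<close>. If \<open>A\<close> is strictly inside the lens, the
  function extends continuously to \<open>|z| = 1\<close>, because \<open>\<Psi>'\<close> vanishes at the corners, and for
  \<open>n \<ge> 1\<close> its Hermitian part has the same \<open>n\<close>-th Fourier coefficient. This Hermitian part is
  nonnegative on the outer arc; on the inner arc, with \<open>\<sigma> - c\<^sub>0 = r\<^sub>0 e\<^sup>i\<^sup>s\<close>, it becomes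
  nonnegative after adding \<open>2 |ds|\<close>, of total mass \<open>4 \<theta>\<^sub>0\<close>. The Cauchy--Schwarz inequality for this
  nonnegative form gives \<open>2 + 4 \<theta>\<^sub>0 / \<pi>\<close>. The general case follows by enlarging the lens slightly.
  Since \<open>(z - a) / (z - cnj a)\<close> maps the exterior to a sector, the map is explicit, and the Schwarz
  lemma identifies it with the given one.
\<close>

subsection \<open>Resolvents on a complex Hilbert space\<close>

text \<open>The disc hypotheses become sign conditions only on the boundary arcs themselves: there
  \<open>L z\<close> is a real multiple of \<open>psi z - c\<close>. On a level curve |z| = rho < 1
  this structure is lost, so the unit circle cannot be replaced by a smaller one and the corners
  have to be controlled. If the operator touches the boundary of the lens, boundary values need not
  exist. The enlarged lenses keep the same centers, so that both disc hypotheses persist, and the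
  estimate returns by continuity of a contour integral over one fixed circle. On the inner arc the
  outward normal of the lens points to \<open>c0\<close>, so the sign there is the wrong one. The
  angle \<open>th0\<close> enters the constant twice: the corrected form has mass
  \<open>4 * pi + 4 * th0\<close>, and another \<open>4 * th0\<close> is paid for removing the
  correction \<open>kappa t * cinner u v\<close>, which need not be orthogonal to the n-th
  exponential. Dividing by \<open>2 * pi\<close> gives \<open>2 + 4 * th0 / pi\<close>.\<close>

lemma cinner_add_right: "cinner x (y + z) = cinner x y + cinner x (z::'a::complex_inner)"
  by (metis cinner_add_left cinner_commute complex_cnj_add)

lemma cinner_scaleC_right: "cinner x (c *\<^sub>C y) = cnj c * cinner x (y::'a::complex_inner)"
  by (metis cinner_commute cinner_scaleC_left complex_cnj_mult)

lemma scaleC_minus_one: "(-1) *\<^sub>C x = - (x::'a::complex_inner)"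
  using scaleC_of_real[of "-1" x] by simp

lemma scaleC_one [simp]: "1 *\<^sub>C x = (x::'a::complex_inner)"
  using scaleC_of_real[of 1 x] by simp

lemma scaleC_zero_left [simp]: "0 *\<^sub>C x = (0::'a::complex_inner)"
  using scaleC_of_real[of 0 x] by simp

lemma scaleC_zero_right [simp]: "c *\<^sub>C 0 = (0::'a::complex_inner)"
  using scaleC_add_right[of c "0::'a" 0] by simp

lemma scaleC_minus_right: "c *\<^sub>C (- x) = - (c *\<^sub>C (x::'a::complex_inner))"
  using scaleC_add_right[of c x "- x"] by (simp add: eq_neg_iff_add_eq_0 add.commute)

lemma scaleC_minus_left: "(- c) *\<^sub>C x = - (c *\<^sub>C (x::'a::complex_inner))"
  using scaleC_add_left[of c "- c" x] by (simp add: eq_neg_iff_add_eq_0 add.commute)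

lemma scaleC_diff_right: "c *\<^sub>C (x - y) = c *\<^sub>C x - c *\<^sub>C (y::'a::complex_inner)"
  using scaleC_add_right[of c x "- y"] by (simp add: scaleC_minus_right)

lemma scaleC_diff_left: "(c - d) *\<^sub>C x = c *\<^sub>C x - d *\<^sub>C (x::'a::complex_inner)"
  using scaleC_add_left[of c "- d" x] by (simp add: scaleC_minus_left)

lemma cinner_zero_left [simp]: "cinner 0 (y::'a::complex_inner) = 0"
  using cinner_add_left[of 0 0 y] by simp

lemma cinner_minus_left: "cinner (- x) y = - cinner x (y::'a::complex_inner)"
  using cinner_scaleC_left[of "-1" x y] by (simp add: scaleC_minus_one)

lemma cinner_minus_right: "cinner x (- y) = - cinner x (y::'a::complex_inner)"
  using cinner_scaleC_right[of x "-1" y] by (simp add: scaleC_minus_one)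

lemma cinner_diff_left: "cinner (x - y) z = cinner x z - cinner y (z::'a::complex_inner)"
  using cinner_add_left[of x "- y" z] by (simp add: cinner_minus_left)

lemma cinner_diff_right: "cinner x (y - z) = cinner x y - cinner x (z::'a::complex_inner)"
  using cinner_add_right[of x y "- z"] by (simp add: cinner_minus_right)

lemma norm_scaleC [simp]: "norm (c *\<^sub>C x) = cmod c * norm (x::'a::complex_inner)"
proof -
  have "complex_of_real ((norm (c *\<^sub>C x))\<^sup>2) = of_real ((cmod c * norm x)\<^sup>2)"
    unfolding cinner_self[symmetric] cinner_scaleC_left cinner_scaleC_right
    by (simp add: cinner_self complex_norm_square power_mult_distrib flip: mult.assoc of_real_power)
  hence "(norm (c *\<^sub>C x))\<^sup>2 = (cmod c * norm x)\<^sup>2"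
    by (simp only: of_real_eq_iff)
  thus ?thesis by (simp add: power2_eq_iff_nonneg)
qed

lemma norm_diff_square:
  "(norm (x - y))\<^sup>2 = (norm x)\<^sup>2 - 2 * Re (cinner x y) + (norm (y::'a::complex_inner))\<^sup>2"
proof -
  have "complex_of_real ((norm (x - y))\<^sup>2) = cinner x x - (cinner x y + cnj (cinner x y)) + cinner y y"
    using cinner_commute[of y x]
    by (simp only: cinner_self[symmetric] cinner_diff_left cinner_diff_right) simp
  also have "\<dots> = of_real ((norm x)\<^sup>2 - 2 * Re (cinner x y) + (norm y)\<^sup>2)"
    by (simp add: cinner_self complex_add_cnj)
  finally show ?thesis by (simp only: of_real_eq_iff)
qed

lemma norm_cinner_le: "cmod (cinner x y) \<le> norm x * norm (y::'a::complex_inner)"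
proof (cases "y = 0")
  case True
  then show ?thesis using cinner_scaleC_right[of x 0 0] by simp
next
  case False
  define c where "c = cinner x y / of_real ((norm y)\<^sup>2)"
  have "0 \<le> (norm (x - c *\<^sub>C y))\<^sup>2" by simp
  also have "\<dots> = (norm x)\<^sup>2 - 2 * Re (cnj c * cinner x y) + (cmod c * norm y)\<^sup>2"
    by (simp add: norm_diff_square cinner_scaleC_right)
  also have "cnj c * cinner x y = of_real ((cmod (cinner x y))\<^sup>2 / (norm y)\<^sup>2)"
    using complex_norm_square[of "cinner x y"] by (simp add: c_def mult.commute)
  also have "(cmod c * norm y)\<^sup>2 = (cmod (cinner x y))\<^sup>2 / (norm y)\<^sup>2"
    using False by (simp add: c_def norm_divide norm_power power_mult_distrib power_divide)
      (simp add: power2_eq_square power4_eq_xxxx)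
  finally have "(cmod (cinner x y))\<^sup>2 \<le> (norm x * norm y)\<^sup>2"
    using False by (simp add: field_simps power_mult_distrib)
  thus ?thesis by (rule power2_le_imp_le) auto
qed

lemma tendsto_cinner_left:
  assumes "(f \<longlongrightarrow> l) F"
  shows "((\<lambda>z. cinner (f z) v) \<longlongrightarrow> cinner l (v::'a::complex_inner)) F"
proof -
  have "((\<lambda>z. norm (f z - l) * norm v) \<longlongrightarrow> 0) F"
    using tendsto_mult[OF tendsto_norm_zero[OF LIM_zero[OF assms]] tendsto_const[of "norm v"]] by simp
  hence "((\<lambda>z. cinner (f z) v - cinner l v) \<longlongrightarrow> 0) F"
    by (rule Lim_null_comparison[rotated])
      (auto simp: cinner_diff_left[symmetric] norm_cinner_le)
  thus ?thesis by (rule LIM_zero_cancel)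
qed

lemma bounded_clinear_bounded_linear: "bounded_clinear T \<Longrightarrow> bounded_linear T"
  by (simp add: bounded_clinear_def)

lemma bounded_clinear_scaleC: "bounded_clinear T \<Longrightarrow> T (c *\<^sub>C x) = c *\<^sub>C T x"
  by (simp add: bounded_clinear_def)

lemma bounded_linear_scaleC: "bounded_linear (\<lambda>x. c *\<^sub>C (x::'a::complex_inner))"
proof (rule bounded_linear_intro[where K = "cmod c"])
  show "c *\<^sub>C (r *\<^sub>R x) = r *\<^sub>R (c *\<^sub>C x)" for r and x :: 'a
    by (metis scaleC_of_real scaleC_scaleC mult.commute)
qed (auto simp: scaleC_add_right mult.commute)

lemma bounded_clinear_diff_scaleC:
  "bounded_clinear T \<Longrightarrow> bounded_clinear (\<lambda>x. c *\<^sub>C x - d *\<^sub>C T (x::'a::complex_inner))"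
  unfolding bounded_clinear_def
  by (auto intro!: bounded_linear_sub bounded_linear_scaleC bounded_linear_compose[OF bounded_linear_scaleC]
      simp: scaleC_diff_right scaleC_scaleC mult.commute)

lemma numerical_range_cinner_le:
  assumes "numerical_range T \<subseteq> cball c r" "bounded_clinear T"
  shows "cmod (cinner (T x) x - c * of_real ((norm x)\<^sup>2)) \<le> r * (norm (x::'a::complex_inner))\<^sup>2"
proof (cases "x = 0")
  case False
  define u where "u = of_real (1 / norm x) *\<^sub>C x"
  have "norm u = 1" using False by (simp add: u_def norm_divide)
  hence "cmod (cinner (T u) u - c) \<le> r"
    using assms(1) by (auto simp: numerical_range_def dist_norm norm_minus_commute)
  moreover have "cinner (T x) x - c * of_real ((norm x)\<^sup>2) = of_real ((norm x)\<^sup>2) * (cinner (T u) u - c)"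
    using False bounded_clinear_scaleC[OF assms(2)]
    by (simp add: u_def cinner_scaleC_left cinner_scaleC_right power2_eq_square right_diff_distrib)
  ultimately show ?thesis
    using mult_left_mono[of "cmod (cinner (T u) u - c)" r "(norm x)\<^sup>2"]
    by (simp add: norm_mult norm_power mult.commute)
qed (use bounded_clinear_bounded_linear[OF assms(2)] in \<open>simp add: linear_simps\<close>)

lemma coercive_norm_ge:
  assumes "d > 0" "d * (norm x)\<^sup>2 \<le> cmod (cinner (T x) (x::'a::complex_inner))"
  shows "d * norm x \<le> norm (T x)"
proof (cases "x = 0")
  case False
  have "d * (norm x)\<^sup>2 \<le> norm (T x) * norm x"
    using assms(2) norm_cinner_le[of "T x" x] by linarith
  thus ?thesis using False by (simp add: power2_eq_square)
qed auto

text \<open>Lax--Milgram: for small \<open>t > 0\<close> the map \<open>x \<mapsto> x - t (T x - v)\<close> is a contraction.\<close>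

lemma coercive_surj:
  fixes T :: "'a::complex_hilbert \<Rightarrow> 'a"
  assumes T: "bounded_clinear T" and d: "d > 0"
    and co: "\<And>x. d * (norm x)\<^sup>2 \<le> Re (cinner (T x) x)"
  shows "\<exists>x. T x = v"
proof -
  interpret T: bounded_linear T using T by (rule bounded_clinear_bounded_linear)
  obtain M where M: "M > 0" "\<And>x. norm (T x) \<le> norm x * M" using T.pos_bounded by auto
  \<comment> \<open>Adding \<open>d\<close> guarantees \<open>d < M'\<close>, so that the radicand
    of \<open>k\<close> is positive even on the zero space.\<close>
  define M' where "M' = M + d"
  have M': "M' > 0" "\<And>x. norm (T x) \<le> norm x * M'"
    using M d by (auto simp: M'_def distrib_left intro!: add_increasing2)
  \<comment> \<open>This \<open>t\<close> minimises
    \<open>1 - 2 * t * d + t\<^sup>2 * M'\<^sup>2\<close>; the minimum is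
    \<open>k\<^sup>2\<close>.\<close>
  define t where "t = d / M'\<^sup>2"
  have t: "t > 0" using d M' by (simp add: t_def)
  define k where "k = sqrt (1 - d\<^sup>2 / M'\<^sup>2)"
  have dM: "d\<^sup>2 < M'\<^sup>2" using M d by (simp add: M'_def power_strict_mono)
  have k: "0 \<le> k" "k < 1" "k\<^sup>2 = 1 - d\<^sup>2 / M'\<^sup>2"
    using dM M' d less_imp_le[OF dM] by (simp_all add: k_def divide_le_eq)
  have contr: "norm (x - t *\<^sub>R T x) \<le> k * norm x" for x
  proof -
    have "(norm (x - t *\<^sub>R T x))\<^sup>2 = (norm x)\<^sup>2 - 2 * t * Re (cinner (T x) x) + t\<^sup>2 * (norm (T x))\<^sup>2"
      using cinner_commute[of x "T x"]
      by (simp add: norm_diff_square scaleC_of_real[symmetric] cinner_scaleC_right power_mult_distrib)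
    also have "\<dots> \<le> (norm x)\<^sup>2 - 2 * t * (d * (norm x)\<^sup>2) + t\<^sup>2 * (norm x * M')\<^sup>2"
      using mult_left_mono[OF co[of x], of "2 * t"] t power_mono[OF M'(2)[of x], of 2]
      by (intro add_mono diff_mono mult_left_mono) auto
    also have "\<dots> = (k * norm x)\<^sup>2"
      using M' unfolding power_mult_distrib k(3) t_def by (simp add: field_simps power2_eq_square)
    finally show ?thesis by (rule power2_le_imp_le) (use k in auto)
  qed
  have "dist (x - t *\<^sub>R (T x - v)) (y - t *\<^sub>R (T y - v)) \<le> k * dist x y" for x y
  proof -
    have "x - t *\<^sub>R (T x - v) - (y - t *\<^sub>R (T y - v)) = (x - y) - t *\<^sub>R T (x - y)"
      by (simp add: T.diff algebra_simps)
    thus ?thesis using contr[of "x - y"] by (simp only: dist_norm)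
  qed
  hence "\<exists>!x. x - t *\<^sub>R (T x - v) = x"
    by (intro banach_fix_type[OF k(1,2)]) auto
  then obtain x where "x - t *\<^sub>R (T x - v) = x" by blast
  thus ?thesis using t by auto
qed


lemma op_poly_eq_sum:
  assumes "degree p \<le> n"
  shows "op_poly p T x = (\<Sum>i\<le>n. coeff p i *\<^sub>C (T ^^ i) (x::'a::complex_inner))"
  unfolding op_poly_def
  by (rule sum.mono_neutral_left) (use assms in \<open>auto simp: coeff_eq_0\<close>)

lemma op_poly_pCons:
  assumes "bounded_clinear T"
  shows "op_poly (pCons c p) T x = c *\<^sub>C x + T (op_poly p T (x::'a::complex_inner))"
proof -
  interpret T: bounded_linear T using assms by (rule bounded_clinear_bounded_linear)
  have "op_poly (pCons c p) T x = (\<Sum>i\<le>Suc (degree p). coeff (pCons c p) i *\<^sub>C (T ^^ i) x)"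
    by (rule op_poly_eq_sum) (rule degree_pCons_le)
  also have "\<dots> = c *\<^sub>C x + (\<Sum>i\<le>degree p. T (coeff p i *\<^sub>C (T ^^ i) x))"
    by (subst sum.atMost_Suc_shift) (simp add: bounded_clinear_scaleC[OF assms])
  finally show ?thesis by (simp add: op_poly_def T.sum)
qed

lemma open_exterior_lens: "open (- lens c0 r0 c1 r1)"
proof -
  have "- lens c0 r0 c1 r1 = - cball (complex_of_real c1) r1 \<union> ball (complex_of_real c0) r0"
    by (auto simp: lens_def dist_norm norm_minus_commute)
  thus ?thesis by (simp add: open_Un open_Compl)
qed

text \<open>The hypotheses on the operator alone, separated from the geometry so that one operator
  can be paired with a whole family of lenses.\<close>

locale lens_operator =
  fixes A :: "'a::complex_hilbert \<Rightarrow> 'a" and c0 c1 r0 r1 :: real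
  assumes A: "bounded_clinear A" and r0: "r0 > 0" and r1: "r1 > 0"
    and W1: "numerical_range A \<subseteq> cball (complex_of_real c1) r1"
    and invertible: "op_invertible (\<lambda>x. A x - complex_of_real c0 *\<^sub>C x)"
    and W0: "numerical_range (inv (\<lambda>x. A x - complex_of_real c0 *\<^sub>C x)) \<subseteq> cball 0 (1 / r0)"
begin

sublocale A: bounded_linear A
  using A by (rule bounded_clinear_bounded_linear)

definition B :: "'a \<Rightarrow> 'a"
  where "B = inv (\<lambda>x. A x - complex_of_real c0 *\<^sub>C x)"

lemma B: "bounded_clinear B"
  and A_B: "A (B x) - complex_of_real c0 *\<^sub>C B x = x"
  and B_A: "B (A x - complex_of_real c0 *\<^sub>C x) = x"
  using op_invertible_inv[OF invertible] by (auto simp: B_def fun_eq_iff)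

text \<open>The exterior with a margin, on which the resolvent is bounded uniformly. The margin is
  absolute at the circle about \<open>c1\<close> and relative at the one about \<open>c0\<close>,
  matching the coercivity constants \<open>cmod (\<sigma> - c1) - r1\<close> and
  \<open>1 - cmod (\<sigma> - c0) / r0\<close>.\<close>

definition far :: "real \<Rightarrow> complex set"
  where "far d = {\<sigma>. r1 + d \<le> cmod (\<sigma> - c1) \<or> cmod (\<sigma> - c0) \<le> r0 * (1 - d)}"

lemma not_lens_far:
  assumes "\<sigma> \<notin> lens c0 r0 c1 r1"
  obtains d where "d > 0" "\<sigma> \<in> far d"
proof (cases "r1 < cmod (\<sigma> - c1)")
  case True
  then show ?thesis using that[of "cmod (\<sigma> - c1) - r1"] by (auto simp: far_def)
next
  case False
  hence "cmod (\<sigma> - c0) < r0" using assms by (simp add: lens_def)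
  then show ?thesis using that[of "1 - cmod (\<sigma> - c0) / r0"] r0
    by (simp add: far_def)
qed

lemma far_subset:
  assumes "d > 0"
  shows "far d \<subseteq> - lens c0 r0 c1 r1"
proof -
  have "r0 * (1 - d) < r0" using assms r0 by simp
  thus ?thesis using assms by (auto simp: far_def lens_def)
qed

text \<open>Write \<sigma> - A = (\<sigma> - c1) - (A - c1). The form of A - c1 is at most r1 times
  the squared norm, and the factor \<open>cnj (\<sigma> - c1)\<close> rotates the main term onto the
  positive axis.\<close>

lemma Re_cinner_outer:
  fixes \<sigma> :: complex
  shows
  "Re (cnj (\<sigma> - c1) * cinner (\<sigma> *\<^sub>C x - A x) x) \<ge> cmod (\<sigma> - c1) * (cmod (\<sigma> - c1) - r1) * (norm x)\<^sup>2"
proof -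
  define d where "d = cinner (A x) x - c1 * of_real ((norm x)\<^sup>2)"
  have eq: "cinner (\<sigma> *\<^sub>C x - A x) x = (\<sigma> - c1) * of_real ((norm x)\<^sup>2) - d"
    by (simp add: d_def cinner_diff_left cinner_scaleC_left cinner_self algebra_simps)
  have 1: "Re (cnj (\<sigma> - c1) * ((\<sigma> - c1) * of_real ((norm x)\<^sup>2))) = (cmod (\<sigma> - c1))\<^sup>2 * (norm x)\<^sup>2"
    using complex_norm_square[of "\<sigma> - c1"]
    by (metis (no_types, lifting) Re_complex_of_real mult.assoc mult.commute of_real_mult)
  have 2: "Re (cnj (\<sigma> - c1) * d) \<le> cmod (\<sigma> - c1) * (r1 * (norm x)\<^sup>2)"
    by (rule order.trans[OF complex_Re_le_cmod], unfold norm_mult complex_mod_cnj)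
      (use numerical_range_cinner_le[OF W1 A, of x] in \<open>simp add: d_def mult_left_mono\<close>)
  show ?thesis unfolding eq right_diff_distrib[of "cnj (\<sigma> - c1)"] minus_complex.sel(1) 1 using 2
    by (simp add: algebra_simps power2_eq_square)
qed

text \<open>The same perturbation argument for 1 - (\<sigma> - c0) B, since the form of
  \<open>B\<close> is bounded by 1 / r0.\<close>

lemma Re_cinner_inner:
  fixes \<sigma> :: complex
  shows
  "Re (cinner (x - (\<sigma> - c0) *\<^sub>C B x) x) \<ge> (1 - cmod (\<sigma> - c0) / r0) * (norm x)\<^sup>2"
proof -
  have "Re ((\<sigma> - c0) * cinner (B x) x) \<le> cmod (\<sigma> - c0) * (1 / r0 * (norm x)\<^sup>2)"
    by (rule order.trans[OF complex_Re_le_cmod], unfold norm_mult)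
      (use numerical_range_cinner_le[OF W0 B[unfolded B_def], of x, folded B_def] in \<open>intro mult_left_mono; simp\<close>)
  thus ?thesis by (simp add: cinner_diff_left cinner_scaleC_left cinner_self algebra_simps)
qed

text \<open>On vectors \<open>x = B y\<close> the operator \<sigma> - A becomes the negative of 1 -
  (\<sigma> - c0) B. This carries estimates for \<open>B\<close> over to the resolvent inside the
  disc about \<open>c0\<close>.\<close>

lemma minus_A_B: "\<sigma> *\<^sub>C B y - A (B y) = - (y - (\<sigma> - c0) *\<^sub>C B y)"
  using A_B[of y] by (simp add: scaleC_diff_left algebra_simps)

lemma norm_le_far:
  assumes "d > 0"
  obtains M where "M > 0" "\<And>\<sigma> x. \<sigma> \<in> far d \<Longrightarrow> norm x \<le> M * norm (\<sigma> *\<^sub>C x - A x)"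
proof -
  interpret B: bounded_linear B using B by (rule bounded_clinear_bounded_linear)
  obtain K where K: "K > 0" "\<And>x. norm (B x) \<le> norm x * K" using B.pos_bounded by auto
  \<comment> \<open>\<open>1 / d\<close> serves outside the disc about \<open>c1\<close>, and
    \<open>K / d\<close> inside the disc about \<open>c0\<close>, where the factor \<open>K\<close>
    is lost in passing from \<open>y\<close> to \<open>x = B y\<close>. The sum covers both
    cases.\<close>
  have "norm x \<le> (1 / d + K / d) * norm (\<sigma> *\<^sub>C x - A x)" if "\<sigma> \<in> far d" for \<sigma> x
  proof (cases "r1 + d \<le> cmod (\<sigma> - c1)")
    case True
    hence pos: "cmod (\<sigma> - c1) > 0" using r1 assms by linarith
    have "cmod (\<sigma> - c1) * (d * (norm x)\<^sup>2) \<le> cmod (\<sigma> - c1) * (cmod (\<sigma> - c1) - r1) * (norm x)\<^sup>2"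
      using True by (simp add: mult_left_mono mult_right_mono flip: mult.assoc)
    also have "\<dots> \<le> cmod (cnj (\<sigma> - c1) * cinner (\<sigma> *\<^sub>C x - A x) x)"
      using Re_cinner_outer complex_Re_le_cmod order.trans by blast
    finally have "d * (norm x)\<^sup>2 \<le> cmod (cinner (\<sigma> *\<^sub>C x - A x) x)"
      using pos unfolding norm_mult complex_mod_cnj by simp
    hence "d * norm x \<le> norm (\<sigma> *\<^sub>C x - A x)"
      using coercive_norm_ge[OF assms, of x "\<lambda>x. \<sigma> *\<^sub>C x - A x"] by simp
    moreover have "0 \<le> K / d * norm (\<sigma> *\<^sub>C x - A x)"
      using K assms by simp
    ultimately show ?thesis using assms by (simp add: field_simps)
  next
    case False
      hence le: "cmod (\<sigma> - c0) / r0 \<le> 1 - d" using that r0 by (simp add: far_def field_simps)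
      define y where "y = A x - complex_of_real c0 *\<^sub>C x"
      have x: "x = B y" by (simp add: y_def B_A)
      have "d * (norm y)\<^sup>2 \<le> (1 - cmod (\<sigma> - c0) / r0) * (norm y)\<^sup>2"
        using le by (intro mult_right_mono) auto
      also have "\<dots> \<le> cmod (cinner (y - (\<sigma> - c0) *\<^sub>C B y) y)"
        using Re_cinner_inner complex_Re_le_cmod order.trans by blast
      finally have "d * norm y \<le> norm (y - (\<sigma> - c0) *\<^sub>C B y)"
        using coercive_norm_ge[OF assms, of y "\<lambda>y. y - (\<sigma> - c0) *\<^sub>C B y"] by simp
      also have "\<dots> = norm (\<sigma> *\<^sub>C x - A x)" unfolding x minus_A_B norm_minus_cancel ..
      finally have "K * norm y \<le> K / d * norm (\<sigma> *\<^sub>C x - A x)"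
        using assms K by (simp add: field_simps)
      moreover have "norm x \<le> K * norm y" using K(2)[of y] x by (simp add: mult.commute)
      moreover have "0 \<le> 1 / d * norm (\<sigma> *\<^sub>C x - A x)" using assms by simp
      ultimately show ?thesis by (simp add: distrib_right)
  qed
  moreover have "1 / d + K / d > 0" using K assms by (simp add: add_pos_pos)
  ultimately show ?thesis using that by blast
qed

text \<open>Uniqueness is the lower bound on \<open>far\<close>. Existence is Lax--Milgram, applied
  outside the disc about \<open>c1\<close> to \<sigma> - A rotated by
  \<open>cnj (\<sigma> - c1)\<close>, and otherwise to 1 - (\<sigma> - c0) B.\<close>

lemma resolvent_ex1:
  assumes "\<sigma> \<notin> lens c0 r0 c1 r1"
  shows "\<exists>!x. \<sigma> *\<^sub>C x - A x = u"
proof -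
  obtain d where d: "d > 0" "\<sigma> \<in> far d" using not_lens_far[OF assms] .
  obtain M where M: "\<And>x. norm x \<le> M * norm (\<sigma> *\<^sub>C x - A x)" using norm_le_far[OF d(1)] d(2) by metis
  have "\<exists>x. \<sigma> *\<^sub>C x - A x = u"
  proof (cases "r1 < cmod (\<sigma> - c1)")
    case True
    hence ne: "cmod (\<sigma> - c1) > 0" using r1 by linarith
      have "\<exists>x. (cnj (\<sigma> - c1) * \<sigma>) *\<^sub>C x - cnj (\<sigma> - c1) *\<^sub>C A x = cnj (\<sigma> - c1) *\<^sub>C u"
      proof (rule coercive_surj[OF bounded_clinear_diff_scaleC[OF A]])
        show "cmod (\<sigma> - c1) * (cmod (\<sigma> - c1) - r1) > 0"
          using True ne by simp
        show "cmod (\<sigma> - c1) * (cmod (\<sigma> - c1) - r1) * (norm x)\<^sup>2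
          \<le> Re (cinner ((cnj (\<sigma> - c1) * \<sigma>) *\<^sub>C x - cnj (\<sigma> - c1) *\<^sub>C A x) x)" for x
          using Re_cinner_outer[of \<sigma> x]
          by (simp only: scaleC_scaleC[symmetric] scaleC_diff_right[symmetric] cinner_scaleC_left)
      qed
      then obtain x where "cnj (\<sigma> - c1) *\<^sub>C (\<sigma> *\<^sub>C x - A x - u) = 0"
        by (auto simp: scaleC_diff_right scaleC_scaleC)
      hence "norm (cnj (\<sigma> - c1) *\<^sub>C (\<sigma> *\<^sub>C x - A x - u)) = 0" by (simp only: norm_zero)
      hence "\<sigma> *\<^sub>C x - A x - u = 0" using ne unfolding norm_scaleC complex_mod_cnj by simp
      thus ?thesis by (intro exI[of _ x]) simp
  next
    case False
    hence "cmod (\<sigma> - c0) < r0" using assms by (auto simp: lens_def)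
    have "\<exists>y. 1 *\<^sub>C y - (\<sigma> - c0) *\<^sub>C B y = - u"
    proof (rule coercive_surj[OF bounded_clinear_diff_scaleC[OF B]])
      show "0 < 1 - cmod (\<sigma> - c0) / r0"
        using \<open>cmod (\<sigma> - c0) < r0\<close> r0 by simp
    qed (use Re_cinner_inner in simp)
    then obtain y where "y - (\<sigma> - c0) *\<^sub>C B y = - u" by auto
    thus ?thesis using minus_A_B[of \<sigma> y] by (metis minus_minus)
  qed
  moreover have "x = y" if "\<sigma> *\<^sub>C x - A x = u" "\<sigma> *\<^sub>C y - A y = u" for x y
    using M[of "x - y"] that by (simp add: scaleC_diff_right A.diff algebra_simps)
  ultimately show ?thesis by blast
qed

definition R :: "complex \<Rightarrow> 'a \<Rightarrow> 'a"
  where "R \<sigma> u = (THE x. \<sigma> *\<^sub>C x - A x = u)"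

context
  fixes \<sigma> assumes \<sigma>: "\<sigma> \<notin> lens c0 r0 c1 r1"
begin

lemma R: "\<sigma> *\<^sub>C R \<sigma> u - A (R \<sigma> u) = u"
  unfolding R_def by (rule theI'[OF resolvent_ex1[OF \<sigma>]])

lemma R_eqI: "\<sigma> *\<^sub>C x - A x = u \<Longrightarrow> R \<sigma> u = x"
  using R resolvent_ex1[OF \<sigma>] by blast

lemma R_diff: "R \<sigma> (u - v) = R \<sigma> u - R \<sigma> v"
  using R[of u] R[of v] by (intro R_eqI) (simp add: A.diff scaleC_diff_right algebra_simps)

lemma R_add: "R \<sigma> (u + v) = R \<sigma> u + R \<sigma> v"
  using R[of u] R[of v] by (intro R_eqI) (simp add: A.add scaleC_add_right algebra_simps)

lemma R_scaleC: "R \<sigma> (c *\<^sub>C u) = c *\<^sub>C R \<sigma> u"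
proof (rule R_eqI)
  have "\<sigma> *\<^sub>C c *\<^sub>C R \<sigma> u - A (c *\<^sub>C R \<sigma> u) = c *\<^sub>C (\<sigma> *\<^sub>C R \<sigma> u - A (R \<sigma> u))"
    by (simp add: bounded_clinear_scaleC[OF A] scaleC_diff_right scaleC_scaleC mult.commute)
  thus "\<sigma> *\<^sub>C c *\<^sub>C R \<sigma> u - A (c *\<^sub>C R \<sigma> u) = c *\<^sub>C u" by (simp add: R)
qed

lemma R_A: "R \<sigma> (A u) = A (R \<sigma> u)"
proof (rule R_eqI)
  have "\<sigma> *\<^sub>C A (R \<sigma> u) - A (A (R \<sigma> u)) = A (\<sigma> *\<^sub>C R \<sigma> u - A (R \<sigma> u))"
    by (simp add: A.diff bounded_clinear_scaleC[OF A])
  thus "\<sigma> *\<^sub>C A (R \<sigma> u) - A (A (R \<sigma> u)) = A u" by (simp add: R)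
qed

end

definition res :: "'a \<Rightarrow> 'a \<Rightarrow> complex \<Rightarrow> complex"
  where "res u v \<sigma> = cinner (R \<sigma> u) v"

lemma norm_R_far:
  assumes "d > 0"
  obtains M where "M > 0" "\<And>\<sigma> u. \<sigma> \<in> far d \<Longrightarrow> norm (R \<sigma> u) \<le> M * norm u"
  by (metis norm_le_far[OF assms] R subsetD[OF far_subset[OF assms]] ComplD)

lemma res_far:
  assumes "d > 0"
  obtains M where "M > 0" "\<And>\<sigma> u v. \<sigma> \<in> far d \<Longrightarrow> cmod (res u v \<sigma>) \<le> M * norm u * norm v"
proof -
  obtain M where M: "M > 0" "\<And>\<sigma> u. \<sigma> \<in> far d \<Longrightarrow> norm (R \<sigma> u) \<le> M * norm u"
    using norm_R_far[OF assms] by blast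
  have "cmod (res u v \<sigma>) \<le> M * norm u * norm v" if "\<sigma> \<in> far d" for \<sigma> u v
    unfolding res_def using norm_cinner_le[of "R \<sigma> u" v] mult_right_mono[OF M(2)[OF that, of u] norm_ge_zero[of v]]
    by linarith
  with M(1) show ?thesis using that by blast
qed

lemma res_mult: "\<sigma> \<notin> lens c0 r0 c1 r1 \<Longrightarrow> \<sigma> * res u v \<sigma> = cinner u v + res (A u) v \<sigma>"
  using R[of \<sigma> u] cinner_scaleC_left[of \<sigma> "R \<sigma> u" v] cinner_diff_left[of "\<sigma> *\<^sub>C R \<sigma> u" "A (R \<sigma> u)" v]
  by (simp add: res_def R_A)

text \<open>p(\<sigma>) - p(A) is divisible by \<sigma> - A, so multiplying the resolvent by
  p(\<sigma>) or by p(A) differs only by a polynomial in \<sigma>. That polynomial has a primitive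
  and will drop out of contour integrals.\<close>

lemma res_poly:
  "\<exists>q. \<forall>\<sigma>. \<sigma> \<notin> lens c0 r0 c1 r1 \<longrightarrow> poly p \<sigma> * res u v \<sigma> = res (op_poly p A u) v \<sigma> + poly q \<sigma>"
proof (induction p)
  case 0
  have "res 0 v \<sigma> = 0" if "\<sigma> \<notin> lens c0 r0 c1 r1" for \<sigma>
    using R_diff[OF that, of 0 0] by (simp add: res_def)
  then show ?case by (intro exI[of _ 0]) (simp add: op_poly_def)
next
  case (pCons c p)
  then obtain q where q: "\<And>\<sigma>. \<sigma> \<notin> lens c0 r0 c1 r1 \<Longrightarrow> poly p \<sigma> * res u v \<sigma> = res (op_poly p A u) v \<sigma> + poly q \<sigma>"
    by blast
  show ?case
  proof (intro exI allI impI)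
    fix \<sigma> assume \<sigma>: "\<sigma> \<notin> lens c0 r0 c1 r1"
    have "poly (pCons c p) \<sigma> * res u v \<sigma> = c * res u v \<sigma> + \<sigma> * (poly p \<sigma> * res u v \<sigma>)"
      by (simp add: algebra_simps)
    also have "\<dots> = c * res u v \<sigma> + (\<sigma> * res (op_poly p A u) v \<sigma> + \<sigma> * poly q \<sigma>)"
      by (simp add: q[OF \<sigma>] algebra_simps)
    also have "\<dots> = res (op_poly (pCons c p) A u) v \<sigma> + poly (pCons (cinner (op_poly p A u) v) q) \<sigma>"
      by (simp add: res_mult[OF \<sigma>] op_poly_pCons[OF A])
        (simp add: res_def R_add[OF \<sigma>] R_scaleC[OF \<sigma>] cinner_add_left cinner_scaleC_left)
    finally show "poly (pCons c p) \<sigma> * res u v \<sigma> = res (op_poly (pCons c p) A u) v \<sigma>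
        + poly (pCons (cinner (op_poly p A u) v) q) \<sigma>" .
  qed
qed

text \<open>Two applications of \<open>res_mult\<close> write the left side as
  \<open>cinner u v\<close> plus \<open>inverse \<sigma>\<close> times a quantity that is bounded on
  \<open>far 1\<close>, hence near infinity.\<close>

lemma res_infinity: "((\<lambda>\<sigma>. \<sigma> * res u v \<sigma>) \<longlongrightarrow> cinner u v) at_infinity"
proof -
  obtain M where M: "M > 0" "\<And>\<sigma> u v. \<sigma> \<in> far 1 \<Longrightarrow> cmod (res u v \<sigma>) \<le> M * norm u * norm v"
    using res_far[of 1] by auto
  have far: "\<forall>\<^sub>F \<sigma> in at_infinity. \<sigma> \<noteq> 0 \<and> \<sigma> \<in> far 1"
  proof (rule eventually_at_infinityI)
    fix \<sigma> :: complex assume "\<bar>c1\<bar> + r1 + 1 \<le> cmod \<sigma>"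
    moreover have "cmod \<sigma> \<le> cmod (\<sigma> - c1) + \<bar>c1\<bar>"
      using norm_triangle_ineq[of "\<sigma> - c1" "complex_of_real c1"] by simp
    ultimately show "\<sigma> \<noteq> 0 \<and> \<sigma> \<in> far 1" using r1 by (auto simp: far_def)
  qed
  have "((\<lambda>\<sigma>. inverse \<sigma> * (cinner (A u) v + res (A (A u)) v \<sigma>)) \<longlongrightarrow> 0) at_infinity"
  proof (rule lim_null_mult_right_bounded[OF tendsto_inverse_0])
    show "\<forall>\<^sub>F \<sigma> in at_infinity. norm (cinner (A u) v + res (A (A u)) v \<sigma>)
      \<le> cmod (cinner (A u) v) + M * norm (A (A u)) * norm v"
      using far by eventually_elim (use M(2) in \<open>auto intro!: norm_triangle_le add_mono\<close>)
  qed
  from tendsto_add[OF tendsto_const[of "cinner u v"] this]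
  have "((\<lambda>\<sigma>. cinner u v + inverse \<sigma> * (cinner (A u) v + res (A (A u)) v \<sigma>)) \<longlongrightarrow> cinner u v) at_infinity"
    by (simp only: add_0_right)
  moreover have "\<forall>\<^sub>F \<sigma> in at_infinity. cinner u v + inverse \<sigma> * (cinner (A u) v + res (A (A u)) v \<sigma>) = \<sigma> * res u v \<sigma>"
    using far
  proof eventually_elim
    case (elim \<sigma>)
    hence "\<sigma> \<notin> lens c0 r0 c1 r1" using far_subset[of 1] by auto
    thus ?case using elim res_mult[of \<sigma> u v] res_mult[of \<sigma> "A u" v, symmetric] by simp
  qed
  ultimately show ?thesis by (rule Lim_transform_eventually)
qed

lemma R_resolvent_identity:
  assumes "\<sigma> \<notin> lens c0 r0 c1 r1" "\<tau> \<notin> lens c0 r0 c1 r1"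
  shows "R \<sigma> u - R \<tau> u = - ((\<sigma> - \<tau>) *\<^sub>C R \<sigma> (R \<tau> u))"
proof -
  have "R \<sigma> u = R \<tau> u - (\<sigma> - \<tau>) *\<^sub>C R \<sigma> (R \<tau> u)"
  proof (rule R_eqI[OF assms(1)])
    have "\<sigma> *\<^sub>C (R \<tau> u - (\<sigma> - \<tau>) *\<^sub>C R \<sigma> (R \<tau> u)) - A (R \<tau> u - (\<sigma> - \<tau>) *\<^sub>C R \<sigma> (R \<tau> u))
      = (\<sigma> - \<tau>) *\<^sub>C R \<tau> u + (\<tau> *\<^sub>C R \<tau> u - A (R \<tau> u))
        - (\<sigma> - \<tau>) *\<^sub>C (\<sigma> *\<^sub>C R \<sigma> (R \<tau> u) - A (R \<sigma> (R \<tau> u)))"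
      by (simp add: A.diff bounded_clinear_scaleC[OF A] scaleC_diff_right scaleC_diff_left scaleC_scaleC
          right_diff_distrib mult.commute)
    also have "\<dots> = u" by (simp add: R[OF assms(1)] R[OF assms(2)])
    finally show "\<sigma> *\<^sub>C (R \<tau> u - (\<sigma> - \<tau>) *\<^sub>C R \<sigma> (R \<tau> u)) - A (R \<tau> u - (\<sigma> - \<tau>) *\<^sub>C R \<sigma> (R \<tau> u)) = u" .
  qed
  thus ?thesis by simp
qed

lemma eventually_far:
  assumes "\<tau> \<notin> lens c0 r0 c1 r1"
  obtains d where "d > 0" "\<forall>\<^sub>F \<sigma> in nhds \<tau>. \<sigma> \<in> far d"
proof (cases "r1 < cmod (\<tau> - c1)")
  case True
  then obtain e where e: "r1 < e" "e < cmod (\<tau> - c1)"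
    using dense by blast
  define d where "d = e - r1"
  have d: "d > 0" "r1 + d < cmod (\<tau> - c1)"
    using e by (simp_all add: d_def)
  have "open {\<sigma>. r1 + d < cmod (\<sigma> - complex_of_real c1)}"
    by (intro open_Collect_less continuous_intros)
  hence "\<forall>\<^sub>F \<sigma> in nhds \<tau>. \<sigma> \<in> {\<sigma>. r1 + d < cmod (\<sigma> - complex_of_real c1)}"
    using d by (intro eventually_nhds_in_open) auto
  hence "\<forall>\<^sub>F \<sigma> in nhds \<tau>. \<sigma> \<in> far d"
    by eventually_elim (auto simp: far_def)
  then show ?thesis using that d by blast
next
  case False
  hence "cmod (\<tau> - c0) / r0 < 1" using assms r0 by (auto simp: lens_def)
  then obtain e where e: "cmod (\<tau> - c0) / r0 < e" "e < 1"
    using dense by blast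
  define d where "d = 1 - e"
  have d: "d > 0" "cmod (\<tau> - c0) < r0 * (1 - d)"
    using e r0 by (simp_all add: d_def pos_divide_less_eq mult.commute)
  have "open {\<sigma>. cmod (\<sigma> - complex_of_real c0) < r0 * (1 - d)}"
    by (intro open_Collect_less continuous_intros)
  hence "\<forall>\<^sub>F \<sigma> in nhds \<tau>. \<sigma> \<in> {\<sigma>. cmod (\<sigma> - complex_of_real c0) < r0 * (1 - d)}"
    using d by (intro eventually_nhds_in_open) auto
  hence "\<forall>\<^sub>F \<sigma> in nhds \<tau>. \<sigma> \<in> far d"
    by eventually_elim (auto simp: far_def)
  then show ?thesis using that d by blast
qed

lemma tendsto_R:
  assumes "\<tau> \<notin> lens c0 r0 c1 r1"
  shows "((\<lambda>\<sigma>. R \<sigma> u) \<longlongrightarrow> R \<tau> u) (at \<tau>)"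
proof -
  obtain d where d: "d > 0" and ev: "\<forall>\<^sub>F \<sigma> in nhds \<tau>. \<sigma> \<in> far d"
    using eventually_far[OF assms] .
  obtain M where M: "M > 0" "\<And>\<sigma> u. \<sigma> \<in> far d \<Longrightarrow> norm (R \<sigma> u) \<le> M * norm u"
    using norm_R_far[OF d] by blast
  have "\<forall>\<^sub>F \<sigma> in at \<tau>. norm (R \<sigma> u - R \<tau> u) \<le> cmod (\<sigma> - \<tau>) * (M * norm (R \<tau> u))"
    using eventually_nhds_conv_at[THEN iffD1, OF ev, THEN conjunct1]
  proof eventually_elim
    case (elim \<sigma>)
    hence "\<sigma> \<notin> lens c0 r0 c1 r1" using far_subset[OF d] by auto
    hence "norm (R \<sigma> u - R \<tau> u) = cmod (\<sigma> - \<tau>) * norm (R \<sigma> (R \<tau> u))"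
      using R_resolvent_identity[OF _ assms] by simp
    also have "\<dots> \<le> cmod (\<sigma> - \<tau>) * (M * norm (R \<tau> u))"
      using M(2)[OF elim] by (intro mult_left_mono) auto
    finally show ?case .
  qed
  moreover have "((\<lambda>\<sigma>. cmod (\<sigma> - \<tau>) * (M * norm (R \<tau> u))) \<longlongrightarrow> 0) (at \<tau>)"
    by (rule tendsto_eq_intros refl | simp)+
  ultimately have "((\<lambda>\<sigma>. R \<sigma> u - R \<tau> u) \<longlongrightarrow> 0) (at \<tau>)"
    by (rule Lim_null_comparison)
  thus ?thesis by (rule LIM_zero_cancel)
qed

lemma res_has_field_derivative:
  assumes "\<tau> \<notin> lens c0 r0 c1 r1"
  shows "(res u v has_field_derivative - res (R \<tau> u) v \<tau>) (at \<tau>)"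
proof -
  have "((\<lambda>\<sigma>. - res (R \<tau> u) v \<sigma>) \<longlongrightarrow> - res (R \<tau> u) v \<tau>) (at \<tau>)"
    unfolding res_def by (intro tendsto_minus tendsto_cinner_left tendsto_R assms)
  moreover have "\<forall>\<^sub>F \<sigma> in at \<tau>. - res (R \<tau> u) v \<sigma> = (res u v \<sigma> - res u v \<tau>) / (\<sigma> - \<tau>)"
    using eventually_at_in_open[OF open_exterior_lens, of \<tau>] assms
    by (rule_tac eventually_mono[where P = "\<lambda>\<sigma>. \<sigma> \<in> - lens c0 r0 c1 r1 - {\<tau>}"])
      (auto simp: res_def cinner_diff_left[symmetric] R_resolvent_identity cinner_minus_left cinner_scaleC_left)
  ultimately show ?thesis
    unfolding has_field_derivative_iff by (rule Lim_transform_eventually)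
qed

lemma res_holomorphic: "res u v holomorphic_on - lens c0 r0 c1 r1"
  using res_has_field_derivative by (auto simp: holomorphic_on_open[OF open_exterior_lens])

text \<open>With \<open>x = R \<sigma> u\<close>, the form of the resolvent at \<open>u\<close> is
  the conjugate of the form of \<sigma> - A at \<open>x\<close>, so \<open>Re_cinner_outer\<close>
  applies after conjugation.\<close>

lemma res_outer:
  fixes \<sigma> :: complex
  assumes "r1 \<le> cmod (\<sigma> - c1)" "\<sigma> \<notin> lens c0 r0 c1 r1"
  shows "Re ((\<sigma> - c1) * res u u \<sigma>) \<ge> 0"
proof -
  define x where "x = R \<sigma> u"
  have u: "u = \<sigma> *\<^sub>C x - A x" using R[OF assms(2)] by (simp add: x_def)
  have "0 \<le> cmod (\<sigma> - c1) * (cmod (\<sigma> - c1) - r1) * (norm x)\<^sup>2" using assms by simp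
  also have "\<dots> \<le> Re (cnj (\<sigma> - c1) * cinner u x)" unfolding u by (rule Re_cinner_outer)
  also have "cnj (\<sigma> - c1) * cinner u x = cnj ((\<sigma> - c1) * cinner x u)"
    using cinner_commute[of u x] by simp
  finally show ?thesis by (simp add: res_def x_def)
qed

text \<open>If \<open>R \<sigma> u = B y\<close>, then u = (\<sigma> - c0) B y - y and -y = u -
  (\<sigma> - c0) R u. The nonnegative real part of
  \<open>cinner (y - (\<sigma> - c0) *\<^sub>C B y) y\<close> is therefore the difference of the two
  sides.\<close>

lemma res_inner:
  fixes \<sigma> :: complex
  assumes "cmod (\<sigma> - c0) \<le> r0" "\<sigma> \<notin> lens c0 r0 c1 r1"
  shows "Re ((\<sigma> - c0) * res u u \<sigma>) \<le> (norm u)\<^sup>2"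
proof -
  define y where "y = A (R \<sigma> u) - complex_of_real c0 *\<^sub>C R \<sigma> u"
  have x: "R \<sigma> u = B y" by (simp add: y_def B_A)
  have u: "u = (\<sigma> - c0) *\<^sub>C B y - y" using R[OF assms(2), of u] minus_A_B[of \<sigma> y] by (simp add: x)
  have "0 \<le> (1 - cmod (\<sigma> - c0) / r0) * (norm y)\<^sup>2" using assms r0 by simp
  also have "\<dots> \<le> Re (cinner (y - (\<sigma> - c0) *\<^sub>C B y) y)" by (rule Re_cinner_inner)
  also have "y - (\<sigma> - c0) *\<^sub>C B y = - u" by (simp add: u)
  also have "cinner (- u) y = cnj (cinner (- y) u)"
    by (metis cinner_commute cinner_minus_left cinner_minus_right)
  also have "- y = u - (\<sigma> - c0) *\<^sub>C R \<sigma> u" using u x by simp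
  finally show ?thesis by (simp add: cinner_diff_left cinner_scaleC_left cinner_self res_def)
qed

lemma res_sesquilinear:
  assumes "\<sigma> \<notin> lens c0 r0 c1 r1"
  shows "res (u - c *\<^sub>C v) (u - c *\<^sub>C v) \<sigma>
    = res u u \<sigma> - cnj c * res u v \<sigma> - c * res v u \<sigma> + c * cnj c * res v v \<sigma>"
  by (simp add: res_def R_diff[OF assms] R_scaleC[OF assms] cinner_diff_left cinner_diff_right
      cinner_scaleC_left cinner_scaleC_right algebra_simps)

end

subsection \<open>The exterior map of a lens\<close>

text \<open>In polar angle \<open>t\<close>, two half-planes whose boundary lines make the angles d
  and -d with the axis have as their union the sector of half-opening pi - d.\<close>

lemma sin_or_sin_iff:
  fixes t d :: real
  assumes d: "0 < d" "d < pi / 2" and t: "- pi < t" "t \<le> pi"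
  shows "sin (t - d) < 0 \<or> sin (t + d) > 0 \<longleftrightarrow> \<bar>t\<bar> < pi - d"
proof
  assume *: "sin (t - d) < 0 \<or> sin (t + d) > 0"
  show "\<bar>t\<bar> < pi - d"
  proof (rule ccontr)
    assume "\<not> ?thesis"
    then consider "t \<ge> pi - d" | "t \<le> - (pi - d)" by linarith
    thus False
    proof cases
      case 1
      have "sin (t - d) \<ge> 0" by (rule sin_ge_zero) (use 1 d t in linarith)+
      moreover have "sin (t + d) \<le> 0" by (rule sin_le_zero) (use 1 d t in linarith)+
      ultimately show False using * by linarith
    next
      case 2
      have "sin (- t - d) \<ge> 0" by (rule sin_ge_zero) (use 2 d t in linarith)+
      moreover have "sin (- t + d) \<le> 0" by (rule sin_le_zero) (use 2 d t in linarith)+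
      moreover have "sin (- t - d) = - sin (t + d)" "sin (- t + d) = - sin (t - d)"
        using sin_minus[of "t + d"] sin_minus[of "t - d"] by simp_all
      ultimately show False using * by linarith
    qed
  qed
next
  assume "\<bar>t\<bar> < pi - d"
  show "sin (t - d) < 0 \<or> sin (t + d) > 0"
  proof (cases "t < d")
    case True
    have "sin (d - t) > 0" by (rule sin_gt_zero) (use True \<open>\<bar>t\<bar> < pi - d\<close> in linarith)+
    thus ?thesis using sin_minus[of "d - t"] by simp
  next
    case False
    have "sin (t + d) > 0" by (rule sin_gt_zero) (use False d \<open>\<bar>t\<bar> < pi - d\<close> in linarith)+
    thus ?thesis ..
  qed
qed

lemma Ln_powr_of_real:
  assumes "z \<noteq> 0" "- pi < b * Im (Ln z)" "b * Im (Ln z) \<le> pi"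
  shows "Ln (z powr complex_of_real b) = of_real b * Ln z"
  unfolding powr_def using assms by (simp add: Ln_exp)

text \<open>The Moebius map with zero \<open>a\<close> and pole \<open>cnj a\<close> takes a circle
  through both points to a line through 0, here the one in direction \<open>cis th\<close>; the sign
  of \<open>Im (\<phi> * cis (- th))\<close> tells the two sides apart.\<close>

lemma circle_through_points:
  fixes c r th :: real and a \<phi> z :: complex
  assumes a: "a - c = r * cis th" and \<phi>: "\<phi> \<noteq> 1" and z: "z = cnj a + (a - cnj a) / (1 - \<phi>)"
  shows "z - c = r * (cis th - \<phi> * cis (- th)) / (1 - \<phi>)"
    and "(cmod (z - c))\<^sup>2 - r\<^sup>2 = - (4 * r\<^sup>2 * sin th * Im (\<phi> * cis (- th))) / (cmod (1 - \<phi>))\<^sup>2"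
proof -
  have aeq: "a = c + r * cis th" using a by (simp add: algebra_simps)
  have ca: "cnj a = c + r * cis (- th)" by (simp add: aeq cis_cnj)
  show 1: "z - c = r * (cis th - \<phi> * cis (- th)) / (1 - \<phi>)"
    unfolding z ca using \<phi> by (simp add: aeq divide_simps) (simp add: algebra_simps)
  have pos: "(cmod (1 - \<phi>))\<^sup>2 > 0" using \<phi> by simp
  have "(cmod (z - c))\<^sup>2 - r\<^sup>2 = r\<^sup>2 * ((cmod (cis th - \<phi> * cis (- th)))\<^sup>2 - (cmod (1 - \<phi>))\<^sup>2) / (cmod (1 - \<phi>))\<^sup>2"
    unfolding 1 norm_divide norm_mult using pos \<phi>
    by (simp add: power_divide power_mult_distrib field_simps)
  also have "(cmod (cis th - \<phi> * cis (- th)))\<^sup>2 - (cmod (1 - \<phi>))\<^sup>2 = - 4 * sin th * Im (\<phi> * cis (- th))"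
  proof -
    have s: "sin th * sin th = 1 - cos th * cos th"
      using sin_cos_squared_add[of th] by (simp add: power2_eq_square)
    have "(cos th - (Re \<phi> * cos th + Im \<phi> * sin th))\<^sup>2 + (sin th - (Im \<phi> * cos th - Re \<phi> * sin th))\<^sup>2
        - ((1 - Re \<phi>)\<^sup>2 + (Im \<phi>)\<^sup>2) = - 4 * sin th * (Im \<phi> * cos th - Re \<phi> * sin th)"
      using s by algebra
    thus ?thesis by (simp add: cmod_power2)
  qed
  finally show "(cmod (z - c))\<^sup>2 - r\<^sup>2 = - (4 * r\<^sup>2 * sin th * Im (\<phi> * cis (- th))) / (cmod (1 - \<phi>))\<^sup>2"
    by (simp add: mult_ac)
qed

text \<open>The radii are functions of the corner, so a lens with fixed centers is moved by moving
  \<open>a\<close>. Without assumptions, the exported definitional equations hold for every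
  \<open>a\<close>, as the continuity argument in \<open>a\<close> requires.\<close>

locale lens_parameters =
  fixes a :: complex and c0 c1 :: real
begin

definition "th0 = Arg (a - complex_of_real c0)"
definition "th1 = Arg (a - complex_of_real c1)"
definition "r0 = cmod (a - complex_of_real c0)"
definition "r1 = cmod (a - complex_of_real c1)"

text \<open>The exterior angle of the lens at its corners is \<open>b * pi\<close>.\<close>

definition "b = (2 * pi - th1 + th0) / pi"
text \<open>The direction of the bisector of the image sector; the point 1, the image of infinity,
  lies at angle \<open>- m\<close> from it.\<close>

definition "m = (th0 + th1) / 2"
text \<open>The power \<open>b\<close> turns the angle \<open>eta\<close> into \<open>m\<close>, so
  that \<open>S 0 = q\<close> yields \<open>phi 0 = 1\<close>.\<close>

definition "eta = m / b"
definition "q = cis (- eta)"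
text \<open>Among the Moebius maps of the disc onto the half-plane with value \<open>q\<close> at 0,
  the factors \<open>\<i>\<close> select the rotation for which \<open>z * psi z\<close> has a
  positive limit at 0.\<close>

definition "N z = q - \<i> * z"
definition "D z = 1 + \<i> * q * z"
definition "S z = N z / D z"
definition "phi z = cis m * S z powr complex_of_real b"

text \<open>
  \<open>S\<close> maps the unit disc to the right half-plane, the power \<open>phi\<close> opens it to a sector, and
  \<open>z \<mapsto> (z - a) / (z - cnj a)\<close> maps the exterior of the lens onto that sector with \<open>\<infinity>\<close> going to \<open>1\<close>.
  Hence \<open>psi z\<close> is the inverse of the exterior map at \<open>1 / z\<close>.
\<close>

definition "psi z = cnj a + (a - cnj a) / (1 - phi z)"

text \<open>\<open>L z\<close> is \<open>- z * deriv psi z\<close>.\<close>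

definition "L z = - (4 * Im a * b * cos eta) * q * z * phi z / ((1 - phi z)\<^sup>2 * N z * D z)"

text \<open>The candidate inverse of \<open>psi\<close>: it undoes the Moebius quotient, the power
  and \<open>S\<close> in turn.\<close>

definition "chi z = (q - (cis (- m) * ((z - a) / (z - cnj a))) powr complex_of_real (1 / b))
  / (\<i> * (1 + q * (cis (- m) * ((z - a) / (z - cnj a))) powr complex_of_real (1 / b)))"

abbreviation "E \<equiv> lens c0 r0 c1 r1"

end

text \<open>Centers in this order and a corner in the upper half-plane already force a genuine lens:
  the exterior angle satisfies 1 < b < 2.\<close>

locale lens_map = lens_parameters +
  assumes Im_a: "Im a > 0" and c0_less_c1: "c0 < c1"
begin

lemma r0: "r0 > 0" and r1: "r1 > 0"
  using Im_a by (auto simp: r0_def r1_def complex_eq_iff)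

lemma a_c0: "a - complex_of_real c0 = r0 * cis th0" and a_c1: "a - complex_of_real c1 = r1 * cis th1"
  using r0 r1 by (simp_all add: r0_def r1_def th0_def th1_def rcis_cmod_Arg[unfolded rcis_def])

lemma Im_a_eq: "Im a = r0 * sin th0" "Im a = r1 * sin th1"
  using arg_cong[OF a_c0, of Im] arg_cong[OF a_c1, of Im] by simp_all

lemma th0: "0 < th0" "th0 < pi" and th1: "0 < th1" "th1 < pi"
  using Im_a Arg_lt_pi[of "a - complex_of_real c0"] Arg_lt_pi[of "a - complex_of_real c1"]
  by (auto simp: th0_def th1_def)

text \<open>Twice the area of the triangle \<open>c0\<close>, \<open>c1\<close>, \<open>a\<close> is
  both \<open>r0 * r1 * sin (th1 - th0)\<close> and \<open>Im a * (c1 - c0)\<close>, so the sine is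
  positive.\<close>

lemma th0_less_th1: "th0 < th1"
proof (rule ccontr)
  assume "\<not> th0 < th1"
  hence "sin (th0 - th1) \<ge> 0" using th0 th1 by (intro sin_ge_zero) auto
  hence "0 \<le> r0 * r1 * sin (th0 - th1)" using r0 r1 by simp
  also have "\<dots> = (r0 * sin th0) * (r1 * cos th1) - (r0 * cos th0) * (r1 * sin th1)"
    by (simp add: sin_diff algebra_simps)
  also have "\<dots> = Im a * (c0 - c1)"
  proof -
    have "r1 * cos th1 = Re a - c1" "r0 * cos th0 = Re a - c0"
      using arg_cong[OF a_c0, of Re] arg_cong[OF a_c1, of Re] by simp_all
    thus ?thesis by (simp only: Im_a_eq[symmetric]) (simp add: algebra_simps)
  qed
  also have "\<dots> < 0" using Im_a c0_less_c1 by (simp add: mult_pos_neg)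
  finally show False by simp
qed

lemma b: "1 < b" "b < 2"
  using th0 th1 th0_less_th1 by (simp_all add: b_def field_simps)

lemma b_pi: "b * pi / 2 = pi - (th1 - th0) / 2"
  by (simp add: b_def field_simps)

lemma m: "0 < m" "m < b * pi / 2"
  using th0 th1 th0_less_th1 unfolding b_pi by (simp_all add: m_def field_simps)

lemma b_eta: "b * eta = m"
  using b by (simp add: eta_def)

lemma eta: "0 < eta" "eta < pi / 2"
  using m b by (simp_all add: eta_def field_simps)

lemma cos_eta: "cos eta > 0"
  using eta by (intro cos_gt_zero_pi) auto

lemma norm_q [simp]: "cmod q = 1"
  by (simp add: q_def)

lemma q_nonzero [simp]: "q \<noteq> 0"
  by (simp add: q_def)

lemma q_simps: "Re q = cos eta" "Im q = - sin eta" "q * cnj q = 1" "cnj q * q = 1"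
  by (simp_all add: q_def cis_cnj cis_mult)

lemma q_square: "1 + q\<^sup>2 = 2 * cos eta * q"
proof -
  have "1 + q\<^sup>2 = q * (cnj q + q)" by (simp add: distrib_left q_simps power2_eq_square)
  also have "cnj q + q = 2 * cos eta" by (simp add: complex_eq_iff q_simps)
  finally show ?thesis by simp
qed

text \<open>Up to the factor \<open>- \<i>\<close> this is the determinant of the Moebius map
  \<open>S\<close>, the numerator of its derivative.\<close>

lemma D_qN: "D z + q * N z = 2 * cos eta * q"
  using q_square by (simp add: D_def N_def algebra_simps power2_eq_square)

text \<open>The real part shows that the disc goes to the right half-plane. On the unit circle the
  sign of the imaginary part, opposite to that of \<open>Re z + sin eta\<close>, decides which of
  the two arcs is hit.\<close>

lemma Re_Im_S:
  shows "Re (S z) = (1 - (cmod z)\<^sup>2) * cos eta / (cmod (D z))\<^sup>2"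
    and "Im (S z) = - (sin eta * (1 + (cmod z)\<^sup>2) + 2 * Re z) / (cmod (D z))\<^sup>2"
proof -
  have "S z = N z * cnj (D z) / (cmod (D z))\<^sup>2"
    using complex_norm_square[of "D z"] by (cases "D z = 0") (simp_all add: S_def divide_simps)
  moreover have "Re (N z * cnj (D z)) = (1 - (cmod z)\<^sup>2) * cos eta"
    unfolding cmod_power2 by (simp add: N_def D_def q_simps) (insert sin_cos_squared_add[of eta], algebra)
  moreover have "Im (N z * cnj (D z)) = - (sin eta * (1 + (cmod z)\<^sup>2) + 2 * Re z)"
    unfolding cmod_power2 by (simp add: N_def D_def q_simps) (insert sin_cos_squared_add[of eta], algebra)
  ultimately show "Re (S z) = (1 - (cmod z)\<^sup>2) * cos eta / (cmod (D z))\<^sup>2"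
    "Im (S z) = - (sin eta * (1 + (cmod z)\<^sup>2) + 2 * Re z) / (cmod (D z))\<^sup>2"
    by simp_all
qed

lemma N_eq_0_iff: "N z = 0 \<longleftrightarrow> z = - \<i> * q" and D_eq_0_iff: "D z = 0 \<longleftrightarrow> z = \<i> * cnj q"
proof -
  have "N z = - \<i> * (z - (- \<i> * q))" by (simp add: N_def algebra_simps)
  thus "N z = 0 \<longleftrightarrow> z = - \<i> * q" by (simp only: mult_eq_0_iff right_minus_eq) simp
  have "D z = \<i> * q * (z - \<i> * cnj q)" using q_simps by (simp add: D_def algebra_simps)
  thus "D z = 0 \<longleftrightarrow> z = \<i> * cnj q" by (simp only: mult_eq_0_iff right_minus_eq) simp
qed

lemma N_D_nonzero:
  assumes "cmod z < 1"
  shows "N z \<noteq> 0" "D z \<noteq> 0" "S z \<noteq> 0"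
  using assms by (auto simp: S_def N_eq_0_iff D_eq_0_iff norm_mult)

lemma Re_S_pos: "cmod z < 1 \<Longrightarrow> Re (S z) > 0"
  unfolding Re_Im_S using cos_eta N_D_nonzero[of z] by (simp add: power_less_one_iff)

lemma Re_S_nonneg: "cmod z \<le> 1 \<Longrightarrow> Re (S z) \<ge> 0"
  unfolding Re_Im_S using cos_eta by (simp add: power_le_one)

lemma Re_S_circle: "cmod z = 1 \<Longrightarrow> Re (S z) = 0"
  and Im_S_circle: "cmod z = 1 \<Longrightarrow> Im (S z) = - 2 * (Re z + sin eta) / (cmod (D z))\<^sup>2"
  unfolding Re_Im_S by (simp_all add: algebra_simps)

lemma S_not_nonpos:
  assumes "cmod z \<le> 1" "S z \<noteq> 0"
  shows "S z \<notin> \<real>\<^sub>\<le>\<^sub>0"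
  using Re_S_nonneg[OF assms(1)] assms(2) by (auto simp: complex_nonpos_Reals_iff complex_eq_iff)

lemma abs_Arg_S:
  assumes "cmod z \<le> 1" "S z \<noteq> 0"
  shows "\<bar>Im (Ln (S z))\<bar> \<le> pi / 2"
  using Re_S_nonneg[OF assms(1)] assms(2) Re_Ln_pos_le[of "S z"] by blast

lemma phi_eq:
  assumes "S z \<noteq> 0"
  shows "phi z = of_real (cmod (S z) powr b) * cis (m + b * Im (Ln (S z)))"
proof -
  have "S z powr b = of_real (cmod (S z) powr b) * cis (b * Im (Ln (S z)))"
    using assms by (simp add: powr_def exp_eq_polar)
  thus ?thesis by (simp add: phi_def cis_mult mult_ac)
qed

lemma Ln_S_powr:
  assumes "cmod z \<le> 1" "S z \<noteq> 0"
  shows "Ln (S z powr b) = b * Ln (S z)"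
proof (rule Ln_powr_of_real[OF assms(2)])
  have "\<bar>b * Im (Ln (S z))\<bar> \<le> b * (pi / 2)"
    using abs_Arg_S[OF assms] b by (simp add: abs_mult)
  also have "\<dots> < pi" using b by simp
  finally show "- pi < b * Im (Ln (S z))" "b * Im (Ln (S z)) \<le> pi" by linarith+
qed

text \<open>Since b < 2, logarithms of \<open>S z powr b\<close> stay principal, so
  \<open>phi z = 1\<close> would give \<open>S z = q = S 0\<close>, against the injectivity of
  \<open>S\<close>.\<close>

lemma phi_neq_1:
  assumes "cmod z \<le> 1" "z \<noteq> 0"
  shows "phi z \<noteq> 1"
proof
  assume phi: "phi z = 1"
  hence S: "S z \<noteq> 0" by (auto simp: phi_def)
  have "S z powr b = cis (- m) * phi z"
    by (simp add: phi_def cis_mult flip: mult.assoc)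
  hence "S z powr b = cis (- m)" using phi by simp
  hence "b * Ln (S z) = Ln (cis (- m))" using Ln_S_powr[OF assms(1) S] by metis
  also have "\<dots> = \<i> * of_real (- m)"
  proof -
    have "m < pi" using m b mult_strict_right_mono[of b 2 pi] pi_gt_zero by linarith
    thus ?thesis unfolding cis_conv_exp using m by (intro Ln_exp) auto
  qed
  finally have "b * Ln (S z) = b * (\<i> * of_real (- eta))" using b_eta[symmetric] by simp
  moreover have "complex_of_real b \<noteq> 0" using b by simp
  ultimately have "Ln (S z) = \<i> * of_real (- eta)" using mult_left_cancel by blast
  hence "exp (Ln (S z)) = cis (- eta)" by (simp only: cis_conv_exp)
  hence "S z = q" using S by (simp add: q_def)
  moreover have "D z \<noteq> 0" using S by (auto simp: S_def)
  ultimately have "q * D z = N z" by (simp add: S_def field_simps)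
  hence "\<i> * z * (1 + q\<^sup>2) = 0" by (simp add: D_def N_def algebra_simps power2_eq_square)
  thus False using assms cos_eta by (simp add: q_square)
qed

lemma phi_0: "phi 0 = 1"
proof -
  have "S 0 = exp (\<i> * of_real (- eta))" by (simp add: S_def N_def D_def q_def cis_conv_exp)
  moreover have "Ln (exp (\<i> * of_real (- eta))) = \<i> * of_real (- eta)"
    using eta pi_gt_zero by (intro Ln_exp; simp; linarith)
  ultimately have "S 0 powr b = exp (\<i> * of_real (- (b * eta)))"
    by (simp add: powr_def mult_ac)
  hence "S 0 powr b = cis (- m)" by (simp only: b_eta cis_conv_exp)
  thus ?thesis by (simp add: phi_def cis_mult)
qed

text \<open>\<open>circle_through_points\<close> for both circles, with the angle \<open>t\<close>
  measured from the bisector: \<open>m - th1\<close> and \<open>m - th0\<close> are minus and plus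
  \<open>(th1 - th0) / 2\<close>.\<close>

lemma arc_sides:
  assumes "\<phi> \<noteq> 1" "z = cnj a + (a - cnj a) / (1 - \<phi>)"
    and "\<phi> = of_real R * cis (m + t)" "R > 0"
  shows "r1 < cmod (z - c1) \<longleftrightarrow> sin (t - (th1 - th0) / 2) < 0"
    and "cmod (z - c0) < r0 \<longleftrightarrow> sin (t + (th1 - th0) / 2) > 0"
    and "r1 \<le> cmod (z - c1) \<longleftrightarrow> sin (t - (th1 - th0) / 2) \<le> 0"
    and "cmod (z - c0) \<le> r0 \<longleftrightarrow> sin (t + (th1 - th0) / 2) \<ge> 0"
proof -
  have d: "(cmod (1 - \<phi>))\<^sup>2 > 0" using assms(1) by simp
  have *: "m + t - th1 = t - (th1 - th0) / 2" "m + t - th0 = t + (th1 - th0) / 2"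
    by (simp_all add: m_def field_simps)
  have "Im (\<phi> * cis (- th1)) = R * sin (t - (th1 - th0) / 2)"
    "Im (\<phi> * cis (- th0)) = R * sin (t + (th1 - th0) / 2)"
    unfolding assms(3) mult.assoc cis_mult
    by (simp_all only: diff_conv_add_uminus[symmetric] *) simp_all
  note I = this
  define k1 where "k1 = 4 * r1\<^sup>2 * sin th1 * R / (cmod (1 - \<phi>))\<^sup>2"
  define k0 where "k0 = 4 * r0\<^sup>2 * sin th0 * R / (cmod (1 - \<phi>))\<^sup>2"
  have k: "k1 > 0" "k0 > 0"
    using d r0 r1 assms(4) sin_gt_zero[OF th0] sin_gt_zero[OF th1] by (simp_all add: k0_def k1_def)
  have 1: "(cmod (z - c1))\<^sup>2 - r1\<^sup>2 = - (k1 * sin (t - (th1 - th0) / 2))"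
    using circle_through_points(2)[OF a_c1 assms(1,2)] unfolding I by (simp add: k1_def mult_ac)
  have 0: "(cmod (z - c0))\<^sup>2 - r0\<^sup>2 = - (k0 * sin (t + (th1 - th0) / 2))"
    using circle_through_points(2)[OF a_c0 assms(1,2)] unfolding I by (simp add: k0_def mult_ac)
  have "r1 < cmod (z - c1) \<longleftrightarrow> 0 < (cmod (z - c1))\<^sup>2 - r1\<^sup>2"
    using r1 abs_le_square_iff[of "cmod (z - c1)" r1] by (auto simp flip: not_le)
  also have "\<dots> \<longleftrightarrow> sin (t - (th1 - th0) / 2) < 0"
    using k by (simp add: 1 mult_less_0_iff)
  finally show "r1 < cmod (z - c1) \<longleftrightarrow> sin (t - (th1 - th0) / 2) < 0" .
  have "r1 \<le> cmod (z - c1) \<longleftrightarrow> 0 \<le> (cmod (z - c1))\<^sup>2 - r1\<^sup>2"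
    using r1 abs_le_square_iff[of r1 "cmod (z - c1)"] by auto
  also have "\<dots> \<longleftrightarrow> sin (t - (th1 - th0) / 2) \<le> 0"
    using k by (simp add: 1 mult_le_0_iff)
  finally show "r1 \<le> cmod (z - c1) \<longleftrightarrow> sin (t - (th1 - th0) / 2) \<le> 0" .
  have "cmod (z - c0) < r0 \<longleftrightarrow> (cmod (z - c0))\<^sup>2 - r0\<^sup>2 < 0"
    using r0 abs_le_square_iff[of r0 "cmod (z - c0)"] by (auto simp flip: not_le)
  also have "\<dots> \<longleftrightarrow> sin (t + (th1 - th0) / 2) > 0"
    using k by (simp add: 0 zero_less_mult_iff)
  finally show "cmod (z - c0) < r0 \<longleftrightarrow> sin (t + (th1 - th0) / 2) > 0" .
  have "cmod (z - c0) \<le> r0 \<longleftrightarrow> (cmod (z - c0))\<^sup>2 - r0\<^sup>2 \<le> 0"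
    using r0 abs_le_square_iff[of "cmod (z - c0)" r0] by auto
  also have "\<dots> \<longleftrightarrow> sin (t + (th1 - th0) / 2) \<ge> 0"
    using k by (simp add: 0 zero_le_mult_iff)
  finally show "cmod (z - c0) \<le> r0 \<longleftrightarrow> sin (t + (th1 - th0) / 2) \<ge> 0" .
qed

lemma half_angle: "0 < (th1 - th0) / 2" "(th1 - th0) / 2 < pi / 2"
  using th0 th1 th0_less_th1 by simp_all

lemma not_E_iff:
  assumes "\<phi> \<noteq> 1" "z = cnj a + (a - cnj a) / (1 - \<phi>)"
    and "\<phi> = of_real R * cis (m + t)" "R > 0" "- pi < t" "t \<le> pi"
  shows "z \<notin> E \<longleftrightarrow> \<bar>t\<bar> < b * pi / 2"
proof -
  have "z \<notin> E \<longleftrightarrow> r1 < cmod (z - c1) \<or> cmod (z - c0) < r0"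
    by (auto simp: lens_def)
  also have "\<dots> \<longleftrightarrow> \<bar>t\<bar> < b * pi / 2"
    unfolding arc_sides(1,2)[OF assms(1-4)] b_pi by (rule sin_or_sin_iff[OF half_angle assms(5,6)])
  finally show ?thesis .
qed

lemma psi_not_E:
  assumes "cmod z < 1" "z \<noteq> 0"
  shows "psi z \<notin> E"
proof -
  have S: "S z \<noteq> 0" using N_D_nonzero assms by simp
  have "\<bar>Im (Ln (S z))\<bar> < pi / 2" using Re_S_pos[OF assms(1)] S Re_Ln_pos_lt by blast
  hence lt: "\<bar>b * Im (Ln (S z))\<bar> < b * pi / 2" using b by (simp add: abs_mult)
  moreover have "b * pi / 2 < pi" using b by simp
  ultimately have "- pi < b * Im (Ln (S z))" "b * Im (Ln (S z)) \<le> pi" by linarith+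
  from not_E_iff[OF phi_neq_1 psi_def phi_eq _ this] show ?thesis
    using assms S lt by simp
qed

lemma psi_closed_exterior:
  assumes "cmod z \<le> 1" "z \<noteq> 0"
  shows "r1 \<le> cmod (psi z - c1) \<or> cmod (psi z - c0) \<le> r0"
proof (cases "S z = 0")
  case True
  \<comment> \<open>\<open>S z = 0\<close> holds at both corners, at the second one because of
    division by zero. There \<open>psi\<close> has the default value \<open>a\<close>, although its
    limit is \<open>cnj a\<close>.\<close>
  hence "psi z = a" by (simp add: psi_def phi_def)
  thus ?thesis by (simp add: r1_def)
next
  case S: False
  define t where "t = b * Im (Ln (S z))"
  define d where "d = (th1 - th0) / 2"
  have le: "\<bar>t\<bar> \<le> pi - d"
    using mult_left_mono[OF abs_Arg_S[OF assms(1) S], of b] b b_pi by (simp add: abs_mult t_def d_def)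
  have "sin (t - d) \<le> 0 \<or> sin (t + d) \<ge> 0"
  proof (cases "t < d")
    case True
    have "sin (d - t) \<ge> 0" by (rule sin_ge_zero) (use True le in linarith)+
    thus ?thesis using sin_minus[of "d - t"] by simp
  next
    case False
    have "sin (t + d) \<ge> 0" by (rule sin_ge_zero) (use False half_angle le in \<open>unfold d_def, linarith\<close>)+
    thus ?thesis ..
  qed
  thus ?thesis using arc_sides(3,4)[OF phi_neq_1[OF assms] psi_def phi_eq[OF S]] S
    by (simp add: t_def d_def)
qed

lemma phi_has_field_derivative:
  assumes "cmod z \<le> 1" "S z \<noteq> 0"
  shows "(phi has_field_derivative (- 2 * \<i> * b * cos eta * q * phi z / (N z * D z))) (at z)"
proof -
  have nz: "N z \<noteq> 0" "D z \<noteq> 0" using assms by (auto simp: S_def)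
  have "(S has_field_derivative (- \<i> * (D z + q * N z) / (D z)\<^sup>2)) (at z)"
    unfolding S_def N_def D_def using nz
    by (auto intro!: derivative_eq_intros simp: N_def D_def power2_eq_square algebra_simps)
  hence dS: "(S has_field_derivative (- 2 * \<i> * cos eta * q / (D z)\<^sup>2)) (at z)"
    by (simp add: D_qN mult_ac)
  have "((\<lambda>w. w powr of_real b) has_field_derivative b * (S z powr b / S z)) (at (S z))"
    using has_field_derivative_powr[OF S_not_nonpos[OF assms], of "of_real b"] assms(2)
    by (simp add: powr_diff)
  from DERIV_chain2[OF this dS] have "((\<lambda>z. S z powr b) has_field_derivative
      b * (S z powr b / S z) * (- 2 * \<i> * cos eta * q / (D z)\<^sup>2)) (at z)" .
  from DERIV_cmult[OF this, of "cis m"] show ?thesis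
    unfolding phi_def[abs_def]
    by (rule DERIV_cong) (use nz in \<open>simp add: S_def divide_simps power2_eq_square\<close>)
qed

lemma psi_has_field_derivative:
  assumes "cmod z \<le> 1" "S z \<noteq> 0" "z \<noteq> 0"
  shows "(psi has_field_derivative (- L z / z)) (at z)"
proof -
  have nz: "N z \<noteq> 0" "D z \<noteq> 0" using assms by (auto simp: S_def)
  have ne: "1 - phi z \<noteq> 0" using phi_neq_1[of z] assms by auto
  have aa: "a - cnj a = 2 * \<i> * Im a" by (simp add: complex_eq_iff)
  have "((\<lambda>z. cnj a + (a - cnj a) / (1 - phi z)) has_field_derivative
    ((a - cnj a) * (- 2 * \<i> * b * cos eta * q * phi z / (N z * D z)) / (1 - phi z)\<^sup>2)) (at z)"
    by (rule derivative_eq_intros phi_has_field_derivative assms refl ne)+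
      (use ne in \<open>simp add: divide_simps power2_eq_square\<close>)
  hence "(psi has_field_derivative
    ((a - cnj a) * (- 2 * \<i> * b * cos eta * q * phi z / (N z * D z)) / (1 - phi z)\<^sup>2)) (at z)"
    unfolding psi_def[abs_def] .
  thus ?thesis
    by (rule DERIV_cong) (use assms in \<open>simp add: L_def aa mult_ac\<close>)
qed

lemma psi_holomorphic: "psi holomorphic_on ball 0 1 - {0}"
  by (subst holomorphic_on_open)
    (auto intro!: exI psi_has_field_derivative N_D_nonzero simp: less_imp_le open_delete)

text \<open>This inverts \<open>S\<close>; the modulus bound is the identity |1 + q s|^2 - |q - s|^2
  = 4 Re s cos eta.\<close>

lemma half_plane_phase:
  assumes "Re s > 0"
  shows "1 + q * s \<noteq> 0" "cmod ((q - s) / (\<i> * (1 + q * s))) < 1" "S ((q - s) / (\<i> * (1 + q * s))) = s"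
proof -
  have "(cmod (1 + q * s))\<^sup>2 - (cmod (q - s))\<^sup>2 = 4 * Re s * cos eta"
    unfolding cmod_power2 by (simp add: q_simps) (insert sin_cos_squared_add[of eta], algebra)
  moreover have "4 * Re s * cos eta > 0" using assms cos_eta by simp
  ultimately have "(cmod (q - s))\<^sup>2 < (cmod (1 + q * s))\<^sup>2" by linarith
  hence lt: "cmod (q - s) < cmod (1 + q * s)" by (rule power2_less_imp_less) simp
  thus nz: "1 + q * s \<noteq> 0" by auto
  thus "cmod ((q - s) / (\<i> * (1 + q * s))) < 1" using lt by (simp add: norm_divide norm_mult)
  have i: "\<i> * ((q - s) / (\<i> * (1 + q * s))) = (q - s) / (1 + q * s)" by simp
  have "N ((q - s) / (\<i> * (1 + q * s))) = s * (1 + q\<^sup>2) / (1 + q * s)"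
    "D ((q - s) / (\<i> * (1 + q * s))) = (1 + q\<^sup>2) / (1 + q * s)"
    unfolding N_def D_def mult.commute[of \<i> q] mult.assoc[of q \<i>] i
    using nz by (simp_all add: divide_simps) (simp_all add: algebra_simps power2_eq_square)
  thus "S ((q - s) / (\<i> * (1 + q * s))) = s"
    using nz cos_eta by (simp add: S_def q_square)
qed

text \<open>Off the lens the angle of \<open>W\<close> is less than \<open>b * pi / 2\<close>, so
  its principal root of order \<open>b\<close> lies in the right half-plane, and raising it to the
  power \<open>b\<close> again crosses no cut.\<close>

lemma chi:
  assumes "z \<notin> E"
  shows "cmod (chi z) < 1" "chi z \<noteq> 0" "psi (chi z) = z"
proof -
  have "a \<in> E" "cnj a \<in> E"
    using complex_mod_cnj[of "a - complex_of_real c0"] complex_mod_cnj[of "a - complex_of_real c1"]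
    by (auto simp: lens_def r0_def r1_def)
  hence nz: "z - a \<noteq> 0" "z - cnj a \<noteq> 0" using assms by auto
  define \<phi> where "\<phi> = (z - a) / (z - cnj a)"
  define W where "W = cis (- m) * \<phi>"
  define T where "T = W powr complex_of_real (1 / b)"
  have W0: "W \<noteq> 0" using nz by (simp add: W_def \<phi>_def)
  have "a \<noteq> cnj a" using Im_a by (auto simp: complex_eq_iff)
  hence \<phi>1: "\<phi> \<noteq> 1" using nz by (simp add: \<phi>_def)
  have z: "z = cnj a + (a - cnj a) / (1 - \<phi>)"
    using nz \<open>a \<noteq> cnj a\<close> by (simp add: \<phi>_def divide_simps)
  have "W = of_real (cmod W) * cis (Im (Ln W))"
    using W0 by (metis Arg_eq_Im_Ln rcis_cmod_Arg rcis_def)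
  moreover have "\<phi> = cis m * W" by (simp add: W_def cis_mult flip: mult.assoc)
  ultimately have "\<phi> = of_real (cmod W) * cis (m + Im (Ln W))"
    by (metis cis_mult mult.left_commute)
  from not_E_iff[OF \<phi>1 z this] have "\<bar>Im (Ln W)\<bar> < b * pi / 2"
    using assms W0 mpi_less_Im_Ln Im_Ln_le_pi by simp
  hence lt: "\<bar>1 / b * Im (Ln W)\<bar> < pi / 2"
    using b by (simp add: abs_mult field_simps)
  have "Ln T = of_real (1 / b) * Ln W"
    unfolding T_def by (rule Ln_powr_of_real) (use lt W0 pi_gt_zero in \<open>simp, linarith, linarith\<close>)
  hence LnT: "b * Ln T = Ln W" using b by simp
  have T0: "T \<noteq> 0" using W0 by (simp add: T_def)
  have "\<bar>Im (Ln T)\<bar> < pi / 2" using lt \<open>Ln T = of_real (1 / b) * Ln W\<close> by simp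
  hence T: "Re T > 0" using T0 Re_Ln_pos_lt by blast
  have Tb: "T powr b = W" using T0 W0 LnT by (simp add: powr_def)
  have chi: "chi z = (q - T) / (\<i> * (1 + q * T))" by (simp add: chi_def T_def W_def \<phi>_def)
  show "cmod (chi z) < 1" unfolding chi by (rule half_plane_phase[OF T])
  have "S (chi z) = T" unfolding chi by (rule half_plane_phase[OF T])
  hence phi: "phi (chi z) = \<phi>" by (simp add: phi_def Tb W_def cis_mult flip: mult.assoc)
  thus "chi z \<noteq> 0" using \<phi>1 phi_0 by auto
  show "psi (chi z) = z" unfolding psi_def phi by (rule z[symmetric])
qed

lemma chi_psi:
  assumes "cmod z < 1" "z \<noteq> 0"
  shows "chi (psi z) = z"
proof -
  have S: "S z \<noteq> 0" "D z \<noteq> 0" using N_D_nonzero assms by simp_all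
  have "1 - phi z \<noteq> 0" using phi_neq_1[of z] assms by auto
  moreover have aa: "a \<noteq> cnj a" using Im_a by (auto simp: complex_eq_iff)
  ultimately have "(psi z - a) / (psi z - cnj a) = phi z"
    by (simp add: psi_def divide_simps) (simp add: algebra_simps)
  hence "cis (- m) * ((psi z - a) / (psi z - cnj a)) = S z powr b"
    by (simp add: phi_def cis_mult flip: mult.assoc)
  moreover have "(S z powr b) powr complex_of_real (1 / b) = S z"
    using Ln_S_powr[of z] S assms b by (simp add: powr_def[of "S z powr b"])
  ultimately have "chi (psi z) = (q - S z) / (\<i> * (1 + q * S z))"
    by (simp only: chi_def)
  also have "\<dots> = (q * D z - N z) / (\<i> * (D z + q * N z))"
    using S by (simp add: S_def divide_simps)
  also have "q * D z - N z = \<i> * z * (1 + q\<^sup>2)" by (simp add: D_def N_def algebra_simps power2_eq_square)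
  also have "\<dots> / (\<i> * (D z + q * N z)) = z" using cos_eta by (simp add: D_qN q_square)
  finally show ?thesis .
qed

end

context lens_map
begin

subsection \<open>Boundary behaviour at the corners\<close>

lemma norm_phi: "cmod (phi z) = cmod (S z) powr b"
  by (simp add: phi_def norm_mult norm_powr_real_powr')

lemma isCont_phi: "cmod z \<le> 1 \<Longrightarrow> S z \<noteq> 0 \<Longrightarrow> isCont phi z"
  using phi_has_field_derivative DERIV_isCont by blast

lemma isCont_psi: "cmod z \<le> 1 \<Longrightarrow> S z \<noteq> 0 \<Longrightarrow> z \<noteq> 0 \<Longrightarrow> isCont psi z"
  using psi_has_field_derivative DERIV_isCont by blast

lemma isCont_N: "isCont N z" and isCont_D: "isCont D z"
  unfolding N_def D_def by (intro continuous_intros)+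

lemma isCont_L:
  assumes "cmod z \<le> 1" "S z \<noteq> 0" "z \<noteq> 0"
  shows "isCont L z"
  unfolding L_def[abs_def]
  by (intro continuous_intros isCont_phi isCont_N isCont_D)
    (use assms phi_neq_1[of z] in \<open>auto simp: S_def\<close>)

lemma norm_L:
  "cmod (L z) = 4 * Im a * b * cos eta * cmod z * cmod (phi z) / ((cmod (1 - phi z))\<^sup>2 * cmod (N z) * cmod (D z))"
  using Im_a b cos_eta by (simp add: L_def norm_mult norm_divide norm_power)

lemma D_corner: "D (- \<i> * q) = 1 + q\<^sup>2" and N_corner: "N (\<i> * cnj q) = 2 * cos eta"
proof -
  show "D (- \<i> * q) = 1 + q\<^sup>2" by (simp add: D_def power2_eq_square algebra_simps)
  show "N (\<i> * cnj q) = 2 * cos eta" by (simp add: N_def complex_eq_iff q_simps)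
qed

lemma tendsto_cmod_powr_0:
  fixes f :: "complex \<Rightarrow> complex"
  assumes "isCont f z" "f z = 0" "e > 0"
  shows "((\<lambda>z. cmod (f z) powr e) \<longlongrightarrow> 0) (at z)"
  using assms isContD[OF assms(1)]
  by (intro tendsto_zero_powrI[where b = e]) (auto intro: tendsto_norm_zero)

lemma tendsto_phi_corner: "(phi \<longlongrightarrow> 0) (at (- \<i> * q))"
proof (rule tendsto_norm_zero_cancel)
  have "isCont S (- \<i> * q)" unfolding S_def
    by (intro continuous_intros isCont_N isCont_D) (unfold D_corner q_square, use cos_eta in simp)
  moreover have "S (- \<i> * q) = 0" by (simp add: S_def N_def)
  ultimately show "((\<lambda>z. cmod (phi z)) \<longlongrightarrow> 0) (at (- \<i> * q))"
    unfolding norm_phi using b by (intro tendsto_cmod_powr_0) auto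
qed

lemma tendsto_psi_corner: "(psi \<longlongrightarrow> a) (at (- \<i> * q))"
proof -
  have "((\<lambda>z. cnj a + (a - cnj a) / (1 - phi z)) \<longlongrightarrow> cnj a + (a - cnj a) / (1 - 0)) (at (- \<i> * q))"
    by (intro tendsto_intros tendsto_phi_corner) auto
  thus ?thesis by (simp add: psi_def[abs_def])
qed

text \<open>Near the zero of \<open>N\<close>, |L| is of the order |S|^b / (|N| |D|) = |S|^(b - 1) /
  |D|^2, which vanishes because the exterior angle exceeds pi, that is, b > 1.\<close>

lemma tendsto_L_corner: "(L \<longlongrightarrow> 0) (at (- \<i> * q))"
proof (rule tendsto_norm_zero_cancel)
  define z0 where "z0 = - \<i> * q"
  have D0: "D z0 \<noteq> 0" using cos_eta unfolding z0_def D_corner q_square by simp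
  have S: "isCont S z0" unfolding S_def by (intro continuous_intros isCont_N isCont_D D0)
  have S0: "S z0 = 0" by (simp add: S_def N_def z0_def)
  have "((\<lambda>z. 4 * Im a * b * cos eta * cmod z * cmod (S z) powr (b - 1) / ((cmod (1 - phi z))\<^sup>2 * (cmod (D z))\<^sup>2))
    \<longlongrightarrow> 4 * Im a * b * cos eta * cmod z0 * 0 / ((cmod (1 - 0))\<^sup>2 * (cmod (D z0))\<^sup>2)) (at z0)"
    by (intro tendsto_intros tendsto_cmod_powr_0[OF S S0] tendsto_phi_corner[folded z0_def]
        isContD[OF isCont_D]) (use b D0 in auto)
  moreover have "\<forall>\<^sub>F z in at z0. D z \<noteq> 0"
    using isContD[OF isCont_D[of z0]] D0 by (rule tendsto_imp_eventually_ne)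
  hence "\<forall>\<^sub>F z in at z0. 4 * Im a * b * cos eta * cmod z * cmod (S z) powr (b - 1)
      / ((cmod (1 - phi z))\<^sup>2 * (cmod (D z))\<^sup>2) = cmod (L z)"
  proof eventually_elim
    case (elim z)
    show ?case
    proof (cases "N z = 0")
      case False
      hence "cmod (S z) powr b = cmod (S z) powr (b - 1) * (cmod (N z) / cmod (D z))"
        using elim by (simp add: S_def norm_divide powr_diff)
      thus ?thesis using False elim
        by (simp add: norm_L norm_phi power2_eq_square mult_ac)
    qed (simp add: L_def S_def)
  qed
  ultimately show "((\<lambda>z. cmod (L z)) \<longlongrightarrow> 0) (at (- \<i> * q))"
    unfolding z0_def[symmetric] by (auto intro: Lim_transform_eventually)
qed

lemma tendsto_inverse_S_corner:
  assumes "e > 0"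
  shows "((\<lambda>z. cmod (D z / N z) powr e) \<longlongrightarrow> 0) (at (\<i> * cnj q))"
proof (rule tendsto_cmod_powr_0[OF _ _ assms])
  show "isCont (\<lambda>z. D z / N z) (\<i> * cnj q)"
    by (intro continuous_intros isCont_N isCont_D) (use cos_eta in \<open>simp add: N_corner\<close>)
qed (simp add: D_eq_0_iff)

lemma eventually_corner: "\<forall>\<^sub>F z in at (\<i> * cnj q). N z \<noteq> 0 \<and> D z \<noteq> 0"
proof (intro eventually_conj)
  show "\<forall>\<^sub>F z in at (\<i> * cnj q). N z \<noteq> 0"
    by (rule tendsto_imp_eventually_ne[OF isContD[OF isCont_N]]) (use cos_eta in \<open>simp add: N_corner\<close>)
  show "\<forall>\<^sub>F z in at (\<i> * cnj q). D z \<noteq> 0"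
    unfolding D_eq_0_iff by (rule eventually_neq_at_within)
qed

lemma eventually_norm_phi: "\<forall>\<^sub>F z in at (\<i> * cnj q). cmod (phi z) = inverse (cmod (D z / N z) powr b)"
  using eventually_corner
  by eventually_elim (simp add: norm_phi S_def norm_divide powr_divide)

lemma tendsto_psi_corner': "(psi \<longlongrightarrow> cnj a) (at (\<i> * cnj q))"
proof -
  have "\<forall>\<^sub>F z in at (\<i> * cnj q). 0 < cmod (D z / N z) powr b"
    using eventually_corner by eventually_elim auto
  from filterlim_inverse_at_top[OF tendsto_inverse_S_corner this] b
  have "filterlim (\<lambda>z. cmod (phi z)) at_top (at (\<i> * cnj q))"
    using filterlim_cong[OF refl refl eventually_norm_phi] by auto
  hence "filterlim phi at_infinity (at (\<i> * cnj q))" by (rule filterlim_norm_at_top_imp_at_infinity)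
  hence "filterlim (\<lambda>z. 1 - phi z) at_infinity (at (\<i> * cnj q))"
    using tendsto_add_filterlim_at_infinity[OF tendsto_const[of 1], of "\<lambda>z. - phi z"]
    by (simp add: filterlim_at_infinity[OF order_refl])
  hence "((\<lambda>z. (a - cnj a) / (1 - phi z)) \<longlongrightarrow> 0) (at (\<i> * cnj q))"
    by (intro tendsto_divide_0[OF tendsto_const])
  from tendsto_add[OF tendsto_const[of "cnj a"] this] show ?thesis
    by (simp add: psi_def[abs_def])
qed

text \<open>Here \<open>phi\<close> is large, and |phi| / |1 - phi|^2 is at most four times 1 /
  |phi| = |D / N|^b. Dividing by |D| leaves the positive power b - 1.\<close>

lemma tendsto_L_corner': "(L \<longlongrightarrow> 0) (at (\<i> * cnj q))"
proof (rule Lim_null_comparison)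
  define z1 where "z1 = \<i> * cnj q"
  define C where "C = 4 * Im a * b * cos eta"
  have C: "C \<ge> 0" using Im_a b cos_eta by (simp add: C_def)
  have "\<forall>\<^sub>F z in at z1. cmod (D z / N z) powr b < 1 / 2"
    using tendsto_inverse_S_corner[of b] b by (intro order_tendstoD) (auto simp: z1_def)
  with eventually_corner[folded z1_def] eventually_norm_phi[folded z1_def]
  show "\<forall>\<^sub>F z in at (\<i> * cnj q). norm (L z)
      \<le> 4 * (C * cmod z * cmod (D z / N z) powr (b - 1) / (cmod (N z))\<^sup>2)"
    unfolding z1_def[symmetric]
  proof eventually_elim
    case (elim z)
    define V where "V = cmod (D z / N z) powr b"
    have V: "V > 0" "V < 1 / 2" using elim by (auto simp: V_def)
    have phi: "cmod (phi z) = inverse V" using elim by (simp add: V_def)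
    hence "cmod (phi z) > 2" using V by (simp add: less_imp_inverse_less[of V "1/2", simplified])
    hence "cmod (phi z) \<le> 2 * cmod (1 - phi z)"
      using norm_triangle_ineq[of 1 "phi z - 1"] by (simp add: norm_minus_commute)
    hence "(cmod (phi z))\<^sup>2 \<le> (2 * cmod (1 - phi z))\<^sup>2" by (intro power_mono) auto
    hence sq: "(cmod (phi z))\<^sup>2 / (cmod (1 - phi z))\<^sup>2 \<le> 4"
      by (simp add: power_mult_distrib divide_le_eq zero_le_mult_iff)
    have V2: "V = cmod (D z / N z) powr (b - 1) * (cmod (D z) / cmod (N z))"
      using elim by (simp add: V_def powr_diff norm_divide)
    have "cmod (L z) = C * cmod z * ((cmod (phi z))\<^sup>2 / (cmod (1 - phi z))\<^sup>2) * V / (cmod (N z) * cmod (D z))"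
      unfolding norm_L C_def using V by (simp add: phi power2_eq_square field_simps)
    also have "\<dots> = ((cmod (phi z))\<^sup>2 / (cmod (1 - phi z))\<^sup>2) * (C * cmod z * cmod (D z / N z) powr (b - 1) / (cmod (N z))\<^sup>2)"
      unfolding V2 using elim by (simp add: power2_eq_square mult_ac)
    also have "\<dots> \<le> 4 * (C * cmod z * cmod (D z / N z) powr (b - 1) / (cmod (N z))\<^sup>2)"
      using C by (intro mult_right_mono sq) auto
    finally show ?case by simp
  qed
  have "((\<lambda>z. 4 * (C * cmod z * cmod (D z / N z) powr (b - 1) / (cmod (N z))\<^sup>2))
    \<longlongrightarrow> 4 * (C * cmod z1 * 0 / (cmod (N z1))\<^sup>2)) (at z1)"
    unfolding z1_def
    by (intro tendsto_intros tendsto_inverse_S_corner isContD[OF isCont_N])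
      (use b cos_eta in \<open>simp_all add: N_corner\<close>)
  thus "((\<lambda>z. 4 * (C * cmod z * cmod (D z / N z) powr (b - 1) / (cmod (N z))\<^sup>2)) \<longlongrightarrow> 0) (at (\<i> * cnj q))"
    by (simp add: z1_def)
qed

text \<open>The second point is the pole of \<open>S\<close>, where division by zero gives the value
  0; a single condition thus singles out both corners.\<close>

lemma S_eq_0_iff: "S z = 0 \<longleftrightarrow> z = - \<i> * q \<or> z = \<i> * cnj q"
  by (auto simp: S_def N_eq_0_iff D_eq_0_iff)

text \<open>Division by zero gives \<open>L\<close> at the corners the very value that is its limit
  there.\<close>

lemma L_corner: "S z = 0 \<Longrightarrow> L z = 0"
  by (auto simp: L_def S_def)

lemma tendsto_L_S_0:
  assumes "S z = 0"
  shows "(L \<longlongrightarrow> 0) (at z)"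
  using assms tendsto_L_corner tendsto_L_corner' by (auto simp: S_eq_0_iff)

subsection \<open>Behaviour at the origin\<close>

lemma tendsto_phi_0: "((\<lambda>z. z / (1 - phi z)) \<longlongrightarrow> 1 / (2 * \<i> * b * cos eta)) (at 0)"
proof -
  have nz: "N 0 = q" "D 0 = 1" by (simp_all add: N_def D_def)
  have "(phi has_field_derivative (- 2 * \<i> * b * cos eta)) (at 0)"
    using phi_has_field_derivative[of 0] N_D_nonzero[of 0] by (simp add: nz phi_0)
  hence "((\<lambda>z. (phi z - 1) / z) \<longlongrightarrow> - 2 * \<i> * b * cos eta) (at 0)"
    by (simp add: has_field_derivative_iff phi_0)
  hence "((\<lambda>z. - inverse ((phi z - 1) / z)) \<longlongrightarrow> - inverse (- 2 * \<i> * b * cos eta)) (at 0)"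
    by (intro tendsto_minus tendsto_inverse) (use b cos_eta in auto)
  moreover have "- inverse ((phi z - 1) / z) = z / (1 - phi z)" for z
    by (metis inverse_divide minus_diff_eq minus_divide_right)
  ultimately show ?thesis by (simp add: field_simps)
qed

lemma tendsto_phi_0': "(phi \<longlongrightarrow> 1) (at 0)"
  using isContD[OF isCont_phi[of 0]] N_D_nonzero[of 0] by (simp add: phi_0)

text \<open>The factor \<open>\<i>\<close> of \<open>a - cnj a\<close> cancels against that of the
  derivative of \<open>phi\<close> at 0. The positive limit is the logarithmic capacity of the
  lens.\<close>

lemma tendsto_psi_0: "((\<lambda>z. z * psi z) \<longlongrightarrow> of_real (Im a / (b * cos eta))) (at 0)"
proof -
  have aa: "a - cnj a = 2 * \<i> * Im a" by (simp add: complex_eq_iff)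
  have "((\<lambda>z. z * cnj a + (a - cnj a) * (z / (1 - phi z))) \<longlongrightarrow>
      0 * cnj a + (a - cnj a) * (1 / (2 * \<i> * b * cos eta))) (at 0)"
    by (intro tendsto_intros tendsto_phi_0)
  also have "(\<lambda>z. z * cnj a + (a - cnj a) * (z / (1 - phi z))) = (\<lambda>z. z * psi z)"
    by (simp add: psi_def[abs_def] algebra_simps)
  also have "0 * cnj a + (a - cnj a) * (1 / (2 * \<i> * b * cos eta)) = of_real (Im a / (b * cos eta))"
    using b cos_eta by (simp add: aa field_simps)
  finally show ?thesis .
qed

lemma tendsto_L_0: "((\<lambda>z. z * L z) \<longlongrightarrow> of_real (Im a / (b * cos eta))) (at 0)"
proof -
  have nz: "N 0 = q" "D 0 = 1" by (simp_all add: N_def D_def)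
  have "((\<lambda>z. - (4 * Im a * b * cos eta) * q * (z / (1 - phi z))\<^sup>2 * phi z / (N z * D z)) \<longlongrightarrow>
      - (4 * Im a * b * cos eta) * q * (1 / (2 * \<i> * b * cos eta))\<^sup>2 * 1 / (N 0 * D 0)) (at 0)"
    by (intro tendsto_intros tendsto_phi_0 tendsto_phi_0' isContD[OF isCont_N] isContD[OF isCont_D])
      (simp add: nz)
  also have "(\<lambda>z. - (4 * Im a * b * cos eta) * q * (z / (1 - phi z))\<^sup>2 * phi z / (N z * D z)) = (\<lambda>z. z * L z)"
    by (simp add: L_def fun_eq_iff power_divide power2_eq_square[of "_ :: complex"] mult_ac)
  also have "- (4 * Im a * b * cos eta) * q * (1 / (2 * \<i> * b * cos eta))\<^sup>2 * 1 / (N 0 * D 0)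
      = of_real (Im a / (b * cos eta))"
    using b cos_eta by (simp add: nz power2_eq_square field_simps)
  finally show ?thesis .
qed

lemma psi_0_limit_pos: "Im a / (b * cos eta) > 0"
  using Im_a b cos_eta by simp

lemma filterlim_psi_0: "filterlim psi at_infinity (at 0)"
proof -
  have "filterlim (\<lambda>z. (z * psi z) / z) at_infinity (at 0)"
    by (rule filterlim_divide_at_infinity[OF tendsto_psi_0])
      (use psi_0_limit_pos filterlim_ident in \<open>auto\<close>)
  moreover have "\<forall>\<^sub>F z in at 0. (z * psi z) / z = psi z"
    by (simp add: eventually_at_filter)
  ultimately show ?thesis by (rule filterlim_mono_eventually[OF _ order_refl order_refl])
qed

lemma tendsto_L_psi_0: "((\<lambda>z. L z / psi z) \<longlongrightarrow> 1) (at 0)"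
proof -
  define k where "k = complex_of_real (Im a / (b * cos eta))"
  have k: "k \<noteq> 0" using psi_0_limit_pos unfolding k_def of_real_eq_0_iff by linarith
  have "((\<lambda>z. (z * L z) / (z * psi z)) \<longlongrightarrow> k / k) (at 0)"
    unfolding k_def by (rule tendsto_divide[OF tendsto_L_0 tendsto_psi_0 k[unfolded k_def]])
  hence "((\<lambda>z. (z * L z) / (z * psi z)) \<longlongrightarrow> 1) (at 0)" unfolding divide_self[OF k] .
  thus ?thesis
    by (rule Lim_transform_eventually) (simp add: eventually_at_filter)
qed

subsection \<open>Boundary values on the two arcs\<close>

text \<open>On the unit circle \<open>cnj z\<close> is the inverse of \<open>z\<close>, which makes
  \<open>N z * D z\<close> a real multiple of \<open>q * z\<close>. Hence only
  \<open>phi z / (1 - phi z)\<^sup>2\<close> determines the direction of \<open>L z\<close>.\<close>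

lemma N_D_circle:
  assumes "cmod z = 1"
  shows "N z * D z = 2 * complex_of_real (Re z + sin eta) * (q * z)"
proof -
  have z: "z * cnj z = 1" using assms complex_norm_square[of z] by simp
  have "N z * D z = q + q * z\<^sup>2 + \<i> * z * (q\<^sup>2 - 1)" by (simp add: N_def D_def algebra_simps power2_eq_square)
  also have "\<dots> = q * z * (cnj z + z + \<i> * (q - cnj q))"
    using z q_simps by (simp add: algebra_simps power2_eq_square)
  also have "cnj z + z + \<i> * (q - cnj q) = of_real (2 * (Re z + sin eta))"
    by (simp add: complex_eq_iff q_simps)
  finally show ?thesis by (simp add: mult_ac)
qed

text \<open>That the factor is real has a geometric reason: t -> psi (cis t) has velocity -i L and
  runs on a circle about \<open>c\<close>, so \<open>L\<close> is parallel to the radius. The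
  explicit factor also yields the sign: for sin th > 0 it is that of
  \<open>Re z + sin eta\<close>.\<close>

lemma L_arc:
  fixes c r th T :: real
  assumes z: "cmod z = 1" "Re z + sin eta \<noteq> 0"
    and phi: "phi z = - of_real T * cis th" and T: "T > 0"
    and c: "a - c = r * cis th" and r: "r > 0"
  shows "cmod (psi z - c) = r"
    and "L z = of_real (2 * b * cos eta * sin th * T / ((cmod (1 + T * cis th))\<^sup>2 * (Re z + sin eta))) * (psi z - c)"
proof -
  have z0: "z \<noteq> 0" using z by auto
  have ne: "1 + T * cis th \<noteq> 0" using phi_neq_1[of z] z z0 phi by (auto simp: add_eq_0_iff minus_equation_iff)
  have "cmod (cis th + T) = cmod (cis th * (1 + T * cis (- th)))"
    by (simp add: distrib_left cis_mult mult.left_commute[of "cis th"])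
  also have "\<dots> = cmod (cnj (1 + T * cis th))" by (simp add: norm_mult cis_cnj)
  finally have nrm: "cmod (cis th + T) = cmod (1 + T * cis th)" by (simp only: complex_mod_cnj)
  have psi: "psi z - c = r * (cis th + T) / (1 + T * cis th)"
    using circle_through_points(1)[OF c phi_neq_1 psi_def, of z] z z0
    by (simp add: phi cis_mult)
  thus "cmod (psi z - c) = r" using ne r nrm by (simp add: norm_divide norm_mult)
  have sq: "of_real ((cmod (1 + T * cis th))\<^sup>2) * cis th = (1 + T * cis th) * (cis th + T)"
  proof -
    have "(1 + T * cis (- th)) * cis th = cis th + T"
      by (simp add: distrib_right mult.assoc cis_mult)
    thus ?thesis unfolding complex_norm_square by (simp add: cis_cnj mult.assoc)
  qed
  have y: "Im a = r * sin th" using arg_cong[OF c, of Im] by simp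
  have "L z = - (4 * Im a * b * cos eta) * q * z * (- of_real T * cis th)
      / ((1 + T * cis th)\<^sup>2 * (2 * complex_of_real (Re z + sin eta) * (q * z)))"
    unfolding L_def mult.assoc[of _ "N z"] N_D_circle[OF z(1)] by (simp add: phi)
  also have "\<dots> = 2 * b * cos eta * sin th * T * r * cis th / ((1 + T * cis th)\<^sup>2 * (Re z + sin eta))"
  proof -
    define R where "R = complex_of_real (Re z + sin eta)"
    have "R \<noteq> 0" using z(2) unfolding R_def of_real_eq_0_iff .
    thus ?thesis using z0 ne unfolding R_def[symmetric] by (simp add: y field_simps)
  qed
  also have "\<dots> = of_real (2 * b * cos eta * sin th * T / ((cmod (1 + T * cis th))\<^sup>2 * (Re z + sin eta))) * (psi z - c)"
  proof -
    define w where "w = 1 + T * cis th"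
    define v where "v = cis th + T"
    define n where "n = complex_of_real ((cmod w)\<^sup>2)"
    have n: "n \<noteq> 0" "w \<noteq> 0" "n * cis th = w * v" using ne sq by (auto simp: n_def w_def v_def)
    hence "cis th = w * v / n" by (simp add: field_simps)
    moreover define R where "R = complex_of_real (Re z + sin eta)"
    moreover have "R \<noteq> 0" using z(2) unfolding R_def of_real_eq_0_iff .
    ultimately show ?thesis using n
      unfolding psi w_def[symmetric] v_def[symmetric] of_real_divide of_real_mult n_def[symmetric] R_def[symmetric]
      by (simp add: field_simps power2_eq_square)
  qed
  finally show "L z = of_real (2 * b * cos eta * sin th * T / ((cmod (1 + T * cis th))\<^sup>2 * (Re z + sin eta))) * (psi z - c)" .
qed

lemma S_circle_nonzero:
  assumes "cmod z = 1" "Re z + sin eta \<noteq> 0"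
  shows "S z \<noteq> 0"
proof -
  have "N z * D z \<noteq> 0"
    unfolding N_D_circle[OF assms(1)] using assms by (auto simp flip: of_real_add)
  thus ?thesis by (simp add: S_def)
qed

text \<open>\<open>S\<close> maps the outer arc to the negative imaginary axis, and
  \<open>m - b * pi / 2 = th1 - pi\<close>. On the inner arc it is the positive imaginary axis, and
  \<open>m + b * pi / 2 = th0 + pi\<close>.\<close>

lemma phi_outer_arc:
  assumes "cmod z = 1" "Re z + sin eta > 0"
  shows "phi z = - of_real (cmod (S z) powr b) * cis th1"
proof -
  have S: "S z \<noteq> 0" using S_circle_nonzero[of z] assms by simp
  hence "D z \<noteq> 0" by (auto simp: S_def)
  hence "Im (S z) < 0" using assms by (simp add: Im_S_circle divide_neg_pos)
  moreover define r where "r = - Im (S z)"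
  ultimately have r: "r > 0" by simp
  have "S z = of_real r * (- \<i>)"
    using Re_S_circle[OF assms(1)] by (simp add: complex_eq_iff r_def)
  hence Ln: "Im (Ln (S z)) = - (pi / 2)"
    using Ln_times_of_real[of r "- \<i>"] r by (simp add: Ln_of_real)
  have "phi z = of_real (cmod (S z) powr b) * cis (m - b * pi / 2)"
    using phi_eq[OF S, unfolded Ln] by simp
  also have "m - b * pi / 2 = th1 - pi" unfolding b_pi by (simp add: m_def field_simps)
  also have "cis (th1 - pi) = - cis th1" by (simp add: cis_divide[symmetric])
  finally show ?thesis by simp
qed

lemma phi_inner_arc:
  assumes "cmod z = 1" "Re z + sin eta < 0"
  shows "phi z = - of_real (cmod (S z) powr b) * cis th0"
proof -
  have S: "S z \<noteq> 0" using S_circle_nonzero[of z] assms by simp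
  hence "D z \<noteq> 0" by (auto simp: S_def)
  hence "Im (S z) > 0" using assms by (simp add: Im_S_circle zero_less_divide_iff)
  moreover define r where "r = Im (S z)"
  ultimately have r: "r > 0" by simp
  have "S z = of_real r * \<i>"
    using Re_S_circle[OF assms(1)] by (simp add: complex_eq_iff r_def)
  hence Ln: "Im (Ln (S z)) = pi / 2"
    using Ln_times_of_real[of r "\<i>"] r by (simp add: Ln_of_real)
  have "phi z = of_real (cmod (S z) powr b) * cis (m + b * pi / 2)"
    using phi_eq[OF S, unfolded Ln] by simp
  also have "m + b * pi / 2 = th0 + pi" unfolding b_pi by (simp add: m_def field_simps)
  also have "cis (th0 + pi) = - cis th0" by (simp add: cis_mult[symmetric])
  finally show ?thesis by simp
qed

lemma L_outer_arc:
  assumes "cmod z = 1" "Re z + sin eta > 0"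
  obtains l :: real where "l \<ge> 0" "L z = l * (psi z - c1)" "cmod (psi z - c1) = r1"
proof -
  have "S z \<noteq> 0" "Re z + sin eta \<noteq> 0" using S_circle_nonzero[of z] assms by simp_all
  note arc = L_arc[OF assms(1) this(2) phi_outer_arc[OF assms] _ a_c1 r1]
  show ?thesis
    by (rule that[OF _ arc(2,1)]) (use \<open>S z \<noteq> 0\<close> assms b cos_eta sin_gt_zero[OF th1] in auto)
qed

lemma L_inner_arc:
  assumes "cmod z = 1" "Re z + sin eta < 0"
  obtains l :: real where "l \<le> 0" "L z = l * (psi z - c0)" "cmod (psi z - c0) = r0"
proof -
  have "S z \<noteq> 0" "Re z + sin eta \<noteq> 0" using S_circle_nonzero[of z] assms by simp_all
  note arc = L_arc[OF assms(1) this(2) phi_inner_arc[OF assms] _ a_c0 r0]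
  show ?thesis
    by (rule that[OF _ arc(2,1)])
      (use \<open>S z \<noteq> 0\<close> assms b cos_eta sin_gt_zero[OF th0] in \<open>auto intro!: divide_nonneg_neg mult_pos_neg simp: mult_le_0_iff divide_le_0_iff\<close>)
qed


subsection \<open>The total variation of the argument along the inner arc\<close>

lemma inner_arc_interval:
  assumes "pi / 2 + eta < t" "t < 3 * pi / 2 - eta"
  shows "Re (cis t) + sin eta < 0"
proof -
  have "cos t + sin eta < 0"
  proof (cases "t \<le> pi")
    case True
    have "cos t < cos (pi / 2 + eta)"
      using assms True eta by (intro cos_monotone_0_pi) auto
    thus ?thesis by (simp add: cos_add)
  next
    case False
    have "cos (2 * pi - t) < cos (pi / 2 + eta)"
      using assms False eta by (intro cos_monotone_0_pi) auto
    thus ?thesis by (simp add: cos_add cos_diff)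
  qed
  thus ?thesis by simp
qed

lemma outer_arc_interval:
  assumes "0 \<le> t" "t \<le> 2 * pi" "t < pi / 2 + eta \<or> 3 * pi / 2 - eta < t"
  shows "Re (cis t) + sin eta > 0"
proof -
  have *: "cos s + sin eta > 0" if "0 \<le> s" "s < pi / 2 + eta" for s
  proof -
    have "cos (pi / 2 + eta) < cos s"
      using that eta by (intro cos_monotone_0_pi) auto
    thus ?thesis by (simp add: cos_add)
  qed
  from assms(3) have "cos t + sin eta > 0"
  proof
    assume "t < pi / 2 + eta"
    thus ?thesis using * assms by simp
  next
    assume "3 * pi / 2 - eta < t"
    hence "cos (2 * pi - t) + sin eta > 0" using assms by (intro *) auto
    thus ?thesis by (simp add: cos_diff)
  qed
  thus ?thesis by simp
qed

text \<open>With growing \<open>t\<close>, the inner arc is traversed from \<open>cnj a\<close> to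
  \<open>a\<close>.\<close>

lemma inner_arc_corners: "cis (pi / 2 + eta) = \<i> * cnj q" "cis (3 * pi / 2 - eta) = - \<i> * q"
proof -
  show "cis (pi / 2 + eta) = \<i> * cnj q" by (simp add: q_def cis_cnj flip: cis_mult)
  have "3 * pi / 2 = pi + pi / 2" by simp
  hence "cis (3 * pi / 2) = - \<i>" by (simp only: cis_mult[symmetric]) simp
  thus "cis (3 * pi / 2 - eta) = - \<i> * q"
    by (simp only: diff_conv_add_uminus cis_mult[symmetric] q_def)
qed

text \<open>This keeps the principal argument of \<open>psi z - c0\<close> differentiable along the
  inner arc. Reaching the leftmost point of the circle would force
  \<open>sin th0 * (1 + T) = 0\<close>.\<close>

lemma psi_c0_not_nonpos:
  assumes "cmod z = 1" "Re z + sin eta < 0"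
  shows "psi z - c0 \<notin> \<real>\<^sub>\<le>\<^sub>0"
proof
  assume neg: "psi z - c0 \<in> \<real>\<^sub>\<le>\<^sub>0"
  define T where "T = cmod (S z) powr b"
  have S: "S z \<noteq> 0" using S_circle_nonzero[of z] assms by simp
  have phi: "phi z = - of_real T * cis th0" unfolding T_def by (rule phi_inner_arc[OF assms])
  have T: "T > 0" using S by (simp add: T_def)
  have z0: "z \<noteq> 0" using assms by auto
  have ne: "phi z \<noteq> 1" using phi_neq_1[of z] z0 assms by simp
  have "cmod (psi z - c0) = r0"
    using L_arc(1)[OF assms(1) _ phi T a_c0 r0] assms by simp
  hence "psi z - c0 = - r0"
    using neg r0 by (auto elim!: nonpos_Reals_cases)
  hence "of_real r0 * ((cis th0 + T) / (1 - phi z)) = of_real r0 * (- 1)"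
    using circle_through_points(1)[OF a_c0 ne psi_def] by (simp add: phi cis_mult mult.assoc)
  hence "(cis th0 + T) / (1 - phi z) = - 1" by (rule mult_left_cancel[THEN iffD1, rotated]) (use r0 in simp)
  hence "cis th0 + T = - (1 - phi z)" using ne by (simp add: divide_eq_eq)
  hence "Im (cis th0 + T) = Im (- (1 - phi z))" by (rule arg_cong)
  hence "sin th0 * (1 + T) = 0" by (simp add: phi algebra_simps)
  thus False using T sin_gt_zero[OF th0] by simp
qed

lemma cis_has_vector_derivative: "(cis has_vector_derivative \<i> * cis t) (at t)"
  using has_derivative_cis[OF has_derivative_ident, of t UNIV]
  by (simp add: has_vector_derivative_def)

text \<open>The limit of \<open>f\<close> is punctured, so its default value at a corner does no
  harm provided \<open>cis t\<close> meets \<open>z\<close> only at \<open>x\<close>; the radius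
  \<open>pi\<close> ensures this.\<close>

lemma tendsto_cis_at:
  fixes z :: complex
  assumes "(f \<longlongrightarrow> l) (at z)" "cis x = z" "X \<subseteq> ball x pi"
  shows "((\<lambda>t. f (cis t)) \<longlongrightarrow> l) (at x within X)"
proof (rule filterlim_compose[OF assms(1)], unfold filterlim_at, intro conjI)
  show "(cis \<longlongrightarrow> z) (at x within X)"
    unfolding assms(2)[symmetric] by (intro tendsto_intros)
  have "cis t \<noteq> z" if "t \<in> X" "t \<noteq> x" for t
  proof
    assume "cis t = z"
    hence "cis (t - x) = 1" using assms(2) by (auto simp: cis_divide[symmetric])
    hence "cos \<bar>t - x\<bar> = 1" by (simp add: complex_eq_iff)
    moreover have "cos \<bar>t - x\<bar> < cos 0"
      using that assms(3) by (intro cos_monotone_0_pi) (auto simp: dist_real_def abs_minus_commute)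
    ultimately show False by simp
  qed
  thus "\<forall>\<^sub>F t in at x within X. cis t \<in> UNIV \<and> cis t \<noteq> z"
    unfolding eventually_at_filter by (intro always_eventually) auto
qed

text \<open>The integrand is the derivative of the argument of \<open>psi (cis t) - c0\<close>,
  which grows from \<open>- th0\<close> to \<open>th0\<close>.\<close>

lemma has_integral_inner_arc:
  "((\<lambda>t. - Re (L (cis t) / (psi (cis t) - c0))) has_integral 2 * th0) {pi / 2 + eta..3 * pi / 2 - eta}"
proof -
  define x where "x = pi / 2 + eta"
  define y where "y = 3 * pi / 2 - eta"
  have xy: "x < y" "y - x < pi" using eta by (simp_all add: x_def y_def)
  \<comment> \<open>At the initial point \<open>psi\<close> carries the default value
    \<open>a\<close> instead of its limit \<open>cnj a\<close>, so the argument has to be prescribed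
    there.\<close>
  define s where "s t = (if t = x then - th0 else Im (Ln (psi (cis t) - c0)))" for t
  have cx: "cis x = \<i> * cnj q" and cy: "cis y = - \<i> * q"
    using inner_arc_corners by (simp_all only: x_def y_def)
  have Sy: "S (- \<i> * q) = 0" by (simp add: S_eq_0_iff)
  have psi_y: "psi (- \<i> * q) = a" by (simp only: psi_def phi_def Sy) simp
  have nonpos: "a - c0 \<notin> \<real>\<^sub>\<le>\<^sub>0" "cnj a - c0 \<notin> \<real>\<^sub>\<le>\<^sub>0"
    using Im_a by (auto simp: complex_nonpos_Reals_iff)
  have th0_eq: "Im (Ln (a - c0)) = th0"
    unfolding th0_def by (rule Arg_eq_Im_Ln[symmetric]) (use Im_a in \<open>auto simp: complex_eq_iff\<close>)
  have "Ln (cnj a - c0) = cnj (Ln (a - c0))"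
    using cnj_Ln[OF nonpos(1)] by simp
  hence th0_eq': "Im (Ln (cnj a - c0)) = - th0" by (simp add: th0_eq)
  have deriv: "(s has_vector_derivative - Re (L (cis t) / (psi (cis t) - c0))) (at t)" if t: "t \<in> {x<..<y}" for t
  proof -
    have inner: "Re (cis t) + sin eta < 0" using inner_arc_interval t by (simp add: x_def y_def)
    hence S: "S (cis t) \<noteq> 0" using S_circle_nonzero[of "cis t"] by simp
    have "(psi \<circ> cis has_vector_derivative (\<i> * cis t) * (- L (cis t) / cis t)) (at t)"
      by (rule field_vector_diff_chain_at[OF cis_has_vector_derivative])
        (use psi_has_field_derivative[OF _ S] in simp)
    hence "((\<lambda>t. psi (cis t) - c0) has_vector_derivative - (\<i> * L (cis t))) (at t)"
      by (auto simp: o_def intro!: derivative_eq_intros)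
    from field_vector_diff_chain_at[OF this, of Ln]
    have "((\<lambda>t. Ln (psi (cis t) - c0)) has_vector_derivative - (\<i> * L (cis t)) * inverse (psi (cis t) - c0)) (at t)"
      using has_field_derivative_Ln[OF psi_c0_not_nonpos[OF _ inner]] by (simp add: o_def)
    moreover have "- (\<i> * L (cis t)) * inverse (psi (cis t) - c0) = - (\<i> * (L (cis t) / (psi (cis t) - c0)))"
      by (simp add: divide_inverse)
    ultimately have "((\<lambda>t. Im (Ln (psi (cis t) - c0))) has_vector_derivative Im (- (\<i> * (L (cis t) / (psi (cis t) - c0))))) (at t)"
      using bounded_linear.has_vector_derivative[OF bounded_linear_Im] by metis
    hence "((\<lambda>t. Im (Ln (psi (cis t) - c0))) has_vector_derivative - Re (L (cis t) / (psi (cis t) - c0))) (at t)"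
      by (simp only: uminus_complex.sel Im_i_times)
    thus ?thesis
      by (rule has_vector_derivative_transform_within_open[where S = "{x<..<y}"])
        (use t in \<open>auto simp: s_def\<close>)
  qed
  have "continuous (at t within {x..y}) s" if t: "t \<in> {x..y}" for t
  proof -
    consider "t = x" | "t = y" | "t \<in> {x<..<y}" using t by fastforce
    thus ?thesis
    proof cases
      case 1
      have "((\<lambda>t. Im (Ln (psi (cis t) - c0))) \<longlongrightarrow> Im (Ln (cnj a - c0))) (at x within {x..y})"
        by (intro tendsto_intros tendsto_cis_at[OF tendsto_psi_corner' cx] nonpos)
          (use xy in \<open>auto simp: dist_real_def\<close>)
      hence "(s \<longlongrightarrow> Im (Ln (cnj a - c0))) (at x within {x..y})"
        by (rule Lim_transform_eventually) (simp add: eventually_at_filter s_def)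
      thus ?thesis unfolding continuous_within 1 th0_eq' by (simp add: s_def)
    next
      case 2
      have "((\<lambda>t. Im (Ln (psi (cis t) - c0))) \<longlongrightarrow> Im (Ln (a - c0))) (at y within {x..y})"
        by (intro tendsto_intros tendsto_cis_at[OF tendsto_psi_corner cy] nonpos)
          (use xy in \<open>auto simp: dist_real_def\<close>)
      moreover have "\<forall>\<^sub>F t in at y within {x..y}. t \<noteq> x"
        by (rule eventually_neq_at_within)
      hence "\<forall>\<^sub>F t in at y within {x..y}. Im (Ln (psi (cis t) - c0)) = s t"
        by eventually_elim (simp add: s_def)
      ultimately have "(s \<longlongrightarrow> Im (Ln (a - c0))) (at y within {x..y})"
        by (rule Lim_transform_eventually)
      moreover have "s y = Im (Ln (a - c0))" using xy unfolding s_def cy psi_y by simp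
      ultimately show ?thesis unfolding continuous_within 2 by simp
    next
      case 3
      thus ?thesis
        using deriv has_vector_derivative_continuous continuous_at_imp_continuous_within by blast
    qed
  qed
  hence "continuous_on {x..y} s" by (simp add: continuous_on_eq_continuous_within)
  from fundamental_theorem_of_calculus_interior[OF less_imp_le[OF xy(1)] this deriv]
  have "((\<lambda>t. - Re (L (cis t) / (psi (cis t) - c0))) has_integral s y - s x) {x..y}" .
  moreover have "s y - s x = 2 * th0"
    using xy unfolding s_def cy psi_y th0_eq by simp
  ultimately show ?thesis by (simp add: x_def y_def)
qed

subsection \<open>Uniqueness of the exterior map\<close>

text \<open>The reciprocal of \<Phi>(psi z), extended by 0, is a holomorphic bijection of the disc
  fixing 0, hence a rotation; positivity of both normalizations at infinity makes it the
  identity.\<close>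

lemma exterior_map_psi:
  assumes ext: "exterior_riemann_map E \<Phi>" and z: "cmod z < 1" "z \<noteq> 0"
  shows "\<Phi> (psi z) = 1 / z"
proof -
  have hol: "\<Phi> holomorphic_on - E" and bij: "bij_betw \<Phi> (- E) {w. norm w > 1}"
    and lim: "filterlim \<Phi> at_infinity at_infinity"
    using ext by (auto simp: exterior_riemann_map_def)
  obtain d :: real where d: "d > 0" "((\<lambda>z. \<Phi> z / z) \<longlongrightarrow> d) at_infinity"
    using ext by (auto simp: exterior_riemann_map_def)
  define k where "k z = (if z = 0 then 0 else inverse (\<Phi> (psi z)))" for z
  have gt1: "cmod (\<Phi> (psi z)) > 1" if "cmod z < 1" "z \<noteq> 0" for z
    using bij_betw_apply[OF bij, of "psi z"] psi_not_E[OF that] by simp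
  have "(\<Phi> \<circ> psi) holomorphic_on ball 0 1 - {0}"
    by (rule holomorphic_on_compose_gen[OF psi_holomorphic hol]) (use psi_not_E in auto)
  hence "(\<lambda>z. inverse (\<Phi> (psi z))) holomorphic_on ball 0 1 - {0}"
    unfolding o_def by (rule holomorphic_on_inverse) (use gt1 in force)
  hence k1: "k holomorphic_on ball 0 1 - {0}"
    by (rule holomorphic_transform) (simp add: k_def)
  have "((\<lambda>z. inverse (\<Phi> (psi z))) \<longlongrightarrow> 0) (at 0)"
    using filterlim_compose[OF tendsto_inverse_0 filterlim_compose[OF lim filterlim_psi_0]] .
  hence "(k \<longlongrightarrow> k 0) (at 0)"
    unfolding k_def by (rule_tac Lim_transform_eventually) (auto simp: eventually_at_filter)
  hence k: "k holomorphic_on ball 0 1"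
    by (intro no_isolated_singularity'[OF _ k1]) (auto simp: at_within_open[of _ "ball 0 1"])
  have k_lt: "cmod (k z) < 1" if "cmod z < 1" for z
    using gt1[OF that] by (auto simp: k_def norm_inverse inverse_less_1_iff)
  have inj: "inj_on k (ball 0 1)"
  proof (rule inj_onI)
    fix x y assume xy: "x \<in> ball 0 1" "y \<in> ball 0 1" and eq: "k x = k y"
    show "x = y"
    proof (cases "x = 0 \<or> y = 0")
      case True
      thus ?thesis using eq gt1[of x] gt1[of y] xy by (force simp: k_def split: if_splits)
    next
      case False
      hence "\<Phi> (psi x) = \<Phi> (psi y)" using eq by (simp add: k_def)
      moreover have "psi x \<in> - E" "psi y \<in> - E"
        using psi_not_E[of x] psi_not_E[of y] xy False by simp_all
      ultimately have "psi x = psi y" by (rule inj_onD[OF bij_betw_imp_inj_on[OF bij]])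
      moreover have "chi (psi x) = x" "chi (psi y) = y"
        using chi_psi[of x] chi_psi[of y] xy False by simp_all
      ultimately show ?thesis by metis
    qed
  qed
  have surj: "k ` ball 0 1 = ball 0 1"
  proof (rule antisym)
    show "ball 0 1 \<subseteq> k ` ball 0 1"
    proof
      fix w :: complex assume w: "w \<in> ball 0 1"
      show "w \<in> k ` ball 0 1"
      proof (cases "w = 0")
        case False
        hence "inverse w \<in> {w. norm w > 1}" using w by (simp add: norm_inverse one_less_inverse)
        then obtain u where u: "u \<notin> E" "\<Phi> u = inverse w"
          using bij_betw_imp_surj_on[OF bij] by force
        have "k (chi u) = w" using chi[OF u(1)] u(2) by (simp add: k_def)
        thus ?thesis using chi[OF u(1)] by (metis imageI mem_ball_0)
      qed (auto simp: k_def intro!: image_eqI[of _ _ 0])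
    qed
  qed (use k_lt in auto)
  obtain g where g: "g holomorphic_on ball 0 1" "\<And>z. z \<in> ball 0 1 \<Longrightarrow> g (k z) = z"
    using holomorphic_has_inverse[OF k open_ball inj] unfolding surj by metis
  have k0: "k 0 = 0" by (simp add: k_def)
  hence g0: "g 0 = 0" using g(2)[of 0] by simp
  have g_lt: "cmod (g w) < 1" if "cmod w < 1" for w
    using that g(2) surj by (metis imageE mem_ball_0)
  \<comment> \<open>The Schwarz lemma for \<open>k\<close> and for its inverse \<open>g\<close> at a
    sample point forces equality, and equality at one nonzero point makes \<open>k\<close> a
    rotation.\<close>
  have "cmod (k (1 / 2)) \<le> cmod (1 / 2)"
    by (rule Schwarz_Lemma(1)[OF k k0 k_lt]) auto
  moreover have "cmod (g (k (1 / 2))) \<le> cmod (k (1 / 2))"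
    by (rule Schwarz_Lemma(1)[OF g(1) g0 g_lt]) (auto intro: k_lt)
  moreover have "g (k (1 / 2)) = 1 / 2" by (rule g(2)) simp
  ultimately have "cmod (k (1 / 2)) = cmod (1 / 2)" by simp
  hence "\<exists>\<alpha>. (\<forall>z. cmod z < 1 \<longrightarrow> k z = \<alpha> * z) \<and> cmod \<alpha> = 1"
    by (intro Schwarz_Lemma(3)[OF k k0 k_lt, of 0]) (auto intro!: exI[of _ "1 / 2"])
  then obtain \<alpha> where \<alpha>: "\<And>z. cmod z < 1 \<Longrightarrow> k z = \<alpha> * z" "cmod \<alpha> = 1" by blast
  define \<kappa> where "\<kappa> = Im a / (b * cos eta)"
  \<comment> \<open>The limit is a product of two positive numbers, while the function itself is the
    constant \<open>inverse \<alpha>\<close> of modulus one near 0.\<close>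
  have "((\<lambda>z. (\<Phi> (psi z) / psi z) * (z * psi z)) \<longlongrightarrow> of_real d * of_real \<kappa>) (at 0)"
    unfolding \<kappa>_def
    by (intro tendsto_mult tendsto_psi_0 filterlim_compose[OF d(2) filterlim_psi_0])
  moreover have "\<forall>\<^sub>F z in at 0. (\<Phi> (psi z) / psi z) * (z * psi z) = inverse \<alpha>"
  proof -
    have "\<forall>\<^sub>F z in at (0::complex). z \<in> ball 0 1 - {0}"
      by (rule eventually_at_in_open) auto
    moreover have "\<forall>\<^sub>F z in at 0. psi z \<noteq> 0"
      using filterlim_at_infinity_imp_eventually_ne[OF filterlim_psi_0] .
    ultimately show ?thesis
    proof eventually_elim
      case (elim z)
      hence "inverse (\<Phi> (psi z)) = \<alpha> * z" using \<alpha>(1)[of z] by (simp add: k_def)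
      hence "\<Phi> (psi z) = inverse (\<alpha> * z)" by (metis inverse_inverse_eq)
      thus ?case using elim by simp
    qed
  qed
  ultimately have "((\<lambda>z. inverse \<alpha>) \<longlongrightarrow> complex_of_real (d * \<kappa>)) (at (0::complex))"
    using Lim_transform_eventually by fastforce
  hence "inverse \<alpha> = complex_of_real (d * \<kappa>)" by (simp add: tendsto_const_iff)
  moreover have "d * \<kappa> > 0" unfolding \<kappa>_def by (rule mult_pos_pos[OF d(1) psi_0_limit_pos])
  moreover have "cmod (inverse \<alpha>) = 1" using \<alpha>(2) by (simp add: norm_inverse)
  ultimately have "inverse \<alpha> = 1"
    by (metis norm_of_real abs_of_pos of_real_1)
  hence "\<alpha> = 1" by simp
  hence "inverse (\<Phi> (psi z)) = z" using \<alpha>(1)[OF z(1)] z by (simp add: k_def)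
  thus ?thesis using z by (metis inverse_eq_divide inverse_inverse_eq)
qed

lemma exterior_map_eq:
  assumes "exterior_riemann_map E \<Phi>" "z \<notin> E"
  shows "\<Phi> z = 1 / chi z"
  using exterior_map_psi[OF assms(1)] chi[OF assms(2)] by metis

end

section \<open>The modulus of the exterior map at the origin\<close>

lemma norm_one_minus_cis: "cmod (1 - cis (2 * x)) = 2 * \<bar>sin x\<bar>"
  and norm_one_plus_cis: "cmod (1 + cis (2 * x)) = 2 * \<bar>cos x\<bar>"
proof -
  have "1 - cis (2 * x) = cis x * (- 2 * \<i> * sin x)"
    unfolding complex_eq_iff cis.sel minus_complex.sel sin_double cos_double_sin
    by (simp add: power2_eq_square)
  moreover have "1 + cis (2 * x) = cis x * (2 * cos x)"
    unfolding complex_eq_iff cis.sel plus_complex.sel sin_double cos_double_cos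
    by (simp add: power2_eq_square)
  ultimately show "cmod (1 - cis (2 * x)) = 2 * \<bar>sin x\<bar>" "cmod (1 + cis (2 * x)) = 2 * \<bar>cos x\<bar>"
    by (simp_all add: norm_mult)
qed

context lens_map
begin

text \<open>At the origin the Moebius quotient is \<open>a / cnj a\<close>, of modulus one and angle
  \<open>2 * Arg a\<close>. Numerator and denominator of \<open>chi 0\<close> are then chords of the
  unit circle, expressed by half-angles.\<close>

lemma norm_chi_0:
  assumes "0 < c0 + r0" "c0 - r0 < c1 - r1"
  shows "cmod (chi 0) = sin (Arg a / b) / sin ((pi + th0 - Arg a) / b)"
proof -
  define \<alpha> where "\<alpha> = Arg a"
  have \<alpha>: "0 < \<alpha>" "\<alpha> < pi" using Im_a Arg_lt_pi[of a] by (auto simp: \<alpha>_def)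
  have a: "a \<noteq> 0" "a \<noteq> cnj a" using Im_a by (auto simp: complex_eq_iff)
  have rcis: "a = cmod a * cis \<alpha>" by (simp add: \<alpha>_def rcis_cmod_Arg[unfolded rcis_def])
  hence "cnj a = cmod a * cis (- \<alpha>)" by (metis cis_cnj complex_cnj_complex_of_real complex_cnj_mult)
  with rcis have quot: "a / cnj a = cis (2 * \<alpha>)"
    using a by (metis cis_divide diff_minus_eq_add mult_2 mult_divide_mult_cancel_left mult_eq_0_iff)
  \<comment> \<open>It ensures that \<open>2 * \<alpha> - m\<close> is a principal angle. The
    position of the origin enters here: either it is inside the circle about \<open>c0\<close>, or
    that circle, and with it \<open>a\<close>, lies in the closed right half-plane.\<close>
  have "2 * \<alpha> - th0 < pi"
  proof (cases "c0 < r0")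
    case True
    have "cmod (0 - complex_of_real c0) < r0" using True assms(1) by simp
    hence "(cmod (0 - complex_of_real c0))\<^sup>2 - r0\<^sup>2 < 0"
      using power_strict_mono[OF _ norm_ge_zero, of "0 - complex_of_real c0" r0 2] by simp
    moreover have "(cmod (0 - complex_of_real c0))\<^sup>2 - r0\<^sup>2
        = - (4 * r0\<^sup>2 * sin th0 * Im (cis (2 * \<alpha>) * cis (- th0))) / (cmod (1 - cis (2 * \<alpha>)))\<^sup>2"
    proof (rule circle_through_points(2)[OF a_c0])
      have ac: "cis (2 * \<alpha>) * cnj a = a" using quot a by (simp add: divide_eq_eq)
      show ne: "cis (2 * \<alpha>) \<noteq> 1" using ac a by auto
      have "a - cnj a = (1 - cis (2 * \<alpha>)) * (- cnj a)" using ac by (simp add: left_diff_distrib)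
      thus "0 = cnj a + (a - cnj a) / (1 - cis (2 * \<alpha>))" using ne by simp
    qed
    moreover have "Im (cis (2 * \<alpha>) * cis (- th0)) = sin (2 * \<alpha> - th0)"
      by (simp only: cis_mult cis.sel diff_conv_add_uminus)
    ultimately have "- (4 * r0\<^sup>2 * sin th0 * sin (2 * \<alpha> - th0)) / (cmod (1 - cis (2 * \<alpha>)))\<^sup>2 < 0"
      by (simp only:)
    hence "sin (2 * \<alpha> - th0) > 0"
      using r0 sin_gt_zero[OF th0] by (auto simp: zero_less_divide_iff zero_less_mult_iff mult_less_0_iff)
    thus ?thesis using sin_le_zero[of "2 * \<alpha> - th0"] \<alpha> th0 by force
  next
    case False
    have "\<bar>Re (a - c0)\<bar> \<le> r0" unfolding r0_def by (rule abs_Re_le_cmod)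
    hence "Re a \<ge> 0" using False by simp
    hence "\<bar>\<alpha>\<bar> \<le> pi / 2" using a Re_Ln_pos_le[of a] by (simp add: \<alpha>_def Arg_eq_Im_Ln)
    thus ?thesis using th0 by linarith
  qed
  moreover define t where "t = 2 * \<alpha> - m"
  ultimately have t: "- pi < t" "t < pi"
    using m b_pi \<alpha> half_angle th0 th1 by (simp_all add: m_def field_simps)
  have "cis (- m) * ((0 - a) / (0 - cnj a)) = cis t"
    by (simp add: quot cis_mult t_def)
  moreover have "cis t powr complex_of_real (1 / b) = cis (t / b)"
  proof -
    have "Ln (cis t) = \<i> * t" unfolding cis_conv_exp using t by (intro Ln_exp) auto
    thus ?thesis by (simp add: powr_def cis_conv_exp)
  qed
  ultimately have "chi 0 = (q - cis (t / b)) / (\<i> * (1 + q * cis (t / b)))"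
    by (simp only: chi_def)
  moreover have "t / b = 2 * (\<alpha> / b) - eta"
    by (simp add: t_def eta_def diff_divide_distrib)
  hence "q - cis (t / b) = q * (1 - cis (2 * (\<alpha> / b)))"
    "1 + q * cis (t / b) = 1 + cis (2 * (\<alpha> / b - eta))"
    by (simp_all add: q_def right_diff_distrib cis_mult)
  ultimately have "cmod (chi 0) = \<bar>sin (\<alpha> / b)\<bar> / \<bar>cos (\<alpha> / b - eta)\<bar>"
    by (simp only: norm_divide norm_mult norm_one_minus_cis norm_one_plus_cis norm_q norm_ii)
  moreover have "\<alpha> < b * pi" using \<alpha> mult_strict_right_mono[OF b(1) pi_gt_zero] by linarith
  hence "\<alpha> / b < pi" using b by (simp add: divide_less_eq mult.commute)
  hence "sin (\<alpha> / b) > 0" using \<alpha> b by (intro sin_gt_zero) auto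
  \<comment> \<open>This rests on \<open>pi + th0 = b * pi / 2 + m\<close> and turns the cosine into
    the sine of the claim.\<close>
  moreover have x: "(pi + th0 - \<alpha>) / b = pi / 2 + eta - \<alpha> / b"
    using b b_pi by (simp add: eta_def m_def field_simps)
  hence "cos (\<alpha> / b - eta) = sin ((pi + th0 - \<alpha>) / b)"
    unfolding x by (simp add: cos_sin_eq algebra_simps)
  moreover have "sin ((pi + th0 - \<alpha>) / b) > 0"
  proof (rule sin_gt_zero)
    show "0 < (pi + th0 - \<alpha>) / b" using \<alpha> th0 b by (intro divide_pos_pos) linarith+
    have "0 < \<alpha> / b" using \<alpha> b by (intro divide_pos_pos) linarith+
    thus "(pi + th0 - \<alpha>) / b < pi" using eta unfolding x by linarith
  qed
  ultimately show ?thesis by (simp add: \<alpha>_def)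
qed

end

subsection \<open>Continuous dependence on the lens\<close>

text \<open>Every logarithm stays off its cut: the shifted corner is in the upper half-plane, and
  \<open>S\<close> is in the right half-plane.\<close>

lemma continuous_on_lens_map:
  fixes \<alpha> \<zeta> :: "'x::t2_space \<Rightarrow> complex" and c0 c1 :: real
  assumes \<alpha>: "continuous_on X \<alpha>" and \<zeta>: "continuous_on X \<zeta>"
    and lens: "\<And>x. x \<in> X \<Longrightarrow> lens_map (\<alpha> x) c0 c1"
    and unit: "\<And>x. x \<in> X \<Longrightarrow> cmod (\<zeta> x) < 1 \<and> \<zeta> x \<noteq> 0"
  shows "continuous_on X (\<lambda>x. lens_parameters.psi (\<alpha> x) c0 c1 (\<zeta> x))"
    and "continuous_on X (\<lambda>x. lens_parameters.L (\<alpha> x) c0 c1 (\<zeta> x))"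
    and "continuous_on X (\<lambda>x. lens_parameters.th0 (\<alpha> x) c0)"
proof -
  have Arg: "continuous_on X (\<lambda>x. Arg (\<alpha> x - complex_of_real c))" for c
  proof -
    have "Im (\<alpha> x) > 0" if "x \<in> X" for x using lens_map.Im_a[OF lens[OF that]] .
    hence "continuous_on X (\<lambda>x. Im (Ln (\<alpha> x - complex_of_real c)))"
      by (intro continuous_intros \<alpha>) (fastforce simp: complex_nonpos_Reals_iff)
    moreover have "Im (Ln (\<alpha> x - complex_of_real c)) = Arg (\<alpha> x - complex_of_real c)" if "x \<in> X" for x
      using lens_map.Im_a[OF lens[OF that]] by (intro Arg_eq_Im_Ln[symmetric]) (auto simp: complex_eq_iff)
    ultimately show ?thesis using continuous_on_cong by fastforce
  qed
  show th0: "continuous_on X (\<lambda>x. lens_parameters.th0 (\<alpha> x) c0)"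
    unfolding lens_parameters.th0_def by (rule Arg)
  have th1: "continuous_on X (\<lambda>x. lens_parameters.th1 (\<alpha> x) c1)"
    unfolding lens_parameters.th1_def by (rule Arg)
  have b: "continuous_on X (\<lambda>x. lens_parameters.b (\<alpha> x) c0 c1)"
    unfolding lens_parameters.b_def by (intro continuous_intros th0 th1) auto
  have m: "continuous_on X (\<lambda>x. lens_parameters.m (\<alpha> x) c0 c1)"
    unfolding lens_parameters.m_def by (intro continuous_intros th0 th1) auto
  have eta: "continuous_on X (\<lambda>x. lens_parameters.eta (\<alpha> x) c0 c1)"
    unfolding lens_parameters.eta_def using lens_map.b[OF lens] by (intro continuous_intros b m) force
  have q: "continuous_on X (\<lambda>x. lens_parameters.q (\<alpha> x) c0 c1)"
    unfolding lens_parameters.q_def by (intro continuous_intros eta)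
  have N: "continuous_on X (\<lambda>x. lens_parameters.N (\<alpha> x) c0 c1 (\<zeta> x))"
    unfolding lens_parameters.N_def by (intro continuous_intros q \<zeta>)
  have D: "continuous_on X (\<lambda>x. lens_parameters.D (\<alpha> x) c0 c1 (\<zeta> x))"
    unfolding lens_parameters.D_def by (intro continuous_intros q \<zeta>)
  have S: "continuous_on X (\<lambda>x. lens_parameters.S (\<alpha> x) c0 c1 (\<zeta> x))"
    unfolding lens_parameters.S_def
    using lens_map.N_D_nonzero(2)[OF lens] unit by (intro continuous_intros N D) blast
  have nz: "lens_parameters.S (\<alpha> x) c0 c1 (\<zeta> x) \<noteq> 0" if "x \<in> X" for x
    using lens_map.N_D_nonzero(3)[OF lens[OF that]] unit[OF that] by blast
  \<comment> \<open>Base and exponent of the power both vary, so it is rewritten as an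
    exponential.\<close>
  have "continuous_on X (\<lambda>x. cis (lens_parameters.m (\<alpha> x) c0 c1)
      * exp (complex_of_real (lens_parameters.b (\<alpha> x) c0 c1) * Ln (lens_parameters.S (\<alpha> x) c0 c1 (\<zeta> x))))"
    by (intro continuous_intros b m S)
      (use lens_map.S_not_nonpos[OF lens _ nz] unit in \<open>blast intro: less_imp_le\<close>)
  moreover have "cis (lens_parameters.m (\<alpha> x) c0 c1)
      * exp (complex_of_real (lens_parameters.b (\<alpha> x) c0 c1) * Ln (lens_parameters.S (\<alpha> x) c0 c1 (\<zeta> x)))
    = lens_parameters.phi (\<alpha> x) c0 c1 (\<zeta> x)" if "x \<in> X" for x
    using nz[OF that] by (simp add: lens_parameters.phi_def powr_def)
  ultimately have phi: "continuous_on X (\<lambda>x. lens_parameters.phi (\<alpha> x) c0 c1 (\<zeta> x))"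
    by (subst (asm) continuous_on_cong[OF refl]) auto
  have ne: "1 - lens_parameters.phi (\<alpha> x) c0 c1 (\<zeta> x) \<noteq> 0" if "x \<in> X" for x
    using lens_map.phi_neq_1[OF lens[OF that], of "\<zeta> x"] unit[OF that] by auto
  show "continuous_on X (\<lambda>x. lens_parameters.psi (\<alpha> x) c0 c1 (\<zeta> x))"
    unfolding lens_parameters.psi_def using ne by (intro continuous_intros \<alpha> phi) blast
  show "continuous_on X (\<lambda>x. lens_parameters.L (\<alpha> x) c0 c1 (\<zeta> x))"
    unfolding lens_parameters.L_def
    using ne lens_map.N_D_nonzero(1,2)[OF lens] unit
    by (intro continuous_intros continuous_on_cos[OF eta] \<alpha> \<zeta> b q N D phi) auto
qed

subsection \<open>The generating function of the Faber polynomials of an operator\<close>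

text \<open>The radii \<open>s0\<close>, \<open>s1\<close> belong to the operator,
  \<open>r0\<close>, \<open>r1\<close> to the corner \<open>a\<close>; the inequalities put the lens
  of the operator inside the lens of the map.\<close>

locale lens_map_operator = lens_map a c0 c1 + op: lens_operator A c0 c1 s0 s1
  for a :: complex and c0 c1 :: real and A :: "'a::complex_hilbert \<Rightarrow> 'a" and s0 s1 :: real +
  assumes s0: "r0 \<le> s0" and s1: "s1 \<le> r1"
begin

lemma psi_not_lens: "cmod z < 1 \<Longrightarrow> z \<noteq> 0 \<Longrightarrow> psi z \<notin> lens c0 s0 c1 s1"
  using psi_not_E s0 s1 by (fastforce simp: lens_def)

definition G :: "'a \<Rightarrow> 'a \<Rightarrow> complex \<Rightarrow> complex"
  where "G u v z = (if z = 0 then cinner u v else L z * op.res u v (psi z))"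

lemma tendsto_G_0: "(G u v \<longlongrightarrow> G u v 0) (at 0)"
proof -
  have "((\<lambda>z. (L z / psi z) * (psi z * op.res u v (psi z))) \<longlongrightarrow> 1 * cinner u v) (at 0)"
    by (intro tendsto_mult tendsto_L_psi_0 filterlim_compose[OF op.res_infinity filterlim_psi_0])
  moreover have "\<forall>\<^sub>F z in at 0. (L z / psi z) * (psi z * op.res u v (psi z)) = G u v z"
  proof -
    have "\<forall>\<^sub>F z in at (0::complex). z \<noteq> 0" by (rule eventually_neq_at_within)
    moreover have "\<forall>\<^sub>F z in at 0. psi z \<noteq> 0"
      using filterlim_at_infinity_imp_eventually_ne[OF filterlim_psi_0] .
    ultimately show ?thesis by eventually_elim (simp add: G_def)
  qed
  ultimately show ?thesis by (auto simp: G_def intro: Lim_transform_eventually)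
qed

lemma res_psi_holomorphic: "(\<lambda>z. op.res u v (psi z)) holomorphic_on ball 0 1 - {0}"
proof -
  have "(op.res u v \<circ> psi) holomorphic_on ball 0 1 - {0}"
    by (rule holomorphic_on_compose_gen[OF psi_holomorphic op.res_holomorphic])
      (use psi_not_lens in auto)
  thus ?thesis by (simp add: o_def)
qed

lemma L_holomorphic: "L holomorphic_on ball 0 1 - {0}"
proof -
  have "(\<lambda>z. - z * deriv psi z) holomorphic_on ball 0 1 - {0}"
    by (intro holomorphic_intros holomorphic_deriv psi_holomorphic open_delete open_ball)
  moreover have "- z * deriv psi z = L z" if "z \<in> ball 0 1 - {0}" for z
    using DERIV_imp_deriv[OF psi_has_field_derivative[of z]] N_D_nonzero[of z] that by simp
  ultimately show ?thesis by (subst (asm) holomorphic_cong[OF refl]) auto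
qed

lemma G_holomorphic: "G u v holomorphic_on ball 0 1"
proof (rule no_isolated_singularity')
  have "(\<lambda>z. L z * op.res u v (psi z)) holomorphic_on ball 0 1 - {0}"
    by (intro holomorphic_intros L_holomorphic res_psi_holomorphic)
  thus "G u v holomorphic_on ball 0 1 - {0}"
    by (rule holomorphic_transform) (simp add: G_def)
qed (auto simp: at_within_open[of _ "ball 0 1"] tendsto_G_0)

definition coef :: "'a \<Rightarrow> 'a \<Rightarrow> nat \<Rightarrow> complex"
  where "coef u v n = (deriv ^^ n) (G u v) 0 / fact n"

lemma coef_contour:
  assumes "0 < \<rho>" "\<rho> < 1"
  shows "((\<lambda>z. G u v z / z ^ Suc n) has_contour_integral 2 * pi * \<i> * coef u v n) (circlepath 0 \<rho>)"
proof -
  have "cball 0 \<rho> \<subseteq> ball (0::complex) 1" "ball 0 \<rho> \<subseteq> ball (0::complex) 1" using assms by auto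
  hence "continuous_on (cball 0 \<rho>) (G u v)" "G u v holomorphic_on ball 0 \<rho>"
    using G_holomorphic holomorphic_on_imp_continuous_on holomorphic_on_subset by blast+
  from Cauchy_has_contour_integral_higher_derivative_circlepath[OF this, of 0 n] assms show ?thesis
    by (simp add: coef_def)
qed

text \<open>The last term is the derivative of a polynomial composed with \<open>psi\<close>, so it
  integrates to 0 over a closed path.\<close>

lemma G_poly_psi:
  obtains r where "\<And>z. z \<in> ball 0 1 - {0} \<Longrightarrow>
    poly p (psi z) * G u v z / z = G (op_poly p A u) v z / z - deriv psi z * poly r (psi z)"
proof -
  obtain r where r: "\<And>\<sigma>. \<sigma> \<notin> lens c0 s0 c1 s1 \<Longrightarrow>
      poly p \<sigma> * op.res u v \<sigma> = op.res (op_poly p A u) v \<sigma> + poly r \<sigma>"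
    using op.res_poly by blast
  have "poly p (psi z) * G u v z / z = G (op_poly p A u) v z / z - deriv psi z * poly r (psi z)"
    if z: "z \<in> ball 0 1 - {0}" for z
  proof -
    have "deriv psi z = - L z / z"
      using DERIV_imp_deriv[OF psi_has_field_derivative[of z]] N_D_nonzero[of z] z by simp
    moreover have "poly p (psi z) * G u v z / z = L z / z * (poly p (psi z) * op.res u v (psi z))"
      using z by (simp add: G_def)
    moreover have "poly p (psi z) * op.res u v (psi z) = op.res (op_poly p A u) v (psi z) + poly r (psi z)"
      using z by (intro r psi_not_lens) auto
    ultimately have "poly p (psi z) * G u v z / z
        = L z / z * (op.res (op_poly p A u) v (psi z) + poly r (psi z))"
      by (simp only:)
    with \<open>deriv psi z = - L z / z\<close> show ?thesis
      using z by (simp add: G_def distrib_left)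
  qed
  thus ?thesis using that by blast
qed

text \<open>\<open>poly p (psi z)\<close> and \<open>1 / z ^ n\<close> differ by O(z), so
  \<open>1 / z ^ Suc n\<close> may be replaced by \<open>poly p (psi z) / z\<close> in the Cauchy
  integral for the coefficient. \<open>G_poly_psi\<close> then reduces this integral to the value of
  \<open>G\<close> at 0 for the vector \<open>op_poly p A u\<close>.\<close>

lemma coef_eq_op_poly:
  assumes ext: "exterior_riemann_map E \<Phi>" and faber: "faber_polynomial \<Phi> n p"
  shows "coef u v n = cinner (op_poly p A u) v"
proof -
  define \<gamma> where "\<gamma> = circlepath (0::complex) (1 / 2)"
  have \<gamma>: "valid_path \<gamma>" "pathfinish \<gamma> = pathstart \<gamma>" "path_image \<gamma> \<subseteq> ball 0 1 - {0}"
    by (auto simp: \<gamma>_def)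
  define h where "h z = (poly p (psi z) - 1 / z ^ n) / z" for z
  have h: "h holomorphic_on ball 0 1 - {0}"
    unfolding h_def poly_altdef by (intro holomorphic_intros psi_holomorphic) auto
  obtain C where C: "\<forall>\<^sub>F z in at_infinity. norm (poly p z - \<Phi> z ^ n) \<le> C * norm (1 / z)"
    using faber unfolding faber_polynomial_def by (auto elim!: landau_o.bigE)
  define \<kappa> where "\<kappa> = Im a / (b * cos eta)"
  have \<kappa>: "\<kappa> > 0" using psi_0_limit_pos by (simp add: \<kappa>_def)
  \<comment> \<open>The Faber property bounds \<open>h z\<close> by a constant over |z psi z|, and
    \<open>z * psi z\<close> has a nonzero limit; so the singularity of \<open>h\<close> at 0 is
    removable.\<close>
  have "((\<lambda>z. inverse (cmod (z * psi z))) \<longlongrightarrow> inverse (cmod (of_real \<kappa>))) (at 0)"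
    unfolding \<kappa>_def by (intro tendsto_inverse tendsto_norm tendsto_psi_0)
      (use Im_a b cos_eta in simp)
  hence "\<forall>\<^sub>F z in at 0. inverse (cmod (z * psi z)) < inverse (cmod (of_real \<kappa>)) + 1"
    by (rule order_tendstoD) simp
  moreover have "\<forall>\<^sub>F z in at 0. norm (poly p (psi z) - \<Phi> (psi z) ^ n) \<le> C * norm (1 / psi z)"
    using filterlim_psi_0 C by (auto simp: filterlim_iff)
  moreover have "\<forall>\<^sub>F z in at (0::complex). z \<in> ball 0 1 - {0}"
    by (rule eventually_at_in_open) auto
  ultimately have "\<forall>\<^sub>F z in at 0. norm (h z) \<le> \<bar>C\<bar> * (inverse (cmod (of_real \<kappa>)) + 1)"
  proof eventually_elim
    case (elim z)
    have "norm (h z) = norm (poly p (psi z) - \<Phi> (psi z) ^ n) / cmod z"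
      using exterior_map_psi[OF ext, of z] elim by (simp add: h_def norm_divide power_one_over)
    also have "\<dots> \<le> \<bar>C\<bar> * norm (1 / psi z) / cmod z"
      using elim(2) by (intro divide_right_mono) (auto intro!: order.trans[OF elim(2)] mult_right_mono)
    also have "\<dots> = \<bar>C\<bar> * inverse (cmod (z * psi z))"
      by (simp add: norm_mult norm_divide norm_inverse divide_inverse mult_ac)
    also have "\<dots> \<le> \<bar>C\<bar> * (inverse (cmod (of_real \<kappa>)) + 1)"
      using elim(1) by (intro mult_left_mono) auto
    finally show ?case .
  qed
  then obtain g where g: "g holomorphic_on ball 0 1" "\<And>z. z \<in> ball 0 1 - {0} \<Longrightarrow> g z = h z"
    using holomorphic_on_extend_bounded[OF h] by (auto simp: interior_open)
  have "((\<lambda>z. g z * G u v z) has_contour_integral 0) \<gamma>"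
    by (rule Cauchy_theorem_disc_simple[of _ 0 1])
      (use \<gamma> in \<open>auto intro!: holomorphic_intros g G_holomorphic\<close>)
  moreover have "((\<lambda>z. G u v z / z ^ Suc n) has_contour_integral 2 * pi * \<i> * coef u v n) \<gamma>"
    unfolding \<gamma>_def by (rule coef_contour) auto
  ultimately have "((\<lambda>z. g z * G u v z + G u v z / z ^ Suc n) has_contour_integral
      2 * pi * \<i> * coef u v n) \<gamma>"
    using has_contour_integral_add by fastforce
  hence 1: "((\<lambda>z. poly p (psi z) * G u v z / z) has_contour_integral 2 * pi * \<i> * coef u v n) \<gamma>"
  proof (rule has_contour_integral_eq)
    fix z assume "z \<in> path_image \<gamma>"
    hence "z \<in> ball 0 1 - {0}" using \<gamma> by auto
    hence "g z + 1 / z ^ Suc n = poly p (psi z) / z"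
      using g(2)[of z] by (simp add: h_def diff_divide_distrib)
    moreover have "g z * G u v z + G u v z / z ^ Suc n = (g z + 1 / z ^ Suc n) * G u v z"
      by (simp add: distrib_right)
    ultimately show "g z * G u v z + G u v z / z ^ Suc n = poly p (psi z) * G u v z / z"
      by simp
  qed
  obtain r where r: "\<And>z. z \<in> ball 0 1 - {0} \<Longrightarrow>
    poly p (psi z) * G u v z / z = G (op_poly p A u) v z / z - deriv psi z * poly r (psi z)"
    using G_poly_psi by blast
  have "(poly r) holomorphic_on UNIV" unfolding poly_altdef[abs_def] by (intro holomorphic_intros)
  then obtain P where P: "\<And>z. (P has_field_derivative poly r z) (at z)"
    using holomorphic_convex_primitive'[of UNIV "poly r"] by auto
  have "((\<lambda>z. deriv psi z * poly r (psi z)) has_contour_integral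
      (P \<circ> psi) (pathfinish \<gamma>) - (P \<circ> psi) (pathstart \<gamma>)) \<gamma>"
  proof (rule contour_integral_primitive[OF _ \<gamma>(1,3)])
    fix z :: complex assume z: "z \<in> ball 0 1 - {0}"
    have "(psi has_field_derivative deriv psi z) (at z)"
      by (rule holomorphic_derivI[OF psi_holomorphic _ z]) (auto intro: open_delete)
    from DERIV_chain[OF P this]
    show "(P \<circ> psi has_field_derivative deriv psi z * poly r (psi z)) (at z within ball 0 1 - {0})"
      by (auto intro: DERIV_subset simp: mult.commute)
  qed
  hence "((\<lambda>z. deriv psi z * poly r (psi z)) has_contour_integral 0) \<gamma>" by (simp add: \<gamma>(2))
  moreover have "((\<lambda>z. G (op_poly p A u) v z / z ^ Suc 0) has_contour_integral
      2 * pi * \<i> * coef (op_poly p A u) v 0) \<gamma>"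
    unfolding \<gamma>_def by (rule coef_contour) auto
  ultimately have "((\<lambda>z. G (op_poly p A u) v z / z ^ Suc 0 - deriv psi z * poly r (psi z)) has_contour_integral
      2 * pi * \<i> * coef (op_poly p A u) v 0 - 0) \<gamma>"
    by (intro has_contour_integral_diff)
  hence "((\<lambda>z. poly p (psi z) * G u v z / z) has_contour_integral 2 * pi * \<i> * coef (op_poly p A u) v 0 - 0) \<gamma>"
  proof (rule has_contour_integral_eq)
    fix z assume "z \<in> path_image \<gamma>"
    hence "z \<in> ball 0 1 - {0}" using \<gamma>(3) by blast
    from r[OF this] show "G (op_poly p A u) v z / z ^ Suc 0 - deriv psi z * poly r (psi z)
        = poly p (psi z) * G u v z / z" by simp
  qed
  from has_contour_integral_unique[OF this 1] have "coef u v n = coef (op_poly p A u) v 0" by simp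
  thus ?thesis by (simp add: coef_def G_def)
qed

end

subsection \<open>The bound on the coefficients\<close>

locale strict_lens_map_operator = lens_map_operator +
  assumes strict: "r0 < s0" "s1 < r1"
begin

lemma psi_far:
  obtains d where "d > 0" "\<And>z. cmod z \<le> 1 \<Longrightarrow> z \<noteq> 0 \<Longrightarrow> psi z \<in> op.far d"
proof -
  \<comment> \<open>The two gaps between the concentric circles, in the absolute and relative form
    used by \<open>far\<close>.\<close>
  define d where "d = min (r1 - s1) (1 - r0 / s0)"
  have "d > 0" using strict op.r0 by (simp add: d_def)
  moreover have "s1 + d \<le> r1" by (simp add: d_def)
  moreover have "r0 \<le> s0 * (1 - d)"
  proof -
    have "r0 / s0 \<le> 1 - d" by (simp add: d_def)
    thus ?thesis using op.r0 by (simp add: pos_divide_le_eq mult.commute)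
  qed
  ultimately show ?thesis
    using psi_closed_exterior by (intro that[of d]) (force simp: op.far_def)+
qed

lemma psi_not_lens_closed:
  assumes "cmod z \<le> 1" "z \<noteq> 0"
  shows "psi z \<notin> lens c0 s0 c1 s1"
proof -
  obtain d where d: "d > 0" "\<And>z. cmod z \<le> 1 \<Longrightarrow> z \<noteq> 0 \<Longrightarrow> psi z \<in> op.far d"
    by (rule psi_far) blast
  thus ?thesis using op.far_subset[OF d(1)] d(2)[OF assms] by auto
qed

text \<open>At a corner the resolvent form stays bounded by the uniform margin, while
  \<open>L\<close> tends to 0.\<close>

lemma G_continuous: "continuous_on (cball 0 1) (G u v)"
  unfolding continuous_on_def
proof
  fix z :: complex assume z: "z \<in> cball 0 1"
  consider "z = 0" | "z \<noteq> 0" "S z = 0" | "z \<noteq> 0" "S z \<noteq> 0" by blast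
  thus "(G u v \<longlongrightarrow> G u v z) (at z within cball 0 1)"
  proof cases
    case 1
    thus ?thesis using tendsto_G_0 tendsto_within_subset by blast
  next
    case 2
    obtain d where d: "d > 0" "\<And>z. cmod z \<le> 1 \<Longrightarrow> z \<noteq> 0 \<Longrightarrow> psi z \<in> op.far d"
      by (rule psi_far) blast
    obtain M where M: "M > 0" "\<And>\<sigma> u v. \<sigma> \<in> op.far d \<Longrightarrow> cmod (op.res u v \<sigma>) \<le> M * norm u * norm v"
      using op.res_far[OF d(1)] by blast
    have "(G u v \<longlongrightarrow> 0) (at z within cball 0 1)"
    proof (rule Lim_null_comparison)
      have "\<forall>\<^sub>F w in at z within cball 0 1. w \<noteq> 0" by (rule eventually_neq_at_within)
      moreover have "\<forall>\<^sub>F w in at z within cball 0 1. w \<in> cball 0 1" by (simp add: eventually_at_filter)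
      ultimately show "\<forall>\<^sub>F w in at z within cball 0 1. norm (G u v w) \<le> cmod (L w) * (M * norm u * norm v)"
        by eventually_elim (use M(2) d(2) in \<open>simp add: G_def norm_mult mult_left_mono\<close>)
      have "((\<lambda>w. cmod (L w)) \<longlongrightarrow> 0) (at z within cball 0 1)"
        using tendsto_L_S_0[OF 2(2)] tendsto_within_subset by (blast intro: tendsto_norm_zero)
      thus "((\<lambda>w. cmod (L w) * (M * norm u * norm v)) \<longlongrightarrow> 0) (at z within cball 0 1)"
        by (rule tendsto_mult_left_zero)
    qed
    moreover have "G u v z = 0" using 2 by (simp add: G_def L_corner)
    ultimately show ?thesis by simp
  next
    case 3
    have z1: "cmod z \<le> 1" using z by simp
    have "isCont (op.res u v) (psi z)"
      using op.res_has_field_derivative[OF psi_not_lens_closed[OF z1 3(1)]] DERIV_isCont by blast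
    hence "isCont (\<lambda>w. L w * op.res u v (psi w)) z"
      using isCont_L[OF z1 3(2,1)] isCont_psi[OF z1 3(2,1)] isCont_o2 by (intro isCont_mult) blast+
    hence "((\<lambda>w. L w * op.res u v (psi w)) \<longlongrightarrow> G u v z) (at z)"
      using 3 by (simp add: G_def isCont_def)
    moreover have "\<forall>\<^sub>F w in at z. w \<noteq> 0" by (rule eventually_neq_at_within)
    hence "\<forall>\<^sub>F w in at z. L w * op.res u v (psi w) = G u v w"
      by eventually_elim (simp add: G_def)
    ultimately have "(G u v \<longlongrightarrow> G u v z) (at z)" by (rule Lim_transform_eventually)
    thus ?thesis using tendsto_within_subset by blast
  qed
qed

lemma G_integral:
  "((\<lambda>t. G u v (cis t) * cis (- (real n * t))) has_integral 2 * pi * coef u v n) {0..2 * pi}"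
proof -
  have ct: "((\<lambda>z. G u v z / (z - 0) ^ Suc n) has_contour_integral 2 * pi * \<i> / fact n * (deriv ^^ n) (G u v) 0)
    (part_circlepath 0 1 0 (2 * pi))"
    using Cauchy_has_contour_integral_higher_derivative_circlepath[OF G_continuous G_holomorphic, where w = 0 and k = n]
    by (simp add: circlepath_def)
  have "((\<lambda>t. \<i> * (G u v (cis t) * cis (- (real n * t)))) has_integral \<i> * (2 * pi * coef u v n)) {0..2 * pi}"
  proof -
    have "G u v (cis t) / (cis t) ^ Suc n * (\<i> * cis t) = \<i> * (G u v (cis t) * inverse (cis t ^ n))" for t
      by (simp add: field_simps)
    hence "G u v (cis t) / (cis t) ^ Suc n * (\<i> * cis t) = \<i> * (G u v (cis t) * cis (- (real n * t)))" for t
      by (simp only: Complex.DeMoivre cis_inverse)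
    moreover from ct have "((\<lambda>t. G u v (cis t) / (cis t) ^ Suc n * (\<i> * cis t)) has_integral
        2 * pi * \<i> / fact n * (deriv ^^ n) (G u v) 0) {0..2 * pi}"
      by (simp add: has_contour_integral_part_circlepath_iff mult.assoc)
    moreover have "2 * pi * \<i> / fact n * (deriv ^^ n) (G u v) 0 = \<i> * (2 * pi * coef u v n)"
      by (simp add: coef_def)
    ultimately show ?thesis by (simp only:)
  qed
  from has_integral_mult_right[OF this, of "- \<i>"] show ?thesis
    by (simp flip: mult.assoc)
qed

text \<open>Fourier coefficients of negative index vanish for boundary values of a holomorphic
  function. Hence the conjugate of \<open>G v u\<close> can be added without changing the n-th
  coefficient.\<close>

lemma G_integral':
  assumes "n \<ge> 1"
  shows "((\<lambda>t. G u v (cis t) * cis (real n * t)) has_integral 0) {0..2 * pi}"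
proof -
  have "continuous_on (cball 0 1) (\<lambda>z. G u v z * z ^ n)" "(\<lambda>z. G u v z * z ^ n) holomorphic_on ball 0 1"
    by (intro continuous_intros holomorphic_intros G_continuous G_holomorphic)+
  from Cauchy_has_contour_integral_higher_derivative_circlepath[OF this, where w = 0 and k = 0] assms
  have "((\<lambda>z. G u v z * z ^ n / (z - 0) ^ Suc 0) has_contour_integral 0) (part_circlepath 0 1 0 (2 * pi))"
    by (simp add: circlepath_def power_0_left)
  hence "((\<lambda>t. \<i> * (G u v (cis t) * cis (real n * t))) has_integral 0) {0..2 * pi}"
    by (simp add: has_contour_integral_part_circlepath_iff Complex.DeMoivre mult_ac)
  from has_integral_mult_right[OF this, of "- \<i>"] show ?thesis
    by (simp flip: mult.assoc)
qed

text \<open>Twice the angular speed, seen from \<open>c0\<close>, with which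
  \<open>psi (cis t)\<close> runs along the inner arc.\<close>

definition kappa :: "real \<Rightarrow> real"
  where "kappa t = (if pi / 2 + eta < t \<and> t < 3 * pi / 2 - eta
    then - 2 * Re (L (cis t) / (psi (cis t) - c0)) else 0)"

lemma kappa_integral: "(kappa has_integral 4 * th0) {0..2 * pi}"
proof -
  have "((\<lambda>t. 2 * - Re (L (cis t) / (psi (cis t) - c0))) has_integral 2 * (2 * th0)) {pi / 2 + eta..3 * pi / 2 - eta}"
    by (rule has_integral_mult_right[OF has_integral_inner_arc])
  hence "((\<lambda>t. - 2 * Re (L (cis t) / (psi (cis t) - c0))) has_integral 4 * th0) {pi / 2 + eta..3 * pi / 2 - eta}"
    by simp
  hence "(kappa has_integral 4 * th0) {pi / 2 + eta..3 * pi / 2 - eta}"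
    by (rule has_integral_spike_finite[where S = "{pi / 2 + eta, 3 * pi / 2 - eta}", rotated 2])
      (auto simp: kappa_def)
  thus ?thesis
    by (rule has_integral_on_superset) (use eta in \<open>auto simp: kappa_def\<close>)
qed

lemma kappa_nonneg: "kappa t \<ge> 0"
proof (cases "pi / 2 + eta < t \<and> t < 3 * pi / 2 - eta")
  case True
  then obtain l :: real where l: "l \<le> 0" "L (cis t) = l * (psi (cis t) - c0)" "cmod (psi (cis t) - c0) = r0"
    using L_inner_arc[of "cis t"] inner_arc_interval by auto
  have "psi (cis t) - c0 \<noteq> 0" using l(3) r0 by auto
  hence "L (cis t) / (psi (cis t) - c0) = l" using l(2) by simp
  thus ?thesis using l True by (simp add: kappa_def)
qed (auto simp: kappa_def)

definition Q :: "'a \<Rightarrow> real \<Rightarrow> real"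
  where "Q u t = 2 * Re (G u u (cis t)) + kappa t * (norm u)\<^sup>2"

text \<open>
  On the outer arc this is the positivity of the double layer potential of a disc containing the
  numerical range; on the inner arc the potential is only bounded below by \<open>- kappa\<close>.
\<close>

lemma Q_nonneg:
  assumes "0 \<le> t" "t \<le> 2 * pi"
  shows "Q u t \<ge> 0"
proof -
  consider "pi / 2 + eta < t \<and> t < 3 * pi / 2 - eta" | "t = pi / 2 + eta \<or> t = 3 * pi / 2 - eta"
    | "t < pi / 2 + eta \<or> 3 * pi / 2 - eta < t" by linarith
  thus ?thesis
  proof cases
    case 1
    then obtain l :: real where l: "l \<le> 0" "L (cis t) = l * (psi (cis t) - c0)" "cmod (psi (cis t) - c0) = r0"
      using L_inner_arc[of "cis t"] inner_arc_interval by auto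
    have "psi (cis t) - c0 \<noteq> 0" using l(3) r0 by auto
    hence "L (cis t) / (psi (cis t) - c0) = l" using l(2) by simp
    hence k: "kappa t = - 2 * l" using 1 by (simp add: kappa_def)
    have "G u u (cis t) = l * ((psi (cis t) - c0) * op.res u u (psi (cis t)))"
      by (simp add: G_def l(2))
    hence "Re (G u u (cis t)) = l * Re ((psi (cis t) - c0) * op.res u u (psi (cis t)))" by simp
    moreover have "Re ((psi (cis t) - c0) * op.res u u (psi (cis t))) \<le> (norm u)\<^sup>2"
      by (rule op.res_inner) (use l s0 psi_not_lens_closed in auto)
    hence "l * Re ((psi (cis t) - c0) * op.res u u (psi (cis t))) \<ge> l * (norm u)\<^sup>2"
      using l(1) by (rule mult_left_mono_neg)
    ultimately show ?thesis by (simp add: Q_def k)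
  next
    case 2
    hence "S (cis t) = 0" using inner_arc_corners by (auto simp: S_eq_0_iff)
    thus ?thesis using 2 by (auto simp: Q_def G_def kappa_def L_corner)
  next
    case 3
    then obtain l :: real where l: "l \<ge> 0" "L (cis t) = l * (psi (cis t) - c1)" "cmod (psi (cis t) - c1) = r1"
      using L_outer_arc[of "cis t"] outer_arc_interval assms by auto
    have "G u u (cis t) = l * ((psi (cis t) - c1) * op.res u u (psi (cis t)))"
      by (simp add: G_def l(2))
    hence "Re (G u u (cis t)) = l * Re ((psi (cis t) - c1) * op.res u u (psi (cis t)))" by simp
    moreover have "Re ((psi (cis t) - c1) * op.res u u (psi (cis t))) \<ge> 0"
      by (rule op.res_outer) (use l s1 psi_not_lens_closed in auto)
    ultimately show ?thesis using l(1) 3 by (auto simp: Q_def kappa_def)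
  qed
qed

text \<open>A nonnegative Hermitian form is evaluated at \<open>u - e *\<^sub>C v\<close>, where
  \<open>e\<close> is the phase of the mixed term. The arithmetic mean loses nothing in the end,
  since \<open>v\<close> will have the norm of \<open>u\<close>.\<close>

lemma polar_le:
  assumes t: "0 \<le> t" "t \<le> 2 * pi"
  shows "cmod (G u v (cis t) + cnj (G v u (cis t)) + kappa t * cinner u v) \<le> (Q u t + Q v t) / 2"
proof -
  define P where "P = G u v (cis t) + cnj (G v u (cis t)) + kappa t * cinner u v"
  define e where "e = (if P = 0 then 1 else sgn P)"
  have e: "cmod e = 1" by (simp add: e_def norm_sgn)
  have "cnj e * P = cmod P"
  proof (cases "P = 0")
    case False
    have "cnj P * P = of_real ((cmod P)\<^sup>2)" using complex_norm_square[of P] by (simp add: mult.commute)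
    thus ?thesis using False by (simp add: e_def sgn_eq power2_eq_square)
  qed simp
  hence eP: "Re (cnj e * P) = cmod P" by simp
  have ee: "e * cnj e = 1" using complex_norm_square[of e] e by simp
  have "op.res (u - e *\<^sub>C v) (u - e *\<^sub>C v) (psi (cis t)) = op.res u u (psi (cis t))
      - cnj e * op.res u v (psi (cis t)) - e * op.res v u (psi (cis t)) + op.res v v (psi (cis t))"
    using op.res_sesquilinear[OF psi_not_lens_closed[of "cis t"], of u e v] by (simp add: ee)
  hence "G (u - e *\<^sub>C v) (u - e *\<^sub>C v) (cis t)
      = L (cis t) * (op.res u u (psi (cis t))
      - cnj e * op.res u v (psi (cis t)) - e * op.res v u (psi (cis t)) + op.res v v (psi (cis t)))"
    by (simp add: G_def)
  also have "\<dots> = G u u (cis t) - cnj e * G u v (cis t) - e * G v u (cis t) + G v v (cis t)"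
    by (simp add: G_def algebra_simps)
  finally have Gexp: "G (u - e *\<^sub>C v) (u - e *\<^sub>C v) (cis t)
      = G u u (cis t) - cnj e * G u v (cis t) - e * G v u (cis t) + G v v (cis t)" .
  define x where "x = Re (cnj e * (G u v (cis t) + cnj (G v u (cis t))))"
  define y where "y = Re (cnj e * cinner u v)"
  have "Re (G (u - e *\<^sub>C v) (u - e *\<^sub>C v) (cis t)) = Re (G u u (cis t)) + Re (G v v (cis t)) - x"
    unfolding Gexp x_def by (simp add: algebra_simps)
  moreover have "(norm (u - e *\<^sub>C v))\<^sup>2 = (norm u)\<^sup>2 + (norm v)\<^sup>2 - 2 * y"
    by (simp add: y_def norm_diff_square cinner_scaleC_right e)
  moreover have "Re (cnj e * P) = x + kappa t * y"
    by (simp add: P_def x_def y_def algebra_simps)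
  ultimately have "Q (u - e *\<^sub>C v) t = Q u t + Q v t - 2 * Re (cnj e * P)"
    unfolding Q_def by (simp only:) (simp only: algebra_simps)
  with Q_nonneg[OF t, of "u - e *\<^sub>C v"] eP show ?thesis by (simp add: P_def)
qed

lemma Q_integral: "(Q u has_integral (4 * pi + 4 * th0) * (norm u)\<^sup>2) {0..2 * pi}"
proof -
  have "coef u u 0 = of_real ((norm u)\<^sup>2)" by (simp add: coef_def G_def cinner_self)
  hence "((\<lambda>t. G u u (cis t)) has_integral of_real (2 * pi * (norm u)\<^sup>2)) {0..2 * pi}"
    using G_integral[of u u 0] by simp
  from has_integral_linear[OF this bounded_linear_Re]
  have "((\<lambda>t. Re (G u u (cis t))) has_integral 2 * pi * (norm u)\<^sup>2) {0..2 * pi}"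
    by (simp add: o_def)
  from has_integral_add[OF has_integral_mult_right[OF this, of 2] has_integral_mult_left[OF kappa_integral, of "(norm u)\<^sup>2"]]
  show ?thesis unfolding Q_def[abs_def] by (simp add: algebra_simps)
qed

text \<open>The term \<open>kappa t * cinner u v\<close> is needed for positivity but disturbs the
  Fourier coefficient; it is added for \<open>polar_le\<close> and removed again by the triangle
  inequality.\<close>

lemma norm_coef_le_strict:
  assumes n: "n \<ge> 1"
  shows "cmod (coef u v n) \<le> (2 + 4 * th0 / pi) * (((norm u)\<^sup>2 + (norm v)\<^sup>2) / 2)"
proof -
  define K where "K = ((norm u)\<^sup>2 + (norm v)\<^sup>2) / 2"
  define P where "P t = G u v (cis t) + cnj (G v u (cis t)) + kappa t * cinner u v" for t
  have "((\<lambda>t. cnj (G v u (cis t) * cis (real n * t))) has_integral 0) {0..2 * pi}"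
    using has_integral_linear[OF G_integral'[OF n] bounded_linear_cnj] by (simp add: o_def)
  from has_integral_add[OF G_integral[of u v n] this]
  have int: "((\<lambda>t. (P t - kappa t * cinner u v) * cis (- (real n * t))) has_integral 2 * pi * coef u v n) {0..2 * pi}"
    by (simp add: P_def distrib_right cis_cnj)
  have bnd: "((\<lambda>t. (Q u t + Q v t) * (1 / 2) + kappa t * K) has_integral
      ((4 * pi + 4 * th0) * (norm u)\<^sup>2 + (4 * pi + 4 * th0) * (norm v)\<^sup>2) * (1 / 2) + 4 * th0 * K) {0..2 * pi}"
    by (intro has_integral_add has_integral_mult_left Q_integral kappa_integral)
  have uv: "cmod (cinner u v) \<le> K"
  proof -
    have "cmod (cinner u v) \<le> norm u * norm v" by (rule norm_cinner_le)
    also have "\<dots> \<le> K" using sum_squares_bound[of "norm u" "norm v"] by (simp add: K_def)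
    finally show ?thesis .
  qed
  have "norm ((P t - kappa t * cinner u v) * cis (- (real n * t))) \<le> (Q u t + Q v t) * (1 / 2) + kappa t * K"
    if "t \<in> {0..2 * pi}" for t
  proof -
    have "norm ((P t - kappa t * cinner u v) * cis (- (real n * t))) \<le> cmod (P t) + kappa t * cmod (cinner u v)"
      using norm_triangle_ineq4[of "P t" "kappa t * cinner u v"] kappa_nonneg[of t] by (simp add: norm_mult)
    also have "\<dots> \<le> (Q u t + Q v t) * (1 / 2) + kappa t * K"
    proof -
      have "cmod (P t) \<le> (Q u t + Q v t) / 2"
        unfolding P_def by (rule polar_le) (use that in auto)
      thus ?thesis using mult_left_mono[OF uv kappa_nonneg[of t]] by linarith
    qed
    finally show ?thesis .
  qed
  from integral_norm_bound_integral[OF has_integral_integrable[OF int] has_integral_integrable[OF bnd] this]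
  have "norm (2 * pi * coef u v n)
      \<le> ((4 * pi + 4 * th0) * (norm u)\<^sup>2 + (4 * pi + 4 * th0) * (norm v)\<^sup>2) * (1 / 2) + 4 * th0 * K"
    unfolding integral_unique[OF int] integral_unique[OF bnd] .
  also have "\<dots> = 2 * pi * ((2 + 4 * th0 / pi) * K)"
    by (simp add: K_def field_simps)
  finally show ?thesis by (simp add: norm_mult K_def)
qed

end

section \<open>From strict to arbitrary inclusions by continuity in the corner\<close>

context lens_map_operator
begin

text \<open>
  The lens is enlarged by moving its corner along a line that enters the disc about \<open>c0\<close> and
  leaves the disc about \<open>c1\<close>; this makes the inclusions strict.
\<close>

lemma norm_coef_le:
  assumes n: "n \<ge> 1"
  shows "cmod (coef u v n) \<le> (2 + 4 * th0 / pi) * (((norm u)\<^sup>2 + (norm v)\<^sup>2) / 2)"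
proof -
  \<comment> \<open>\<open>w\<close> is orthogonal to the vector from the midpoint of the centers to
    \<open>a\<close>. Along it the linear terms of the squared distances to \<open>c0\<close> and
    \<open>c1\<close> are \<open>- s * (c1 - c0)\<close> and \<open>s * (c1 - c0)\<close>.\<close>
  define k where "k = (Re a - (c0 + c1) / 2) / Im a"
  define w where "w = Complex (- 1) k"
  define \<alpha> where "\<alpha> s = a + complex_of_real s * w" for s
  \<comment> \<open>The first bound keeps the quadratic term
    \<open>s\<^sup>2 * (1 + k\<^sup>2)\<close> below the linear one; the second keeps the corner in
    the upper half-plane.\<close>
  define \<delta> where "\<delta> = min ((c1 - c0) / (2 * (1 + k\<^sup>2))) (Im a / (2 * (1 + \<bar>k\<bar>)))"
  have k2: "1 + k\<^sup>2 > 0" "1 + \<bar>k\<bar> > 0" by (simp_all add: add_pos_nonneg)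
  have \<delta>: "\<delta> > 0" using k2 Im_a c0_less_c1 by (simp add: \<delta>_def)
  have Im: "Im (\<alpha> s) > 0" if "0 \<le> s" "s \<le> \<delta>" for s
  proof -
    have "s \<le> Im a / (2 * (1 + \<bar>k\<bar>))" using that by (simp add: \<delta>_def)
    hence "s * (2 * (1 + \<bar>k\<bar>)) \<le> Im a" using k2 by (simp add: pos_le_divide_eq)
    moreover have "s * \<bar>k\<bar> \<le> s * (1 + \<bar>k\<bar>)" using that by (intro mult_left_mono) auto
    moreover have "- (s * \<bar>k\<bar>) \<le> s * k"
      using that mult_left_mono[of "- \<bar>k\<bar>" k s] by simp
    moreover have "s * (2 * (1 + \<bar>k\<bar>)) = 2 * (s * (1 + \<bar>k\<bar>))" by simp
    ultimately have "2 * - (s * k) \<le> Im a" by linarith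
    thus ?thesis using Im_a by (simp add: \<alpha>_def w_def)
  qed
  have lens: "lens_map (\<alpha> s) c0 c1" if "s \<in> {0..\<delta>}" for s
    by unfold_locales (use Im c0_less_c1 that in auto)
  have cross: "Im a * k = Re a - (c0 + c1) / 2" using Im_a by (simp add: k_def)
  have expand: "(cmod (\<alpha> s - complex_of_real c))\<^sup>2
      = (cmod (a - complex_of_real c))\<^sup>2 + s * (2 * c - (c0 + c1)) + s\<^sup>2 * (1 + k\<^sup>2)" for s c :: real
  proof -
    have "(cmod (\<alpha> s - complex_of_real c))\<^sup>2 = (Re a - c - s)\<^sup>2 + (Im a + s * k)\<^sup>2"
      by (simp add: cmod_power2 \<alpha>_def w_def algebra_simps)
    also have "\<dots> = (Re a - c)\<^sup>2 + (Im a)\<^sup>2 + 2 * s * (Im a * k - (Re a - c)) + s\<^sup>2 * (1 + k\<^sup>2)"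
      by algebra
    also have "\<dots> = (cmod (a - complex_of_real c))\<^sup>2 + s * (2 * c - (c0 + c1)) + s\<^sup>2 * (1 + k\<^sup>2)"
      unfolding cross by (simp add: cmod_power2 algebra_simps)
    finally show ?thesis .
  qed
  have strict: "cmod (\<alpha> s - complex_of_real c0) < r0" "r1 < cmod (\<alpha> s - complex_of_real c1)"
    if "0 < s" "s \<le> \<delta>" for s
  proof -
    have "s \<le> (c1 - c0) / (2 * (1 + k\<^sup>2))" using that by (simp add: \<delta>_def)
    hence "s * (2 * (1 + k\<^sup>2)) \<le> c1 - c0" using k2 by (simp add: pos_le_divide_eq)
    moreover have pos: "s * (1 + k\<^sup>2) > 0" using that k2 by simp
    ultimately have "s * (1 + k\<^sup>2) < c1 - c0" by linarith
    hence "s * (s * (1 + k\<^sup>2)) < s * (c1 - c0)" using that by simp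
    moreover have "0 < s * (s * (1 + k\<^sup>2))" "0 < s * (c1 - c0)" using that pos c0_less_c1 by simp_all
    ultimately have "(cmod (\<alpha> s - complex_of_real c0))\<^sup>2 < r0\<^sup>2" "r1\<^sup>2 < (cmod (\<alpha> s - complex_of_real c1))\<^sup>2"
      unfolding expand r0_def r1_def by (simp_all add: power2_eq_square algebra_simps)
    thus "cmod (\<alpha> s - complex_of_real c0) < r0" "r1 < cmod (\<alpha> s - complex_of_real c1)"
      using r0 by (auto intro: power2_less_imp_less)
  qed
  \<comment> \<open>On this fixed inner circle the integrand is jointly continuous up to
    \<open>s = 0\<close>, where boundary values on the unit circle may fail to exist.\<close>
  define \<zeta> where "\<zeta> t = complex_of_real (1 / 2) * cis t" for t
  have \<zeta>: "cmod (\<zeta> t) < 1" "\<zeta> t \<noteq> 0" for t by (simp_all add: \<zeta>_def norm_mult)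
  define g where "g s t = lens_parameters.L (\<alpha> s) c0 c1 (\<zeta> t)
      * op.res u v (lens_parameters.psi (\<alpha> s) c0 c1 (\<zeta> t)) / \<zeta> t ^ Suc n * (\<i> * \<zeta> t)" for s t
  define I where "I s = integral (cbox 0 (2 * pi)) (g s)" for s
  have op_lens: "lens_map_operator (\<alpha> s) c0 c1 A s0 s1" if "s \<in> {0..\<delta>}" for s
  proof (cases "s = 0")
    case True
    thus ?thesis by (simp add: \<alpha>_def lens_map_operator_axioms)
  next
    case False
    interpret s: lens_map "\<alpha> s" c0 c1 by (rule lens[OF that])
    have "s.r0 \<le> s0" "s1 \<le> s.r1" unfolding s.r0_def s.r1_def using strict[of s] False that s0 s1 by auto
    thus ?thesis by unfold_locales
  qed
  have I_eq: "I s = 2 * pi * \<i> * lens_map_operator.coef (\<alpha> s) c0 c1 A u v n" if "s \<in> {0..\<delta>}" for s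
  proof -
    interpret s: lens_map_operator "\<alpha> s" c0 c1 A s0 s1 by (rule op_lens[OF that])
    have "((\<lambda>z. s.G u v z / z ^ Suc n) has_contour_integral 2 * pi * \<i> * s.coef u v n)
        (part_circlepath 0 (1 / 2) 0 (2 * pi))"
      using s.coef_contour[of "1 / 2" u v n] by (simp add: circlepath_def)
    hence "((\<lambda>t. s.G u v (\<zeta> t) / \<zeta> t ^ Suc n * (\<i> * \<zeta> t)) has_integral 2 * pi * \<i> * s.coef u v n) {0..2 * pi}"
      unfolding has_contour_integral_part_circlepath_iff[OF mult_pos_pos[OF zero_less_numeral pi_gt_zero]]
      by (simp add: \<zeta>_def mult_ac)
    hence "(g s has_integral 2 * pi * \<i> * s.coef u v n) (cbox 0 (2 * pi))"
      using \<zeta> by (simp add: g_def[abs_def] s.G_def)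
    thus ?thesis unfolding I_def by (rule integral_unique)
  qed
  have c\<alpha>: "continuous_on X \<alpha>" for X unfolding \<alpha>_def by (intro continuous_intros)
  have c\<zeta>: "continuous_on X \<zeta>" for X unfolding \<zeta>_def by (intro continuous_intros)
  define X where "X = {0..\<delta>} \<times> cbox 0 (2 * pi)"
  have X: "fst ` X \<subseteq> {0..\<delta>}" by (auto simp: X_def)
  have cont2: "continuous_on X (\<lambda>x. \<alpha> (fst x))" "continuous_on X (\<lambda>x. \<zeta> (snd x))"
    by (intro continuous_on_compose2[OF c\<alpha>[of UNIV]] continuous_on_compose2[OF c\<zeta>[of UNIV]] continuous_intros; simp)+
  note maps = continuous_on_lens_map[OF cont2, of c0 c1]
  have psi: "continuous_on X (\<lambda>x. lens_parameters.psi (\<alpha> (fst x)) c0 c1 (\<zeta> (snd x)))"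
    and L: "continuous_on X (\<lambda>x. lens_parameters.L (\<alpha> (fst x)) c0 c1 (\<zeta> (snd x)))"
    using maps(1,2) lens X \<zeta> by (blast, blast)
  have res: "continuous_on X (\<lambda>x. op.res u v (lens_parameters.psi (\<alpha> (fst x)) c0 c1 (\<zeta> (snd x))))"
  proof (rule continuous_on_compose2[OF holomorphic_on_imp_continuous_on[OF op.res_holomorphic] psi])
    show "(\<lambda>x. lens_parameters.psi (\<alpha> (fst x)) c0 c1 (\<zeta> (snd x))) ` X \<subseteq> - lens c0 s0 c1 s1"
      using lens_map_operator.psi_not_lens[OF op_lens] X \<zeta> by blast
  qed
  have "continuous_on X (\<lambda>x. g (fst x) (snd x))"
    unfolding g_def using \<zeta>(2) by (intro continuous_intros L res cont2) auto
  hence "continuous_on {0..\<delta>} I"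
    unfolding I_def X_def by (intro integral_continuous_on_param) (simp add: case_prod_beta)
  hence I0: "(I \<longlongrightarrow> I 0) (at 0 within {0..\<delta>})" using \<delta> by (auto simp: continuous_on_def)
  have "continuous_on {0..\<delta>} (\<lambda>s. lens_parameters.th0 (\<alpha> s) c0)"
    by (rule continuous_on_lens_map(3)[OF c\<alpha> continuous_on_const[of _ "1 / 2"] lens]) auto
  hence th0: "((\<lambda>s. lens_parameters.th0 (\<alpha> s) c0) \<longlongrightarrow> lens_parameters.th0 (\<alpha> 0) c0) (at 0 within {0..\<delta>})"
    using \<delta> by (auto simp: continuous_on_def)
  define K where "K = ((norm u)\<^sup>2 + (norm v)\<^sup>2) / 2"
  have "cmod (I 0) \<le> 2 * pi * ((2 + 4 * lens_parameters.th0 (\<alpha> 0) c0 / pi) * K)"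
  proof (rule tendsto_le[OF _ _ tendsto_norm[OF I0]])
    show "at 0 within {0..\<delta>} \<noteq> bot"
      using \<delta> by (simp add: at_within_Icc_at_right)
    show "((\<lambda>s. 2 * pi * ((2 + 4 * lens_parameters.th0 (\<alpha> s) c0 / pi) * K))
        \<longlongrightarrow> 2 * pi * ((2 + 4 * lens_parameters.th0 (\<alpha> 0) c0 / pi) * K)) (at 0 within {0..\<delta>})"
      by (intro tendsto_intros th0) auto
    have "\<forall>\<^sub>F s in at 0 within {0..\<delta>}. s \<in> {0<..\<delta>}"
      by (auto simp: eventually_at_filter)
    thus "\<forall>\<^sub>F s in at 0 within {0..\<delta>}. cmod (I s) \<le> 2 * pi * ((2 + 4 * lens_parameters.th0 (\<alpha> s) c0 / pi) * K)"
    proof eventually_elim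
      case (elim s)
      hence s: "s \<in> {0..\<delta>}" by simp
      interpret s: lens_map_operator "\<alpha> s" c0 c1 A s0 s1 by (rule op_lens[OF s])
      interpret s: strict_lens_map_operator "\<alpha> s" c0 c1 A s0 s1
        by unfold_locales (unfold s.r0_def s.r1_def, use strict[of s] elim s0 s1 in auto)
      show ?case using s.norm_coef_le_strict[OF n, of u v]
        by (simp add: I_eq[OF s] norm_mult K_def)
    qed
  qed
  moreover have "I 0 = 2 * pi * \<i> * coef u v n" using I_eq[of 0] \<delta> by (simp add: \<alpha>_def)
  ultimately show ?thesis by (simp add: norm_mult \<alpha>_def K_def)
qed

end

theorem corollary6:
  fixes A :: "'a::complex_hilbert \<Rightarrow> 'a"
    and c\<^sub>0 c\<^sub>1 r\<^sub>0 r\<^sub>1 \<gamma> :: real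
    and a :: complex
    and \<Phi> :: "complex \<Rightarrow> complex"
    and F :: "nat \<Rightarrow> complex poly"
  defines "E \<equiv> lens c\<^sub>0 r\<^sub>0 c\<^sub>1 r\<^sub>1"
    and "\<theta>\<^sub>0 \<equiv> Arg (a - complex_of_real c\<^sub>0)"
    and "\<theta>\<^sub>1 \<equiv> Arg (a - complex_of_real c\<^sub>1)"
    and "\<gamma> \<equiv> 1 / norm (\<Phi> 0)"
  assumes "bounded_clinear A"
    and "r\<^sub>0 > 0" and "r\<^sub>1 > 0"
    and "c\<^sub>0 - r\<^sub>0 < c\<^sub>1 - r\<^sub>1" and "c\<^sub>1 - r\<^sub>1 < c\<^sub>0 + r\<^sub>0" and "c\<^sub>0 + r\<^sub>0 < c\<^sub>1 + r\<^sub>1"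
    and "0 < c\<^sub>0 + r\<^sub>0"
    and "numerical_range A \<subseteq> cball (complex_of_real c\<^sub>1) r\<^sub>1"
    and "op_invertible (\<lambda>x. A x - complex_of_real c\<^sub>0 *\<^sub>C x)"
    and "numerical_range (inv (\<lambda>x. A x - complex_of_real c\<^sub>0 *\<^sub>C x)) \<subseteq> cball 0 (1 / r\<^sub>0)"
    and "norm (a - complex_of_real c\<^sub>0) = r\<^sub>0" and "norm (a - complex_of_real c\<^sub>1) = r\<^sub>1" and "Im a > 0"
    and "exterior_riemann_map E \<Phi>"
    and "\<And>n. faber_polynomial \<Phi> n (F n)"
  shows "(\<forall>n\<ge>1. onorm (op_poly (F n) A) \<le> 2 + 4 * \<theta>\<^sub>0 / pi) \<and>
    \<gamma> = sin (pi * Arg a / (2 * pi - \<theta>\<^sub>1 + \<theta>\<^sub>0)) /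
        sin (pi * (pi + \<theta>\<^sub>0 - Arg a) / (2 * pi - \<theta>\<^sub>1 + \<theta>\<^sub>0))"
proof -
  interpret lens_map a c\<^sub>0 c\<^sub>1
    by unfold_locales (use assms in linarith)+
  have r: "r0 = r\<^sub>0" "r1 = r\<^sub>1" using assms by (simp_all add: r0_def r1_def)
  interpret lens_map_operator a c\<^sub>0 c\<^sub>1 A r\<^sub>0 r\<^sub>1
    by unfold_locales (fact assms | simp only: r order_refl)+
  have th: "th0 = \<theta>\<^sub>0" "th1 = \<theta>\<^sub>1" by (simp_all add: th0_def th1_def \<theta>\<^sub>0_def \<theta>\<^sub>1_def)
  have ext: "exterior_riemann_map (lens c\<^sub>0 r0 c\<^sub>1 r1) \<Phi>"
    unfolding r using \<open>exterior_riemann_map E \<Phi>\<close> unfolding E_def .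
  have "onorm (op_poly (F n) A) \<le> 2 + 4 * \<theta>\<^sub>0 / pi" if n: "n \<ge> 1" for n
  proof (rule onorm_bound)
    show "0 \<le> 2 + 4 * \<theta>\<^sub>0 / pi" using th0 th by simp
    fix u
    define w where "w = op_poly (F n) A u"
    show "norm (op_poly (F n) A u) \<le> (2 + 4 * \<theta>\<^sub>0 / pi) * norm u"
    proof (cases "u = 0 \<or> w = 0")
      case True
      have "(A ^^ i) 0 = 0" for i by (induction i) (simp_all add: op.A.zero)
      hence "w = 0" using True by (auto simp: w_def op_poly_def)
      thus ?thesis using th0 th by (simp add: w_def)
    next
      case False
      \<comment> \<open>Rescaling \<open>w\<close> to the norm of \<open>u\<close> turns the mean of
        the squared norms in \<open>norm_coef_le\<close> into
        \<open>(norm u)\<^sup>2\<close>.\<close>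
      define v where "v = complex_of_real (norm u / norm w) *\<^sub>C w"
      have v: "norm v = norm u" using False by (simp add: v_def norm_divide)
      have "cinner w v = of_real (norm u * norm w)"
        using False by (simp add: v_def cinner_scaleC_right cinner_self power2_eq_square)
      moreover have "coef u v n = cinner w v"
        unfolding w_def by (rule coef_eq_op_poly[OF ext]) (fact assms)
      ultimately have "norm u * norm w = cmod (coef u v n)" by (simp add: norm_mult)
      also have "\<dots> \<le> (2 + 4 * \<theta>\<^sub>0 / pi) * (norm u)\<^sup>2"
        using norm_coef_le[OF n, of u v] by (simp add: v th)
      finally have "norm u * norm w \<le> norm u * ((2 + 4 * \<theta>\<^sub>0 / pi) * norm u)"
        by (simp add: power2_eq_square mult_ac)
      thus ?thesis using False by (simp add: w_def)
    qed
  qed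
  moreover have "\<gamma> = cmod (chi 0)"
  proof -
    have "0 \<notin> lens c\<^sub>0 r0 c\<^sub>1 r1" unfolding r by (rule zero_notin_lens) (fact assms)+
    thus ?thesis using exterior_map_eq[OF ext] by (simp add: \<gamma>_def norm_divide)
  qed
  hence "\<gamma> = sin (Arg a / b) / sin ((pi + th0 - Arg a) / b)"
    using norm_chi_0[unfolded r, OF \<open>0 < c\<^sub>0 + r\<^sub>0\<close> \<open>c\<^sub>0 - r\<^sub>0 < c\<^sub>1 - r\<^sub>1\<close>] by simp
  hence "\<gamma> = sin (pi * Arg a / (2 * pi - \<theta>\<^sub>1 + \<theta>\<^sub>0)) /
        sin (pi * (pi + \<theta>\<^sub>0 - Arg a) / (2 * pi - \<theta>\<^sub>1 + \<theta>\<^sub>0))"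
    by (simp add: b_def th mult.commute)
  ultimately show ?thesis by blast
qed

end
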